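(* Let $m,n\ge 0$ be integers with $n\mid m/\gcd(2,m)$, and let $(A,B;D)$ be an amalgam of groups in the variety $(m,n)$. The amalgam is weakly embeddable in $(m,n)$ if and only if the following two conditions are satisfied: (1) $A^nA'\cap D\subseteq Z(B)$ and $B^nB'\cap D\subseteq Z(A)$. (2) For every integer $k>0$, all integers $q_i>0$ with $q_i\mid n$, all $a_i\in A$, $a_i'\in A^nA'$ with $a_i^{q_i}a_i'\in D$, all $b_i\in B$, $b_i'\in B^nB'$ with $b_i^{q_i}b_i'\in D$ ($i=1,\ldots,k$), and each $d\in D$, $$\prod_{i=1}^k[a_i,b_i^{q_i}b_i']=d\iff\prod_{i=1}^k[a_i^{q_i}a_i',b_i]=d,$$ where the first product is computed in $A$ and the second in $B$.
   Context: Commutators are $[x,y]=x^{-1}y^{-1}xy$ and $[x,y,z]=[[x,y],z]$; $G'=[G,G]$; $Z(G)$ is the center. For $k>0$, $G^k$ is the subgroup generated by all $k$-th powers of elements of $G$, and $G^0=\{e\}$. Every integer divides $0$, and $0$ divides only $0$. For nonnegative integers $m,n$ with $n\mid m/\gcd(2,m)$, $(m,n)$ denotes the variety (class) of all groups satisfying the identities $x^m=[x_1,x_2]^n=[x_1,x_2,x_3]=e$. In particular $(0,0)=\mathcal N_2$ is the variety of all nilpotent groups of class at most two. An amalgam $(A,B;D)$ of groups in a class $\mathcal C$ consists of groups $A,B,D\in\mathcal C$ together with injective homomorphisms $D\to A$ and $D\to B$; $D$ is identified with its images, so it is regarded as a subgroup of both $A$ and $B$. It is weakly embeddable in $\mathcal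 C$ if there are $M\in\mathcal C$ and injective homomorphisms $\lambda_A\colon A\to M$, $\lambda_B\colon B\to M$ which agree on $D$. *)

theory Defs
  imports "HOL-Algebra.Algebra"
begin

definition commutator :: "('a, 'r) monoid_scheme \<Rightarrow> 'a \<Rightarrow> 'a \<Rightarrow> 'a" where
  "commutator G x y = inv\<^bsub>G\<^esub> x \<otimes>\<^bsub>G\<^esub> inv\<^bsub>G\<^esub> y \<otimes>\<^bsub>G\<^esub> x \<otimes>\<^bsub>G\<^esub> y"

definition center :: "('a, 'r) monoid_scheme \<Rightarrow> 'a set" where
  "center G = {z \<in> carrier G. \<forall>x \<in> carrier G. z \<otimes>\<^bsub>G\<^esub> x = x \<otimes>\<^bsub>G\<^esub> z}"

definition power_subgroup :: "('a, 'r) monoid_scheme \<Rightarrow> nat \<Rightarrow> 'a set" where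
  "power_subgroup G k =
     (if k = 0 then {\<one>\<^bsub>G\<^esub>} else generate G {x [^]\<^bsub>G\<^esub> k | x. x \<in> carrier G})"

abbreviation commutator_subgroup :: "('a, 'r) monoid_scheme \<Rightarrow> 'a set" where
  "commutator_subgroup G \<equiv> derived G (carrier G)"

text \<open>The library builds \<^const>\<open>derived\<close> from the commutators \<open>x y x\<inverse> y\<inverse>\<close>. The convention
  \<open>x\<inverse> y\<inverse> x y\<close> used here gives the same subgroup.\<close>

lemma (in group) commutator_subgroup_eq:
  "commutator_subgroup G =
     generate G {commutator G x y | x y. x \<in> carrier G \<and> y \<in> carrier G}"
proof -
  have "derived_set G (carrier G) = {commutator G x y | x y. x \<in> carrier G \<and> y \<in> carrier G}"
    (is "?L = ?R")
  proof
    show "?L \<subseteq> ?R"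
    proof
      fix z assume "z \<in> ?L"
      then obtain x y where xy: "x \<in> carrier G" "y \<in> carrier G" "z = x \<otimes> y \<otimes> inv x \<otimes> inv y"
        by blast
      then have "z = commutator G (inv x) (inv y)"
        by (simp add: commutator_def)
      with xy show "z \<in> ?R" by blast
    qed
    show "?R \<subseteq> ?L"
    proof
      fix z assume "z \<in> ?R"
      then obtain x y where xy: "x \<in> carrier G" "y \<in> carrier G" "z = commutator G x y"
        by blast
      then have "z = inv x \<otimes> inv y \<otimes> inv (inv x) \<otimes> inv (inv y)"
        by (simp add: commutator_def)
      moreover have "inv x \<in> carrier G" "inv y \<in> carrier G"
        using xy by simp_all
      ultimately show "z \<in> ?L" by blast
    qed
  qed
  then show ?thesis by (simp add: derived_def)
qed

text \<open>The ordered product \<open>f 1 \<otimes> f 2 \<otimes> \<dots> \<otimes> f k\<close>, for a group that need not be commutative.\<close>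

definition ordered_prod :: "('a, 'r) monoid_scheme \<Rightarrow> (nat \<Rightarrow> 'a) \<Rightarrow> nat \<Rightarrow> 'a" where
  "ordered_prod G f k = foldr (\<otimes>\<^bsub>G\<^esub>) (map f [1..<Suc k]) \<one>\<^bsub>G\<^esub>"

definition in_variety :: "nat \<Rightarrow> nat \<Rightarrow> ('a, 'r) monoid_scheme \<Rightarrow> bool" where
  "in_variety m n G \<longleftrightarrow>
     group G \<and>
     (\<forall>x \<in> carrier G. x [^]\<^bsub>G\<^esub> m = \<one>\<^bsub>G\<^esub>) \<and>
     (\<forall>x \<in> carrier G. \<forall>y \<in> carrier G. commutator G x y [^]\<^bsub>G\<^esub> n = \<one>\<^bsub>G\<^esub>) \<and>
     (\<forall>x \<in> carrier G. \<forall>y \<in> carrier G. \<forall>z \<in> carrier G.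
        commutator G (commutator G x y) z = \<one>\<^bsub>G\<^esub>)"

definition amalgam ::
  "nat \<Rightarrow> nat \<Rightarrow> ('a, 'r) monoid_scheme \<Rightarrow> ('b, 's) monoid_scheme \<Rightarrow> ('d, 't) monoid_scheme
     \<Rightarrow> ('d \<Rightarrow> 'a) \<Rightarrow> ('d \<Rightarrow> 'b) \<Rightarrow> bool" where
  "amalgam m n A B D \<alpha> \<beta> \<longleftrightarrow>
     in_variety m n A \<and> in_variety m n B \<and> in_variety m n D \<and>
     \<alpha> \<in> hom D A \<and> inj_on \<alpha> (carrier D) \<and>
     \<beta> \<in> hom D B \<and> inj_on \<beta> (carrier D)"

definition weak_embedding ::
  "nat \<Rightarrow> nat \<Rightarrow> ('a, 'r) monoid_scheme \<Rightarrow> ('b, 's) monoid_scheme \<Rightarrow> ('d, 't) monoid_scheme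
     \<Rightarrow> ('d \<Rightarrow> 'a) \<Rightarrow> ('d \<Rightarrow> 'b)
     \<Rightarrow> ('m, 'u) monoid_scheme \<Rightarrow> ('a \<Rightarrow> 'm) \<Rightarrow> ('b \<Rightarrow> 'm) \<Rightarrow> bool" where
  "weak_embedding m n A B D \<alpha> \<beta> M \<phi> \<psi> \<longleftrightarrow>
     in_variety m n M \<and>
     \<phi> \<in> hom A M \<and> inj_on \<phi> (carrier A) \<and>
     \<psi> \<in> hom B M \<and> inj_on \<psi> (carrier B) \<and>
     (\<forall>d \<in> carrier D. \<phi> (\<alpha> d) = \<psi> (\<beta> d))"

text \<open>HOL cannot quantify existentially over the type of \<open>M\<close>. Words over \<open>A + B\<close> are a large
  enough supply of elements, because the images of \<open>A\<close> and \<open>B\<close> generate a subgroup of \<open>M\<close> each of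
  whose elements is the value of such a word. Lemma \<open>weakly_embeddableI\<close> below proves that a
  weak embedding into a group of the variety over any type whatsoever yields one over this
  type, so no generality is lost.\<close>

definition weakly_embeddable ::
  "nat \<Rightarrow> nat \<Rightarrow> ('a, 'r) monoid_scheme \<Rightarrow> ('b, 's) monoid_scheme \<Rightarrow> ('d, 't) monoid_scheme
     \<Rightarrow> ('d \<Rightarrow> 'a) \<Rightarrow> ('d \<Rightarrow> 'b) \<Rightarrow> bool" where
  "weakly_embeddable m n A B D \<alpha> \<beta> \<longleftrightarrow>
     (\<exists>(M :: ('a + 'b) list monoid) \<phi> \<psi>. weak_embedding m n A B D \<alpha> \<beta> M \<phi> \<psi>)"

lemma in_variety_inj_hom:
  assumes M: "in_variety m n M" and N: "group N"
    and h: "h \<in> hom N M" and inj: "inj_on h (carrier N)"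
  shows "in_variety m n N"
proof -
  have gM: "group M" using M by (simp add: in_variety_def)
  interpret h: group_hom N M h
    using N gM h by (simp add: group_hom_def group_hom_axioms_def)
  have comm_closed: "commutator N x y \<in> carrier N"
    if "x \<in> carrier N" "y \<in> carrier N" for x y
    using that by (simp add: commutator_def)
  have h_comm: "h (commutator N x y) = commutator M (h x) (h y)"
    if "x \<in> carrier N" "y \<in> carrier N" for x y
    using that by (simp add: commutator_def)
  have eq1: "x = \<one>\<^bsub>N\<^esub>" if "x \<in> carrier N" "h x = \<one>\<^bsub>M\<^esub>" for x
    using inj_onD[OF inj, of x "\<one>\<^bsub>N\<^esub>"] that by simp
  show ?thesis
    unfolding in_variety_def
  proof (intro conjI ballI)
    show "group N" by (fact N)
  next
    fix x assume "x \<in> carrier N"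
    then show "x [^]\<^bsub>N\<^esub> m = \<one>\<^bsub>N\<^esub>"
      using M by (intro eq1) (simp_all add: h.hom_nat_pow in_variety_def)
  next
    fix x y assume "x \<in> carrier N" "y \<in> carrier N"
    then show "commutator N x y [^]\<^bsub>N\<^esub> n = \<one>\<^bsub>N\<^esub>"
      using M by (intro eq1) (simp_all add: h.hom_nat_pow comm_closed h_comm in_variety_def)
  next
    fix x y z assume "x \<in> carrier N" "y \<in> carrier N" "z \<in> carrier N"
    then show "commutator N (commutator N x y) z = \<one>\<^bsub>N\<^esub>"
      using M by (intro eq1) (simp_all add: comm_closed h_comm in_variety_def)
  qed
qed

lemma weakly_embeddableI:
  fixes M :: "('m, 'u) monoid_scheme"
    and A :: "('a, 'r) monoid_scheme" and B :: "('b, 's) monoid_scheme"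
  assumes A: "group A" and B: "group B" and emb: "weak_embedding m n A B D \<alpha> \<beta> M \<phi> \<psi>"
  shows "weakly_embeddable m n A B D \<alpha> \<beta>"
proof -
  have M: "in_variety m n M" and hA: "\<phi> \<in> hom A M" and iA: "inj_on \<phi> (carrier A)"
    and hB: "\<psi> \<in> hom B M" and iB: "inj_on \<psi> (carrier B)"
    and agree: "\<forall>d \<in> carrier D. \<phi> (\<alpha> d) = \<psi> (\<beta> d)"
    using emb by (auto simp: weak_embedding_def)
  interpret M: group M using M by (simp add: in_variety_def)
  interpret hA: group_hom A M \<phi>
    using A hA by (simp add: group_hom_def group_hom_axioms_def M.group_axioms)
  interpret hB: group_hom B M \<psi>
    using B hB by (simp add: group_hom_def group_hom_axioms_def M.group_axioms)
  define T where "T = \<phi> ` carrier A \<union> \<psi> ` carrier B"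
  define S where "S = generate M T"
  have T: "T \<subseteq> carrier M" by (auto simp: T_def)
  have subS: "subgroup S M" unfolding S_def by (rule M.generate_is_subgroup[OF T])
  have TS: "T \<subseteq> S" unfolding S_def by (auto intro: generate.incl)
  define L where "L = lists (Inl ` carrier A \<union> Inr ` carrier B :: ('a + 'b) set)"
  define ev where "ev w = foldr (\<otimes>\<^bsub>M\<^esub>) (map (case_sum \<phi> \<psi>) w) \<one>\<^bsub>M\<^esub>" for w :: "('a + 'b) list"
  have ev_Nil: "ev [] = \<one>\<^bsub>M\<^esub>" by (simp add: ev_def)
  have ev_Cons: "ev (c # w) = case_sum \<phi> \<psi> c \<otimes>\<^bsub>M\<^esub> ev w" for c w by (simp add: ev_def)
  have c_closed: "case_sum \<phi> \<psi> c \<in> carrier M" if "c \<in> Inl ` carrier A \<union> Inr ` carrier B" for c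
    using that by auto
  have ev_closed: "ev w \<in> carrier M" if "w \<in> L" for w
    using that unfolding L_def
    by (induction w rule: lists.induct) (simp_all add: ev_Nil ev_Cons c_closed del: Un_iff)
  have ev_append: "ev (v @ w) = ev v \<otimes>\<^bsub>M\<^esub> ev w" if "v \<in> L" "w \<in> L" for v w
    using that(1) unfolding L_def
  proof (induction v rule: lists.induct)
    case Nil
    then show ?case using ev_closed[OF that(2)] by (simp add: ev_Nil)
  next
    case (Cons c v)
    then have "ev v \<in> carrier M" using ev_closed by (simp add: L_def)
    then show ?case
      using Cons c_closed[OF Cons(1)] ev_closed[OF that(2)] by (simp add: ev_Cons M.m_assoc)
  qed
  have single: "\<exists>w \<in> L. ev w = t" if "t \<in> T" for t
  proof -
    have "T = case_sum \<phi> \<psi> ` (Inl ` carrier A \<union> Inr ` carrier B)"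
      by (simp add: T_def image_Un image_image)
    with that obtain c where c: "c \<in> Inl ` carrier A \<union> Inr ` carrier B" "t = case_sum \<phi> \<psi> c"
      by blast
    then have "[c] \<in> L" "ev [c] = t"
      using c(1) c_closed[OF c(1)] by (simp_all add: L_def ev_Cons ev_Nil c(2))
    then show ?thesis by blast
  qed
  have T_inv: "inv\<^bsub>M\<^esub> t \<in> T" if t: "t \<in> T" for t
  proof -
    consider x where "x \<in> carrier A" "t = \<phi> x" | y where "y \<in> carrier B" "t = \<psi> y"
      using t unfolding T_def by blast
    then show ?thesis
    proof cases
      case 1
      then have "inv\<^bsub>M\<^esub> t = \<phi> (inv\<^bsub>A\<^esub> x)" by simp
      with 1 show ?thesis by (simp add: T_def del: hA.hom_inv)
    next
      case 2
      then have "inv\<^bsub>M\<^esub> t = \<psi> (inv\<^bsub>B\<^esub> y)" by simp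
      with 2 show ?thesis by (simp add: T_def del: hB.hom_inv)
    qed
  qed
  have S_ev: "\<exists>w \<in> L. ev w = s" if "s \<in> S" for s
    using that unfolding S_def
  proof (induction s rule: generate.induct)
    case one
    have "[] \<in> L" by (simp add: L_def)
    then show ?case using ev_Nil by blast
  next
    case (incl h)
    then show ?case by (rule single)
  next
    case (inv h)
    then show ?case by (intro single T_inv)
  next
    case (eng h1 h2)
    then obtain v w where "v \<in> L" "ev v = h1" "w \<in> L" "ev w = h2" by blast
    then have "v @ w \<in> L" "ev (v @ w) = h1 \<otimes>\<^bsub>M\<^esub> h2"
      using ev_append by (auto simp: L_def)
    then show ?case by blast
  qed
  define SM where "SM = M\<lparr>carrier := S\<rparr>"
  have carSM: "carrier SM = S" and multSM: "(\<otimes>\<^bsub>SM\<^esub>) = (\<otimes>\<^bsub>M\<^esub>)"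
    by (simp_all add: SM_def)
  have gS: "group SM"
    unfolding SM_def using subgroup.subgroup_is_group[OF subS M.group_axioms] .
  define g where "g = inv_into UNIV ev"
  have ev_g: "ev (g s) = s" if "s \<in> S" for s
    unfolding g_def using S_ev[OF that] by (intro f_inv_into_f) auto
  have inj_g: "inj_on g (carrier SM)"
    unfolding carSM by (rule inj_on_inverseI[of _ ev]) (rule ev_g)
  define N where "N = image_group g SM"
  have gN: "group N"
    unfolding N_def by (rule group.inj_imp_image_group_is_group[OF gS inj_g])
  have g_iso: "g \<in> iso SM N"
    unfolding N_def by (rule inj_imp_image_group_iso[OF inj_g])
  then have g_hom: "g \<in> hom SM N" and carN: "carrier N = g ` S"
    by (auto simp: iso_def bij_betw_def carSM)
  have g_mult: "g (x \<otimes>\<^bsub>M\<^esub> y) = g x \<otimes>\<^bsub>N\<^esub> g y" if "x \<in> S" "y \<in> S" for x y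
    using hom_mult[OF g_hom, of x y] that by (simp add: carSM multSM)
  have S_mult: "x \<otimes>\<^bsub>M\<^esub> y \<in> S" if "x \<in> S" "y \<in> S" for x y
    using subgroup.m_closed[OF subS that] .
  have S_car: "S \<subseteq> carrier M" using subgroup.subset[OF subS] .
  have ev_hom: "ev \<in> hom N M"
  proof (rule homI)
    show "ev x \<in> carrier M" if "x \<in> carrier N" for x
      using that S_car by (auto simp: carN ev_g)
    show "ev (x \<otimes>\<^bsub>N\<^esub> y) = ev x \<otimes>\<^bsub>M\<^esub> ev y" if "x \<in> carrier N" "y \<in> carrier N" for x y
    proof -
      from that obtain s t where st: "s \<in> S" "x = g s" "t \<in> S" "y = g t" by (auto simp: carN)
      then have "ev (x \<otimes>\<^bsub>N\<^esub> y) = ev (g (s \<otimes>\<^bsub>M\<^esub> t))" by (simp add: g_mult)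
      then show ?thesis by (simp add: st ev_g S_mult)
    qed
  qed
  have ev_inj: "inj_on ev (carrier N)"
    by (auto simp: inj_on_def carN ev_g)
  have N: "in_variety m n N"
    by (rule in_variety_inj_hom[OF M gN ev_hom ev_inj])
  have AS: "\<phi> x \<in> S" if "x \<in> carrier A" for x using that TS by (auto simp: T_def)
  have BS: "\<psi> x \<in> S" if "x \<in> carrier B" for x using that TS by (auto simp: T_def)
  have "weak_embedding m n A B D \<alpha> \<beta> N (g \<circ> \<phi>) (g \<circ> \<psi>)"
    unfolding weak_embedding_def
  proof (intro conjI ballI)
    show "in_variety m n N" by (fact N)
    show "g \<circ> \<phi> \<in> hom A N"
      by (rule homI) (simp_all add: AS carN g_mult)
    show "g \<circ> \<psi> \<in> hom B N"
      by (rule homI) (simp_all add: BS carN g_mult)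
    show "inj_on (g \<circ> \<phi>) (carrier A)"
      using iA inj_g AS by (intro comp_inj_on) (auto simp: carSM intro: inj_on_subset)
    show "inj_on (g \<circ> \<psi>) (carrier B)"
      using iB inj_g BS by (intro comp_inj_on) (auto simp: carSM intro: inj_on_subset)
    show "(g \<circ> \<phi>) (\<alpha> d) = (g \<circ> \<psi>) (\<beta> d)" if "d \<in> carrier D" for d
      using agree that by simp
  qed
  then show ?thesis unfolding weakly_embeddable_def by blast
qed

end

theory Submission
  imports Defs
begin

text \<open>
  Write \<open>V(G) = G\<^sup>n G'\<close>, which is central in every group of the variety. In an overgroup \<open>M\<close> the
  commutators \<open>[a, b]\<close> with \<open>a \<in> A\<close>, \<open>b \<in> B\<close> define a bilinear map on \<open>A/V(A) \<times> B/V(B)\<close> that is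
  prescribed on \<open>A \<times> D\<close> (by commutators of \<open>A\<close>) and on \<open>D \<times> B\<close> (by commutators of \<open>B\<close>). Condition (1)
  makes these two partial maps well defined on the quotients, and both sides in condition (2) are
  evaluations of \<open>[a, b]\<^sup>q\<close>, so (1) and (2) are necessary.

  Conversely, (2) says that \<open>A\<close> and \<open>B\<close> survive when the two partial maps are given values in a common
  abelian group in which the relations \<open>[a, b\<^sup>q b'] = [a\<^sup>q a', b]\<close> hold. Then the partial maps extend to a
  bilinear map on all of \<open>A/V(A) \<times> B/V(B)\<close> with values in an abelian overgroup. This rests on a
  computation of the kernel of \<open>P \<otimes> V \<oplus> U \<otimes> Q \<rightarrow> P \<otimes> Q\<close> for subgroups \<open>U \<le> P\<close>, \<open>V \<le> Q\<close>: bringing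
  an integer matrix to diagonal form shows that it is generated by the elements
  \<open>(x \<otimes> q y, - q x \<otimes> y)\<close>. The bilinear map serves as the cocycle of a group on \<open>A \<times> B \<times> E\<close>,
  and a quotient of that group contains the amalgam.
\<close>

section \<open>Integer matrices and partial bilinear maps\<close>

text \<open>Condition (2) supplies relations only for divisors q of n, while a diagonal form of an
  integer matrix has arbitrary entries k. The gap closes because both quotients have exponent n: if
  the k-th powers of x and y lie in the prescribed subgroups, then so do their gcd(k, n)-th powers.
  For n = 0 and k nonzero this gcd is the absolute value of k, so n = 0 fits the same argument.

  The values of the bilinear map become commutators of the overgroup, so they must have exponent n,
  which V(A) and V(B) need not have. Hence the common abelian group is a quotient of the direct
  product of the n-torsion parts of V(A) and V(B). Elements of the subgroup factored out are the
  pairs of products in condition (2), the second one inverted. Quantifying over d expresses at once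
  that both factors embed and that their elements become equal only in accordance with D.

  The hypothesis on m and n makes n divide both m and m(m-1)/2; the latter is the exponent with
  which the cocycle enters an m-th power in the constructed group.\<close>

lemma hom_finprod_comm_group:
  assumes "comm_group G" "comm_group H" and h: "h \<in> hom G H" and f: "f \<in> I \<rightarrow> carrier G"
  shows "h (finprod G f I) = finprod H (\<lambda>i. h (f i)) I"
proof -
  interpret G: comm_group G by fact
  interpret H: comm_group H by fact
  interpret h: group_hom G H h by unfold_locales (rule h)
  show ?thesis
    using f
  proof (induction I rule: infinite_finite_induct)
    case (insert i I)
    then have "(\<lambda>i. h (f i)) \<in> I \<rightarrow> carrier H" by (auto simp: Pi_iff)
    with insert show ?case by (auto simp: Pi_iff)
  qed auto
qed

section \<open>Finite products in abelian groups\<close>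

context comm_group
begin

lemma finprod_int_pow:
  assumes "f \<in> I \<rightarrow> carrier G"
  shows "finprod G f I [^] (k :: int) = finprod G (\<lambda>i. f i [^] k) I"
proof -
  have "(\<lambda>x. x [^] k) \<in> hom G G" by (auto simp: hom_def int_pow_distrib)
  from hom_finprod_comm_group[OF comm_group_axioms comm_group_axioms this assms]
  show ?thesis by simp
qed

lemma finprod_remove:
  assumes "finite I" "i \<in> I" "f \<in> I \<rightarrow> carrier G"
  shows "finprod G f I = f i \<otimes> finprod G f (I - {i})"
proof -
  have "finprod G f (insert i (I - {i})) = f i \<otimes> finprod G f (I - {i})"
    using assms by (intro finprod_insert) auto
  then show ?thesis using assms(2) by (simp add: insert_absorb)
qed

text \<open>A row operation on a matrix affects only the factors at i and j; this compares the
  products before and after.\<close>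

lemma finprod_cong_two:
  assumes "finite I" "i \<in> I" "j \<in> I" "i \<noteq> j"
    and "f \<in> I \<rightarrow> carrier G" "h \<in> I \<rightarrow> carrier G"
    and "f i \<otimes> f j = h i \<otimes> h j" and "\<And>k. k \<in> I \<Longrightarrow> k \<noteq> i \<Longrightarrow> k \<noteq> j \<Longrightarrow> f k = h k"
  shows "finprod G f I = finprod G h I"
proof -
  have split: "finprod G \<phi> I = \<phi> i \<otimes> \<phi> j \<otimes> finprod G \<phi> (I - {i} - {j})"
    if "\<phi> \<in> I \<rightarrow> carrier G" for \<phi>
  proof -
    have "finprod G \<phi> I = \<phi> i \<otimes> finprod G \<phi> (I - {i})"
      using assms that by (intro finprod_remove) auto
    also have "finprod G \<phi> (I - {i}) = \<phi> j \<otimes> finprod G \<phi> (I - {i} - {j})"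
      using assms that by (intro finprod_remove) auto
    finally show ?thesis
      using assms that by (subst m_assoc) (auto simp: Pi_iff intro!: finprod_closed)
  qed
  have "finprod G f (I - {i} - {j}) = finprod G h (I - {i} - {j})"
    using assms by (intro finprod_cong') auto
  then show ?thesis using assms split[of f] split[of h] by simp
qed

lemma finprod_single_support:
  assumes "finite I" "i \<in> I" "f \<in> I \<rightarrow> carrier G" "\<And>k. k \<in> I \<Longrightarrow> k \<noteq> i \<Longrightarrow> f k = \<one>"
  shows "finprod G f I = f i"
proof -
  have "finprod G f (I - {i}) = \<one>" using assms by (intro finprod_one_eqI) auto
  then show ?thesis using assms finprod_remove[of I i f] by (auto simp: Pi_iff)
qed

end

text \<open>By Bezout the gcd is s k + t n, and the power with exponent t n is trivial. This reduces
  integer exponents to divisors of n.\<close>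

lemma (in group) subgroup_gcd_pow:
  assumes "subgroup H G" "x \<in> carrier G" "x [^] n = \<one>" "x [^] (k :: int) \<in> H"
  shows "x [^] gcd k (int n) \<in> H"
proof -
  obtain s t where "s * k + t * int n = gcd k (int n)" using bezout_int by blast
  then have "x [^] gcd k (int n) = x [^] (k * s + int n * t)" by (simp add: mult.commute)
  also have "\<dots> = (x [^] k) [^] s \<otimes> (x [^] int n) [^] t"
    using assms by (simp add: int_pow_mult int_pow_pow)
  also have "\<dots> = (x [^] k) [^] s" using assms by (simp add: int_pow_int)
  finally show ?thesis using subgroup_int_pow_closed[OF assms(1,4)] by simp
qed

text \<open>In the application \<open>P\<close> and \<open>Q\<close> are A/V(A) and B/V(B),
  \<open>U\<close> and \<open>V\<close> are the images of D in them, \<open>f\<close> comes from the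
  commutators of A with D and \<open>g\<close> from those of D with B. The axiom
  \<open>compat\<close> is the relation of condition (2); for q = 1 it says that \<open>f\<close>
  and \<open>g\<close> agree on U x V.\<close>

locale partial_bilinear =
  P: comm_group P + Q: comm_group Q + C: comm_group C + U: subgroup U P + V: subgroup V Q
  for P :: "('x, 'r) monoid_scheme" and Q :: "('y, 's) monoid_scheme"
    and C :: "('c, 't) monoid_scheme" and U and V +
  fixes f :: "'x \<Rightarrow> 'y \<Rightarrow> 'c" and g :: "'x \<Rightarrow> 'y \<Rightarrow> 'c" and n :: nat
  assumes f_closed: "x \<in> carrier P \<Longrightarrow> v \<in> V \<Longrightarrow> f x v \<in> carrier C"
    and f_mult_left: "x \<in> carrier P \<Longrightarrow> x' \<in> carrier P \<Longrightarrow> v \<in> V \<Longrightarrow>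
      f (x \<otimes>\<^bsub>P\<^esub> x') v = f x v \<otimes>\<^bsub>C\<^esub> f x' v"
    and f_mult_right: "x \<in> carrier P \<Longrightarrow> v \<in> V \<Longrightarrow> v' \<in> V \<Longrightarrow>
      f x (v \<otimes>\<^bsub>Q\<^esub> v') = f x v \<otimes>\<^bsub>C\<^esub> f x v'"
    and g_closed: "u \<in> U \<Longrightarrow> y \<in> carrier Q \<Longrightarrow> g u y \<in> carrier C"
    and g_mult_left: "u \<in> U \<Longrightarrow> u' \<in> U \<Longrightarrow> y \<in> carrier Q \<Longrightarrow>
      g (u \<otimes>\<^bsub>P\<^esub> u') y = g u y \<otimes>\<^bsub>C\<^esub> g u' y"
    and g_mult_right: "u \<in> U \<Longrightarrow> y \<in> carrier Q \<Longrightarrow> y' \<in> carrier Q \<Longrightarrow>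
      g u (y \<otimes>\<^bsub>Q\<^esub> y') = g u y \<otimes>\<^bsub>C\<^esub> g u y'"
    and compat: "q > 0 \<Longrightarrow> q dvd n \<Longrightarrow> x \<in> carrier P \<Longrightarrow> y \<in> carrier Q \<Longrightarrow>
      x [^]\<^bsub>P\<^esub> q \<in> U \<Longrightarrow> y [^]\<^bsub>Q\<^esub> q \<in> V \<Longrightarrow> f x (y [^]\<^bsub>Q\<^esub> q) = g (x [^]\<^bsub>P\<^esub> q) y"
    and exp_P: "x \<in> carrier P \<Longrightarrow> x [^]\<^bsub>P\<^esub> n = \<one>\<^bsub>P\<^esub>"
    and exp_Q: "y \<in> carrier Q \<Longrightarrow> y [^]\<^bsub>Q\<^esub> n = \<one>\<^bsub>Q\<^esub>"
begin

text \<open>The axioms are symmetric in the two sides, so every fact about \<open>f\<close> yields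
  one about \<open>g\<close>, and every row operation yields a column operation.\<close>

lemma swap: "partial_bilinear Q P C V U (\<lambda>y x. g x y) (\<lambda>y x. f x y) n"
  by unfold_locales
    (auto simp: f_closed f_mult_left f_mult_right g_closed g_mult_left g_mult_right compat exp_P exp_Q)

lemma f_hom_left: "v \<in> V \<Longrightarrow> (\<lambda>x. f x v) \<in> hom P C"
  by (auto simp: hom_def f_closed f_mult_left)

lemma f_hom_right: "x \<in> carrier P \<Longrightarrow> f x \<in> hom (Q\<lparr>carrier := V\<rparr>) C"
  by (auto simp: hom_def f_closed f_mult_right)

lemma f_pow_left:
  assumes "x \<in> carrier P" "v \<in> V"
  shows "f (x [^]\<^bsub>P\<^esub> (k :: int)) v = f x v [^]\<^bsub>C\<^esub> k"
  using hom_int_pow[OF f_hom_left[OF assms(2)] assms(1)] by simp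

lemma V_pow: "v \<in> V \<Longrightarrow> v [^]\<^bsub>Q\<^esub> (k :: int) \<in> V"
  using Q.subgroup_int_pow_closed[OF V.subgroup_axioms] .

lemma f_pow_right:
  assumes "x \<in> carrier P" "v \<in> V"
  shows "f x (v [^]\<^bsub>Q\<^esub> (k :: int)) = f x v [^]\<^bsub>C\<^esub> k"
proof -
  have "f x (v [^]\<^bsub>Q\<lparr>carrier := V\<rparr>\<^esub> k) = f x v [^]\<^bsub>C\<^esub> k"
    using hom_int_pow[OF f_hom_right[OF assms(1)], of v k] assms
      V.subgroup_is_group[OF Q.group_axioms] C.group_axioms by simp
  then show ?thesis using Q.int_pow_consistent[OF V.subgroup_axioms assms(2)] by simp
qed

lemma f_one_left: "v \<in> V \<Longrightarrow> f \<one>\<^bsub>P\<^esub> v = \<one>\<^bsub>C\<^esub>"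
  using f_pow_left[of "\<one>\<^bsub>P\<^esub>" v 0] by simp

lemma f_one_right: "x \<in> carrier P \<Longrightarrow> f x \<one>\<^bsub>Q\<^esub> = \<one>\<^bsub>C\<^esub>"
  using f_pow_right[of x "\<one>\<^bsub>Q\<^esub>" 0] by simp

text \<open>For k nonzero both sides are powers of the two sides of \<open>compat\<close> at q =
  gcd(k, n), which divides n; for k = 0 both are trivial. This is the one-entry case of the matrix
  argument.\<close>

lemma compat_int:
  assumes x: "x \<in> carrier P" and y: "y \<in> carrier Q"
    and xk: "x [^]\<^bsub>P\<^esub> (k :: int) \<in> U" and yk: "y [^]\<^bsub>Q\<^esub> k \<in> V"
  shows "f x (y [^]\<^bsub>Q\<^esub> k) = g (x [^]\<^bsub>P\<^esub> k) y"
proof -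
  interpret S: partial_bilinear Q P C V U "\<lambda>y x. g x y" "\<lambda>y x. f x y" n by (rule swap)
  show ?thesis
  proof (cases "k = 0")
    case True
    then show ?thesis using x y by (simp add: f_one_right S.f_one_right)
  next
    case False
    define q where "q = nat (gcd k (int n))"
    have q: "int q = gcd k (int n)" by (simp add: q_def)
    have pos: "q > 0" using False by (simp add: q_def)
    have "int q dvd int n" using q by simp
    then have dvd: "q dvd n" by simp
    obtain r where r: "k = int q * r" using q by (metis dvd_def gcd_dvd1)
    \<comment> \<open>Exponent n of \<open>P\<close> and \<open>Q\<close> is what brings the q-th
      powers into \<open>U\<close> and \<open>V\<close>; only their k-th powers were assumed to lie
      there.\<close>
    have xq: "x [^]\<^bsub>P\<^esub> int q \<in> U"
      using P.subgroup_gcd_pow[OF U.subgroup_axioms x exp_P[OF x] xk] q by simp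
    have yq: "y [^]\<^bsub>Q\<^esub> int q \<in> V"
      using Q.subgroup_gcd_pow[OF V.subgroup_axioms y exp_Q[OF y] yk] q by simp
    have "f x (y [^]\<^bsub>Q\<^esub> int q) = g (x [^]\<^bsub>P\<^esub> int q) y"
      using compat[OF pos dvd x y] xq yq by (simp add: int_pow_int)
    then have "f x ((y [^]\<^bsub>Q\<^esub> int q) [^]\<^bsub>Q\<^esub> r) = g ((x [^]\<^bsub>P\<^esub> int q) [^]\<^bsub>P\<^esub> r) y"
      using x y xq yq by (simp add: f_pow_right S.f_pow_right)
    then show ?thesis using x y r by (simp add: P.int_pow_pow Q.int_pow_pow)
  qed
qed

text \<open>The two evaluations of \<open>\<Sum>\<^sub>i\<^sub>s w i s (a i \<otimes> y s)\<close>, by rows through \<open>f\<close> and by columns through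
  \<open>g\<close>, agree. The property is invariant under row and column operations on \<open>w\<close>, since these can be
  compensated by a change of \<open>a\<close> or \<open>y\<close>, and for a single entry it is \<open>compat_int\<close>.\<close>

definition balanced :: "'i set \<Rightarrow> 'j set \<Rightarrow> ('i \<Rightarrow> 'j \<Rightarrow> int) \<Rightarrow> bool" where
  "balanced I J w \<longleftrightarrow> (\<forall>a y. a \<in> I \<rightarrow> carrier P \<longrightarrow> y \<in> J \<rightarrow> carrier Q \<longrightarrow>
     (\<forall>s\<in>J. finprod P (\<lambda>i. a i [^]\<^bsub>P\<^esub> w i s) I \<in> U) \<longrightarrow>
     (\<forall>i\<in>I. finprod Q (\<lambda>s. y s [^]\<^bsub>Q\<^esub> w i s) J \<in> V) \<longrightarrow>
     finprod C (\<lambda>i. f (a i) (finprod Q (\<lambda>s. y s [^]\<^bsub>Q\<^esub> w i s) J)) I =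
     finprod C (\<lambda>s. g (finprod P (\<lambda>i. a i [^]\<^bsub>P\<^esub> w i s) I) (y s)) J)"

lemma balanced_swap:
  "balanced I J w \<longleftrightarrow> partial_bilinear.balanced Q P C V U (\<lambda>y x. g x y) (\<lambda>y x. f x y) J I (\<lambda>s i. w i s)"
proof -
  interpret S: partial_bilinear Q P C V U "\<lambda>y x. g x y" "\<lambda>y x. f x y" n by (rule swap)
  show ?thesis unfolding balanced_def S.balanced_def by (subst eq_commute) blast
qed

section \<open>Elimination on balanced matrices\<close>

lemma balanced_row_op:
  assumes fin: "finite I" "finite J" and ij: "i \<in> I" "j \<in> I" "i \<noteq> j"
    and bal: "balanced I J (w(j := \<lambda>s. w j s - k * w i s))"
  shows "balanced I J w"
  unfolding balanced_def
proof (intro allI impI)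
  fix a y
  assume a: "a \<in> I \<rightarrow> carrier P" and y: "y \<in> J \<rightarrow> carrier Q"
    and col: "\<forall>s\<in>J. finprod P (\<lambda>i. a i [^]\<^bsub>P\<^esub> w i s) I \<in> U"
    and row: "\<forall>i\<in>I. finprod Q (\<lambda>s. y s [^]\<^bsub>Q\<^esub> w i s) J \<in> V"
  define w' where "w' = w(j := \<lambda>s. w j s - k * w i s)"
  \<comment> \<open>Subtracting k times row i from row j is undone in every column product by adding
    k times \<open>a j\<close> to \<open>a i\<close>. The row products do change, but only at j,
    where k times \<open>\<rho> i\<close> is subtracted.\<close>
  define a' where "a' = a(i := a i \<otimes>\<^bsub>P\<^esub> a j [^]\<^bsub>P\<^esub> k)"
  define \<rho> where "\<rho> i = finprod Q (\<lambda>s. y s [^]\<^bsub>Q\<^esub> w i s) J" for i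
  have ac: "a l \<in> carrier P" if "l \<in> I" for l using a that by auto
  have yc: "y s \<in> carrier Q" if "s \<in> J" for s using y that by auto
  have a': "a' \<in> I \<rightarrow> carrier P" using ac ij by (auto simp: a'_def)
  have \<rho>V: "\<rho> l \<in> V" if "l \<in> I" for l using row that by (simp add: \<rho>_def)
  have \<rho>c: "\<rho> l \<in> carrier Q" if "l \<in> I" for l using \<rho>V[OF that] V.subset by auto
  have col': "finprod P (\<lambda>i. a' i [^]\<^bsub>P\<^esub> w' i s) I = finprod P (\<lambda>i. a i [^]\<^bsub>P\<^esub> w i s) I" for s
  proof (rule P.finprod_cong_two[OF fin(1) ij])
    have "(a i \<otimes>\<^bsub>P\<^esub> a j [^]\<^bsub>P\<^esub> k) [^]\<^bsub>P\<^esub> w i s \<otimes>\<^bsub>P\<^esub> a j [^]\<^bsub>P\<^esub> (w j s - k * w i s) =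
      a i [^]\<^bsub>P\<^esub> w i s \<otimes>\<^bsub>P\<^esub> (a j [^]\<^bsub>P\<^esub> (k * w i s) \<otimes>\<^bsub>P\<^esub> a j [^]\<^bsub>P\<^esub> (w j s - k * w i s))"
      using ac ij by (simp add: P.int_pow_distrib P.int_pow_pow P.m_assoc)
    also have "\<dots> = a i [^]\<^bsub>P\<^esub> w i s \<otimes>\<^bsub>P\<^esub> a j [^]\<^bsub>P\<^esub> w j s"
      using ac ij by (simp flip: P.int_pow_mult)
    finally show "a' i [^]\<^bsub>P\<^esub> w' i s \<otimes>\<^bsub>P\<^esub> a' j [^]\<^bsub>P\<^esub> w' j s = a i [^]\<^bsub>P\<^esub> w i s \<otimes>\<^bsub>P\<^esub> a j [^]\<^bsub>P\<^esub> w j s"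
      using ij by (simp add: a'_def w'_def)
  qed (use a' ac ij in \<open>auto simp: a'_def w'_def\<close>)
  have row_other: "finprod Q (\<lambda>s. y s [^]\<^bsub>Q\<^esub> w' l s) J = \<rho> l" if "l \<noteq> j" for l
    using that by (simp add: w'_def \<rho>_def)
  have row_j: "finprod Q (\<lambda>s. y s [^]\<^bsub>Q\<^esub> w' j s) J = \<rho> j \<otimes>\<^bsub>Q\<^esub> \<rho> i [^]\<^bsub>Q\<^esub> (- k)"
  proof -
    have "finprod Q (\<lambda>s. y s [^]\<^bsub>Q\<^esub> w' j s) J
      = finprod Q (\<lambda>s. y s [^]\<^bsub>Q\<^esub> w j s \<otimes>\<^bsub>Q\<^esub> (y s [^]\<^bsub>Q\<^esub> w i s) [^]\<^bsub>Q\<^esub> (- k)) J"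
      using yc by (intro Q.finprod_cong') (auto simp: w'_def Q.int_pow_pow mult.commute simp flip: Q.int_pow_mult)
    also have "\<dots> = \<rho> j \<otimes>\<^bsub>Q\<^esub> finprod Q (\<lambda>s. (y s [^]\<^bsub>Q\<^esub> w i s) [^]\<^bsub>Q\<^esub> (- k)) J"
      unfolding \<rho>_def using yc by (intro Q.finprod_multf) auto
    also have "finprod Q (\<lambda>s. (y s [^]\<^bsub>Q\<^esub> w i s) [^]\<^bsub>Q\<^esub> (- k)) J = \<rho> i [^]\<^bsub>Q\<^esub> (- k)"
      unfolding \<rho>_def using yc by (intro Q.finprod_int_pow[symmetric]) auto
    finally show ?thesis .
  qed
  have row': "finprod Q (\<lambda>s. y s [^]\<^bsub>Q\<^esub> w' l s) J \<in> V" if "l \<in> I" for l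
    using that ij \<rho>V V_pow by (cases "l = j") (auto simp: row_j row_other)
  have "finprod C (\<lambda>i. f (a i) (\<rho> i)) I =
    finprod C (\<lambda>i. f (a' i) (finprod Q (\<lambda>s. y s [^]\<^bsub>Q\<^esub> w' i s) J)) I"
  proof (rule C.finprod_cong_two[OF fin(1) ij])
    have c: "f (a i) (\<rho> i) \<in> carrier C" "f (a j) (\<rho> i) \<in> carrier C" "f (a j) (\<rho> j) \<in> carrier C"
      using ij ac \<rho>V by (auto simp: f_closed)
    \<comment> \<open>Bilinearity produces the mixed term \<open>f (a j) (\<rho> i)\<close> once
      with exponent k and once with exponent -k, so it cancels.\<close>
    have "f (a i \<otimes>\<^bsub>P\<^esub> a j [^]\<^bsub>P\<^esub> k) (\<rho> i) \<otimes>\<^bsub>C\<^esub> f (a j) (\<rho> j \<otimes>\<^bsub>Q\<^esub> \<rho> i [^]\<^bsub>Q\<^esub> (- k))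
      = f (a i) (\<rho> i) \<otimes>\<^bsub>C\<^esub> f (a j) (\<rho> i) [^]\<^bsub>C\<^esub> k \<otimes>\<^bsub>C\<^esub> (f (a j) (\<rho> j) \<otimes>\<^bsub>C\<^esub> f (a j) (\<rho> i) [^]\<^bsub>C\<^esub> (- k))"
      using ij ac \<rho>V V_pow by (simp add: f_mult_left f_mult_right f_pow_left f_pow_right)
    also have "\<dots> = f (a i) (\<rho> i) \<otimes>\<^bsub>C\<^esub> f (a j) (\<rho> j) \<otimes>\<^bsub>C\<^esub>
        (f (a j) (\<rho> i) [^]\<^bsub>C\<^esub> k \<otimes>\<^bsub>C\<^esub> f (a j) (\<rho> i) [^]\<^bsub>C\<^esub> (- k))"
      using c by (simp add: C.m_ac)
    also have "\<dots> = f (a i) (\<rho> i) \<otimes>\<^bsub>C\<^esub> f (a j) (\<rho> j)" using c by (simp flip: C.int_pow_mult)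
    finally show "f (a i) (\<rho> i) \<otimes>\<^bsub>C\<^esub> f (a j) (\<rho> j) =
      f (a' i) (finprod Q (\<lambda>s. y s [^]\<^bsub>Q\<^esub> w' i s) J) \<otimes>\<^bsub>C\<^esub> f (a' j) (finprod Q (\<lambda>s. y s [^]\<^bsub>Q\<^esub> w' j s) J)"
      using ij by (simp add: row_j row_other a'_def)
  qed (use ij ac a' row' \<rho>V in \<open>auto simp: f_closed row_other a'_def\<close>)
  also have "\<dots> = finprod C (\<lambda>s. g (finprod P (\<lambda>i. a' i [^]\<^bsub>P\<^esub> w' i s) I) (y s)) J"
    using bal[folded w'_def] a' y row' col col' unfolding balanced_def by simp
  finally show "finprod C (\<lambda>i. f (a i) (finprod Q (\<lambda>s. y s [^]\<^bsub>Q\<^esub> w i s) J)) I =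
     finprod C (\<lambda>s. g (finprod P (\<lambda>i. a i [^]\<^bsub>P\<^esub> w i s) I) (y s)) J"
    unfolding \<rho>_def by (simp add: col')
qed

lemma balanced_col_op:
  assumes "finite I" "finite J" "s \<in> J" "t \<in> J" "s \<noteq> t"
    and "balanced I J (\<lambda>i. (w i)(t := w i t - k * w i s))"
  shows "balanced I J w"
proof -
  interpret S: partial_bilinear Q P C V U "\<lambda>y x. g x y" "\<lambda>y x. f x y" n by (rule swap)
  have "(\<lambda>s i. w i s)(t := \<lambda>i. w i t - k * w i s) = (\<lambda>s' i. ((w i)(t := w i t - k * w i s)) s')"
    by (auto simp: fun_eq_iff)
  then show ?thesis
    using S.balanced_row_op[of J I s t "\<lambda>s i. w i s" k] assms balanced_swap[of I J]
    by simp
qed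

text \<open>An isolated entry contributes one factor to each evaluation, and these agree by
  \<open>compat_int\<close>. All other row and column products involve only the smaller matrix,
  because the deleted entries in them are zero.\<close>

lemma balanced_split_pivot:
  assumes fin: "finite I" "finite J" and ij: "i \<in> I" "s \<in> J"
    and row0: "\<And>t. t \<in> J \<Longrightarrow> t \<noteq> s \<Longrightarrow> w i t = 0" and col0: "\<And>l. l \<in> I \<Longrightarrow> l \<noteq> i \<Longrightarrow> w l s = 0"
    and bal: "balanced (I - {i}) (J - {s}) w"
  shows "balanced I J w"
  unfolding balanced_def
proof (intro allI impI)
  fix a y
  assume a: "a \<in> I \<rightarrow> carrier P" and y: "y \<in> J \<rightarrow> carrier Q"
    and col: "\<forall>s\<in>J. finprod P (\<lambda>i. a i [^]\<^bsub>P\<^esub> w i s) I \<in> U"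
    and row: "\<forall>i\<in>I. finprod Q (\<lambda>s. y s [^]\<^bsub>Q\<^esub> w i s) J \<in> V"
  have ac: "a l \<in> carrier P" if "l \<in> I" for l using a that by auto
  have yc: "y s \<in> carrier Q" if "s \<in> J" for s using y that by auto
  have rowi: "finprod Q (\<lambda>t. y t [^]\<^bsub>Q\<^esub> w i t) J = y s [^]\<^bsub>Q\<^esub> w i s"
    using fin ij yc row0 by (intro Q.finprod_single_support) auto
  have cols: "finprod P (\<lambda>l. a l [^]\<^bsub>P\<^esub> w l s) I = a i [^]\<^bsub>P\<^esub> w i s"
    using fin ij ac col0 by (intro P.finprod_single_support) auto
  have rowl: "finprod Q (\<lambda>t. y t [^]\<^bsub>Q\<^esub> w l t) J = finprod Q (\<lambda>t. y t [^]\<^bsub>Q\<^esub> w l t) (J - {s})"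
    if "l \<in> I" "l \<noteq> i" for l
    using fin yc that col0 by (intro Q.finprod_mono_neutral_cong_right) auto
  have colt: "finprod P (\<lambda>l. a l [^]\<^bsub>P\<^esub> w l t) I = finprod P (\<lambda>l. a l [^]\<^bsub>P\<^esub> w l t) (I - {i})"
    if "t \<in> J" "t \<noteq> s" for t
    using fin ac that row0 by (intro P.finprod_mono_neutral_cong_right) auto
  have "finprod C (\<lambda>i. f (a i) (finprod Q (\<lambda>s. y s [^]\<^bsub>Q\<^esub> w i s) J)) I
    = f (a i) (y s [^]\<^bsub>Q\<^esub> w i s) \<otimes>\<^bsub>C\<^esub>
      finprod C (\<lambda>i. f (a i) (finprod Q (\<lambda>s. y s [^]\<^bsub>Q\<^esub> w i s) J)) (I - {i})"
    using fin ij ac row by (subst C.finprod_remove[of I i]) (auto simp: f_closed rowi)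
  also have "finprod C (\<lambda>i. f (a i) (finprod Q (\<lambda>s. y s [^]\<^bsub>Q\<^esub> w i s) J)) (I - {i})
    = finprod C (\<lambda>i. f (a i) (finprod Q (\<lambda>s. y s [^]\<^bsub>Q\<^esub> w i s) (J - {s}))) (I - {i})"
    using rowl ac row by (intro C.finprod_cong') (auto simp: f_closed simp flip: rowl)
  also have "\<dots> = finprod C (\<lambda>s. g (finprod P (\<lambda>i. a i [^]\<^bsub>P\<^esub> w i s) (I - {i})) (y s)) (J - {s})"
    using a y row col by (intro bal[unfolded balanced_def, rule_format]) (auto simp flip: rowl colt)
  also have "\<dots> = finprod C (\<lambda>s. g (finprod P (\<lambda>i. a i [^]\<^bsub>P\<^esub> w i s) I) (y s)) (J - {s})"
    using colt yc col by (intro C.finprod_cong') (auto simp: g_closed)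
  \<comment> \<open>Since row i and column s vanish off the pivot, their membership conditions are
    exactly the hypotheses of \<open>compat_int\<close> for k = \<open>w i s\<close>.\<close>
  also have "f (a i) (y s [^]\<^bsub>Q\<^esub> w i s) = g (finprod P (\<lambda>i. a i [^]\<^bsub>P\<^esub> w i s) I) (y s)"
    unfolding cols using ij ac yc row col rowi cols by (intro compat_int) (auto dest!: bspec)
  also have "\<dots> \<otimes>\<^bsub>C\<^esub> finprod C (\<lambda>s. g (finprod P (\<lambda>i. a i [^]\<^bsub>P\<^esub> w i s) I) (y s)) (J - {s})
    = finprod C (\<lambda>s. g (finprod P (\<lambda>i. a i [^]\<^bsub>P\<^esub> w i s) I) (y s)) J"
    using fin ij yc col by (intro C.finprod_remove[symmetric]) (auto simp: g_closed)
  finally show "finprod C (\<lambda>i. f (a i) (finprod Q (\<lambda>s. y s [^]\<^bsub>Q\<^esub> w i s) J)) I =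
     finprod C (\<lambda>s. g (finprod P (\<lambda>i. a i [^]\<^bsub>P\<^esub> w i s) I) (y s)) J" .
qed

lemma balanced_zero:
  assumes "\<And>i s. i \<in> I \<Longrightarrow> s \<in> J \<Longrightarrow> w i s = 0"
  shows "balanced I J w"
  unfolding balanced_def
proof (intro allI impI)
  interpret S: partial_bilinear Q P C V U "\<lambda>y x. g x y" "\<lambda>y x. f x y" n by (rule swap)
  fix a y
  assume a: "a \<in> I \<rightarrow> carrier P" and y: "y \<in> J \<rightarrow> carrier Q"
  have "finprod Q (\<lambda>s. y s [^]\<^bsub>Q\<^esub> w i s) J = \<one>\<^bsub>Q\<^esub>" if "i \<in> I" for i
    using that assms by (intro Q.finprod_one_eqI) simp
  moreover have "finprod P (\<lambda>i. a i [^]\<^bsub>P\<^esub> w i s) I = \<one>\<^bsub>P\<^esub>" if "s \<in> J" for s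
    using that assms by (intro P.finprod_one_eqI) simp
  ultimately have "finprod C (\<lambda>i. f (a i) (finprod Q (\<lambda>s. y s [^]\<^bsub>Q\<^esub> w i s) J)) I = \<one>\<^bsub>C\<^esub>"
    and "finprod C (\<lambda>s. g (finprod P (\<lambda>i. a i [^]\<^bsub>P\<^esub> w i s) I) (y s)) J = \<one>\<^bsub>C\<^esub>"
    using a y by (auto intro!: C.finprod_one_eqI simp: f_one_right S.f_one_right Pi_iff)
  then show "finprod C (\<lambda>i. f (a i) (finprod Q (\<lambda>s. y s [^]\<^bsub>Q\<^esub> w i s) J)) I =
     finprod C (\<lambda>s. g (finprod P (\<lambda>i. a i [^]\<^bsub>P\<^esub> w i s) I) (y s)) J" by simp
qed

text \<open>Euclidean division by the pivot, with a lexicographic measure: first the absolute value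
  of the pivot, then the number of other nonzero entries in its row and column. A nonzero remainder
  is a smaller pivot; a zero remainder lowers the count. The assumption \<open>smaller\<close>
  quantifies over all matrices because the entries have changed by the time the pivot is
  isolated.\<close>

lemma balanced_pivot:
  assumes fin: "finite I" "finite J"
    and smaller: "\<And>i s w. i \<in> I \<Longrightarrow> s \<in> J \<Longrightarrow> balanced (I - {i}) (J - {s}) w"
    and "i \<in> I" "s \<in> J" "w i s \<noteq> 0"
  shows "balanced I J w"
  using assms(4-)
proof (induction "(nat \<bar>w i s\<bar>, card {l \<in> I - {i}. w l s \<noteq> 0} + card {t \<in> J - {s}. w i t \<noteq> 0})"
    arbitrary: i s w rule: wf_induct_rule[OF wf_lex_prod[OF wf_less_than wf_less_than]])
  case (1 i s w)
  note piv = \<open>i \<in> I\<close> \<open>s \<in> J\<close> \<open>w i s \<noteq> 0\<close>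
  have rem: "\<bar>p - p div w i s * w i s\<bar> < \<bar>w i s\<bar>" for p
    using piv(3) abs_mod_less[of "w i s" p] by (simp add: minus_div_mult_eq_mod)
  consider l where "l \<in> I" "l \<noteq> i" "w l s \<noteq> 0" | t where "t \<in> J" "t \<noteq> s" "w i t \<noteq> 0"
    | "\<And>l. l \<in> I \<Longrightarrow> l \<noteq> i \<Longrightarrow> w l s = 0" "\<And>t. t \<in> J \<Longrightarrow> t \<noteq> s \<Longrightarrow> w i t = 0"
    by blast
  then show ?case
  proof cases
    case l: 1
    define k where "k = w l s div w i s"
    \<comment> \<open>Only row l changes, so the pivot and its row stay as they are, and in the
      pivot column only the entry at l is affected.\<close>
    define w' where "w' = w(l := \<lambda>t. w l t - k * w i t)"
    have "balanced I J w'"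
    proof (cases "w' l s = 0")
      case True
      have "{p \<in> I - {i}. w' p s \<noteq> 0} = {p \<in> I - {i}. w p s \<noteq> 0} - {l}"
        using True by (auto simp: w'_def)
      moreover have "card ({p \<in> I - {i}. w p s \<noteq> 0} - {l}) < card {p \<in> I - {i}. w p s \<noteq> 0}"
        using l fin by (intro card_Diff1_less) auto
      moreover have "w' i = w i" using l by (simp add: w'_def)
      ultimately show ?thesis using piv by (intro 1(1)[of w' i s]) auto
    next
      case False
      have "\<bar>w' l s\<bar> < \<bar>w i s\<bar>" using rem by (simp add: w'_def k_def)
      with False show ?thesis using piv l by (intro 1(1)[of w' l s]) auto
    qed
    then show ?thesis
      unfolding w'_def using balanced_row_op[OF fin piv(1) l(1)] l(2) by blast
  next
    case t: 2
    define k where "k = w i t div w i s"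
    define w' where "w' i = (w i)(t := w i t - k * w i s)" for i
    have "balanced I J w'"
    proof (cases "w' i t = 0")
      case True
      have "{p \<in> J - {s}. w' i p \<noteq> 0} = {p \<in> J - {s}. w i p \<noteq> 0} - {t}"
        using True by (auto simp: w'_def)
      moreover have "card ({p \<in> J - {s}. w i p \<noteq> 0} - {t}) < card {p \<in> J - {s}. w i p \<noteq> 0}"
        using t fin by (intro card_Diff1_less) auto
      moreover have "w' l s = w l s" for l using t by (simp add: w'_def)
      ultimately show ?thesis using piv by (intro 1(1)[of w' i s]) auto
    next
      case False
      have "\<bar>w' i t\<bar> < \<bar>w i s\<bar>" using rem by (simp add: w'_def k_def)
      with False show ?thesis using piv t by (intro 1(1)[of w' i t]) auto
    qed
    then show ?thesis
      unfolding w'_def using balanced_col_op[OF fin piv(2) t(1)] t(2) by blast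
  next
    case 3
    then show ?thesis using fin piv smaller by (intro balanced_split_pivot[of I J i s]) auto
  qed
qed

text \<open>The diagonal form is never written down: each nonzero pivot splits off one row and one
  column, which permits induction on the number of rows.\<close>

lemma balanced_all:
  assumes "finite I" "finite J"
  shows "balanced I J w"
  using assms
proof (induction "card I" arbitrary: I J w rule: less_induct)
  case (less I J w)
  show ?case
  proof (cases "\<forall>i\<in>I. \<forall>s\<in>J. w i s = 0")
    case True
    then show ?thesis by (intro balanced_zero) auto
  next
    case False
    then obtain i s where piv: "i \<in> I" "s \<in> J" "w i s \<noteq> 0" by blast
    have "balanced (I - {l}) (J - {t}) w" if "l \<in> I" for l t w
      using that less.prems by (intro less.hyps card_Diff1_less) auto
    then show ?thesis using less.prems piv by (intro balanced_pivot[of I J i s]) auto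
  qed
qed

end

section \<open>Extension of partial bilinear maps\<close>

lemma (in group) rcoset_mult_left:
  assumes "subgroup H G" "r \<in> H" "x \<in> carrier G"
  shows "H #> (r \<otimes> x) = H #> x"
  using assms by (metis coset_join2 coset_mult_assoc subgroup.mem_carrier subgroup.subset)

lemma nat_pow_DirProd: "(x, y) [^]\<^bsub>G \<times>\<times> H\<^esub> (k :: nat) = (x [^]\<^bsub>G\<^esub> k, y [^]\<^bsub>H\<^esub> k)"
  by (induction k) simp_all

lemma nat_pow_product_group:
  "h [^]\<^bsub>product_group I G\<^esub> (k :: nat) = (\<lambda>i\<in>I. h i [^]\<^bsub>G i\<^esub> k)"
  by (induction k) (auto intro: restrict_ext)

lemma comm_group_DirProd:
  assumes "comm_group G" "comm_group H"
  shows "comm_group (G \<times>\<times> H)"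
proof -
  interpret G: comm_group G by fact
  interpret H: comm_group H by fact
  interpret GH: group "G \<times>\<times> H" by (rule DirProd_group) unfold_locales
  show ?thesis by (rule GH.group_comm_groupI) (auto simp: G.m_comm H.m_comm)
qed

lemma comm_group_product_group:
  assumes "\<And>i. i \<in> I \<Longrightarrow> comm_group (G i)"
  shows "comm_group (product_group I G)"
proof -
  interpret group "product_group I G"
    using assms by (intro product_group) (simp add: comm_group_def)
  show ?thesis
    by (rule group_comm_groupI)
      (use assms in \<open>auto intro!: restrict_ext simp: PiE_iff comm_group_def comm_monoid.m_comm\<close>)
qed

context partial_bilinear
begin

text \<open>The tensor product is modelled as a quotient of the functions \<open>Q \<Rightarrow> P\<close>, where \<open>x \<otimes> y\<close> is the function
  with value \<open>x\<close> at \<open>y\<close> only. A relator is a finite sum of the relations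
  \<open>\<Sum>\<^sub>s w s (x \<otimes> s) = f x (\<Sum>\<^sub>s w s s)\<close> (for integer weights \<open>w\<close> with \<open>\<Sum>\<^sub>s w s s \<in> V\<close>; additivity
  in the second argument is the case where this sum is \<open>0\<close>) and \<open>u \<otimes> s = g u s\<close>. Collecting the
  coefficients as \<open>\<phi>\<close> and \<open>\<tau>\<close> makes the relators visibly a subgroup and exhibits \<open>w\<close> as a matrix.\<close>

definition weights :: "'y set \<Rightarrow> ('y \<Rightarrow> int) set" where
  "weights J = {w. (\<forall>s. w s \<noteq> 0 \<longrightarrow> s \<in> J) \<and> finprod Q (\<lambda>s. s [^]\<^bsub>Q\<^esub> w s) J \<in> V}"

definition relator ::
  "('y \<Rightarrow> int) set \<Rightarrow> 'y set \<Rightarrow> (('y \<Rightarrow> int) \<Rightarrow> 'x) \<Rightarrow> ('y \<Rightarrow> 'x) \<Rightarrow> ('y \<Rightarrow> 'x) \<times> 'c" where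
  "relator I J \<phi> \<tau> =
     (\<lambda>s\<in>carrier Q. finprod P (\<lambda>w. \<phi> w [^]\<^bsub>P\<^esub> w s) I \<otimes>\<^bsub>P\<^esub> inv\<^bsub>P\<^esub> \<tau> s,
      inv\<^bsub>C\<^esub> finprod C (\<lambda>w. f (\<phi> w) (finprod Q (\<lambda>s. s [^]\<^bsub>Q\<^esub> w s) J)) I \<otimes>\<^bsub>C\<^esub>
        finprod C (\<lambda>s. g (\<tau> s) s) J)"

text \<open>The coefficients are total functions with value one outside \<open>I\<close> and
  \<open>J\<close>, so that two relators can be compared over the union of their index sets.\<close>

definition relator_data ::
  "('y \<Rightarrow> int) set \<Rightarrow> 'y set \<Rightarrow> (('y \<Rightarrow> int) \<Rightarrow> 'x) \<Rightarrow> ('y \<Rightarrow> 'x) \<Rightarrow> bool" where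
  "relator_data I J \<phi> \<tau> \<longleftrightarrow> finite I \<and> finite J \<and> J \<subseteq> carrier Q \<and> I \<subseteq> weights J \<and>
     (\<forall>w. \<phi> w \<in> carrier P) \<and> (\<forall>w. w \<notin> I \<longrightarrow> \<phi> w = \<one>\<^bsub>P\<^esub>) \<and>
     (\<forall>s. \<tau> s \<in> U) \<and> (\<forall>s. s \<notin> J \<longrightarrow> \<tau> s = \<one>\<^bsub>P\<^esub>)"

definition relators :: "(('y \<Rightarrow> 'x) \<times> 'c) set" where
  "relators = {relator I J \<phi> \<tau> | I J \<phi> \<tau>. relator_data I J \<phi> \<tau>}"

lemma relatorsI: "relator_data I J \<phi> \<tau> \<Longrightarrow> relator I J \<phi> \<tau> \<in> relators"
  by (auto simp only: relators_def)

definition ext_group :: "(('y \<Rightarrow> 'x) \<times> 'c) monoid" where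
  "ext_group = product_group (carrier Q) (\<lambda>_. P) \<times>\<times> C"

lemma comm_group_ext_group: "comm_group ext_group"
  unfolding ext_group_def
  by (intro comm_group_DirProd comm_group_product_group P.comm_group_axioms C.comm_group_axioms)

section \<open>The relators form a subgroup that meets C trivially\<close>

lemma finprod_weight_mono:
  assumes "finite J'" "J \<subseteq> J'" "J' \<subseteq> carrier Q" "\<And>s. w s \<noteq> 0 \<Longrightarrow> s \<in> J"
  shows "finprod Q (\<lambda>s. s [^]\<^bsub>Q\<^esub> (w s :: int)) J' = finprod Q (\<lambda>s. s [^]\<^bsub>Q\<^esub> w s) J"
proof (rule Q.finprod_mono_neutral_cong_right)
  show "s [^]\<^bsub>Q\<^esub> w s = \<one>\<^bsub>Q\<^esub>" if "s \<in> J' - J" for s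
  proof -
    have "w s = 0" using that assms(4) by blast
    then show ?thesis by simp
  qed
qed (use assms in \<open>auto intro!: Q.int_pow_closed\<close>)

text \<open>New indices carry trivial coefficients, and \<open>f\<close> and \<open>g\<close> are
  trivial at them, so every added factor is one.\<close>

lemma relator_data_mono:
  assumes rd: "relator_data I J \<phi> \<tau>" and sub: "I \<subseteq> I'" "J \<subseteq> J'"
    and I': "finite I'" "I' \<subseteq> weights J'" and J': "finite J'" "J' \<subseteq> carrier Q"
  shows "relator_data I' J' \<phi> \<tau>" "relator I' J' \<phi> \<tau> = relator I J \<phi> \<tau>"
proof -
  interpret S: partial_bilinear Q P C V U "\<lambda>y x. g x y" "\<lambda>y x. f x y" n by (rule swap)
  show "relator_data I' J' \<phi> \<tau>"
    using assms by (auto simp: relator_data_def)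
  have \<phi>: "\<phi> w \<in> carrier P" "w \<notin> I \<Longrightarrow> \<phi> w = \<one>\<^bsub>P\<^esub>" for w
    using rd by (auto simp: relator_data_def)
  have \<tau>: "\<tau> s \<in> U" "s \<notin> J \<Longrightarrow> \<tau> s = \<one>\<^bsub>P\<^esub>" for s
    using rd by (auto simp: relator_data_def)
  have ev: "finprod Q (\<lambda>s. s [^]\<^bsub>Q\<^esub> w s) J' = finprod Q (\<lambda>s. s [^]\<^bsub>Q\<^esub> w s) J" if "w \<in> I" for w
    using rd that sub J' by (intro finprod_weight_mono) (auto simp: relator_data_def weights_def)
  have evV: "finprod Q (\<lambda>s. s [^]\<^bsub>Q\<^esub> w s) J' \<in> V" if "w \<in> I'" for w
    using that I' by (auto simp: weights_def)
  have "finprod P (\<lambda>w. \<phi> w [^]\<^bsub>P\<^esub> w s) I' = finprod P (\<lambda>w. \<phi> w [^]\<^bsub>P\<^esub> w s) I" for s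
    using I' sub \<phi> by (intro P.finprod_mono_neutral_cong_right) auto
  moreover have "finprod C (\<lambda>w. f (\<phi> w) (finprod Q (\<lambda>s. s [^]\<^bsub>Q\<^esub> w s) J')) I'
    = finprod C (\<lambda>w. f (\<phi> w) (finprod Q (\<lambda>s. s [^]\<^bsub>Q\<^esub> w s) J)) I"
    using I' sub \<phi> ev evV
    by (intro C.finprod_mono_neutral_cong_right) (auto simp: f_closed f_one_left)
  moreover have "finprod C (\<lambda>s. g (\<tau> s) s) J' = finprod C (\<lambda>s. g (\<tau> s) s) J"
    using J' sub \<tau> 
    by (intro C.finprod_mono_neutral_cong_right) (auto simp: g_closed S.f_one_right subsetD)
  ultimately show "relator I' J' \<phi> \<tau> = relator I J \<phi> \<tau>"
    by (simp add: relator_def)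
qed

lemma relator_data_mult:
  assumes "relator_data I J \<phi> \<tau>" "relator_data I J \<phi>' \<tau>'"
  shows "relator_data I J (\<lambda>w. \<phi> w \<otimes>\<^bsub>P\<^esub> \<phi>' w) (\<lambda>s. \<tau> s \<otimes>\<^bsub>P\<^esub> \<tau>' s)"
  using assms by (auto simp: relator_data_def)

lemma relator_closed:
  assumes "relator_data I J \<phi> \<tau>"
  shows "relator I J \<phi> \<tau> \<in> carrier ext_group"
proof -
  have "f (\<phi> w) (finprod Q (\<lambda>s. s [^]\<^bsub>Q\<^esub> w s) J) \<in> carrier C" if "w \<in> I" for w
    using assms that by (intro f_closed) (auto simp: relator_data_def weights_def)
  moreover have "g (\<tau> s) s \<in> carrier C" if "s \<in> J" for s
    using assms that by (intro g_closed) (auto simp: relator_data_def)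
  moreover have "\<phi> w \<in> carrier P" "\<tau> s \<in> carrier P" for w s
    using assms U.subset by (auto simp: relator_data_def)
  ultimately show ?thesis
    by (auto simp: relator_def ext_group_def intro!: P.finprod_closed C.finprod_closed P.m_closed C.m_closed)
qed

text \<open>For fixed index sets a relator depends additively on the coefficients, since
  \<open>f\<close> and \<open>g\<close> are additive in their first argument.\<close>

lemma relator_mult:
  assumes rd: "relator_data I J \<phi> \<tau>" "relator_data I J \<phi>' \<tau>'"
  shows "relator I J \<phi> \<tau> \<otimes>\<^bsub>ext_group\<^esub> relator I J \<phi>' \<tau>' =
    relator I J (\<lambda>w. \<phi> w \<otimes>\<^bsub>P\<^esub> \<phi>' w) (\<lambda>s. \<tau> s \<otimes>\<^bsub>P\<^esub> \<tau>' s)"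
proof -
  define ev where "ev w = finprod Q (\<lambda>s. s [^]\<^bsub>Q\<^esub> w s) J" for w :: "'y \<Rightarrow> int"
  have c: "\<phi> w \<in> carrier P" "\<phi>' w \<in> carrier P" "\<tau> s \<in> U" "\<tau>' s \<in> U" for w s
    using rd by (auto simp: relator_data_def)
  have \<tau>c: "\<tau> s \<in> carrier P" "\<tau>' s \<in> carrier P" for s using c U.subset by auto
  have ev: "ev w \<in> V" if "w \<in> I" for w
    using rd that by (auto simp: relator_data_def weights_def ev_def)
  have J: "s \<in> J \<Longrightarrow> s \<in> carrier Q" for s using rd by (auto simp: relator_data_def)
  have "finprod P (\<lambda>w. (\<phi> w \<otimes>\<^bsub>P\<^esub> \<phi>' w) [^]\<^bsub>P\<^esub> w s) I =
    finprod P (\<lambda>w. \<phi> w [^]\<^bsub>P\<^esub> w s) I \<otimes>\<^bsub>P\<^esub> finprod P (\<lambda>w. \<phi>' w [^]\<^bsub>P\<^esub> w s) I" for s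
    using c by (simp add: P.int_pow_distrib)
  moreover have "finprod C (\<lambda>w. f (\<phi> w \<otimes>\<^bsub>P\<^esub> \<phi>' w) (ev w)) I =
    finprod C (\<lambda>w. f (\<phi> w) (ev w)) I \<otimes>\<^bsub>C\<^esub> finprod C (\<lambda>w. f (\<phi>' w) (ev w)) I"
  proof -
    have "finprod C (\<lambda>w. f (\<phi> w \<otimes>\<^bsub>P\<^esub> \<phi>' w) (ev w)) I =
      finprod C (\<lambda>w. f (\<phi> w) (ev w) \<otimes>\<^bsub>C\<^esub> f (\<phi>' w) (ev w)) I"
      using c ev by (intro C.finprod_cong') (auto simp: f_mult_left f_closed)
    then show ?thesis using c ev by (simp add: f_closed Pi_iff)
  qed
  moreover have "finprod C (\<lambda>s. g (\<tau> s \<otimes>\<^bsub>P\<^esub> \<tau>' s) s) J =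
    finprod C (\<lambda>s. g (\<tau> s) s) J \<otimes>\<^bsub>C\<^esub> finprod C (\<lambda>s. g (\<tau>' s) s) J"
  proof -
    have "finprod C (\<lambda>s. g (\<tau> s \<otimes>\<^bsub>P\<^esub> \<tau>' s) s) J = finprod C (\<lambda>s. g (\<tau> s) s \<otimes>\<^bsub>C\<^esub> g (\<tau>' s) s) J"
      using c J by (intro C.finprod_cong') (auto simp: g_mult_left g_closed)
    then show ?thesis using c J by (simp add: g_closed Pi_iff)
  qed
  moreover have "finprod C (\<lambda>w. f (\<phi> w) (ev w)) I \<in> carrier C" "finprod C (\<lambda>w. f (\<phi>' w) (ev w)) I \<in> carrier C"
    "finprod C (\<lambda>s. g (\<tau> s) s) J \<in> carrier C" "finprod C (\<lambda>s. g (\<tau>' s) s) J \<in> carrier C"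
    "finprod P (\<lambda>w. \<phi> w [^]\<^bsub>P\<^esub> w s) I \<in> carrier P" "finprod P (\<lambda>w. \<phi>' w [^]\<^bsub>P\<^esub> w s) I \<in> carrier P" for s
    using c ev J by (auto intro!: C.finprod_closed P.finprod_closed simp: f_closed g_closed)
  ultimately show ?thesis
    using \<tau>c by (auto simp: relator_def ext_group_def P.inv_mult C.inv_mult P.m_ac C.m_ac
        simp flip: ev_def intro!: restrict_ext)
qed

lemma relator_one: "relator I J (\<lambda>_. \<one>\<^bsub>P\<^esub>) (\<lambda>_. \<one>\<^bsub>P\<^esub>) = \<one>\<^bsub>ext_group\<^esub>"
  if "relator_data I J \<phi> \<tau>"
proof -
  interpret S: partial_bilinear Q P C V U "\<lambda>y x. g x y" "\<lambda>y x. f x y" n by (rule swap)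
  have "finprod C (\<lambda>w. f \<one>\<^bsub>P\<^esub> (finprod Q (\<lambda>s. s [^]\<^bsub>Q\<^esub> w s) J)) I = \<one>\<^bsub>C\<^esub>"
    using that by (intro C.finprod_one_eqI f_one_left) (auto simp: relator_data_def weights_def)
  moreover have "finprod C (\<lambda>s. g \<one>\<^bsub>P\<^esub> s) J = \<one>\<^bsub>C\<^esub>"
    using that by (intro C.finprod_one_eqI S.f_one_right) (auto simp: relator_data_def)
  ultimately show ?thesis
    by (auto simp: relator_def ext_group_def)
qed

lemma subgroup_relators: "subgroup relators ext_group"
proof -
  interpret E: comm_group ext_group by (rule comm_group_ext_group)
  show ?thesis
  proof (rule E.subgroupI)
    show "relators \<subseteq> carrier ext_group" by (auto simp: relators_def relator_closed)
    have "relator_data {} {} (\<lambda>_. \<one>\<^bsub>P\<^esub>) (\<lambda>_. \<one>\<^bsub>P\<^esub>)" by (simp add: relator_data_def)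
    from relatorsI[OF this] show "relators \<noteq> {}" by blast
  next
    fix r assume "r \<in> relators"
    then obtain I J \<phi> \<tau> where r: "r = relator I J \<phi> \<tau>" and rd: "relator_data I J \<phi> \<tau>"
      by (auto simp: relators_def)
    have rd': "relator_data I J (\<lambda>w. inv\<^bsub>P\<^esub> \<phi> w) (\<lambda>s. inv\<^bsub>P\<^esub> \<tau> s)"
      using rd by (auto simp: relator_data_def)
    have "\<phi> w \<in> carrier P" "\<tau> s \<in> carrier P" for w s
      using rd U.subset by (auto simp: relator_data_def)
    then have "relator I J (\<lambda>w. inv\<^bsub>P\<^esub> \<phi> w) (\<lambda>s. inv\<^bsub>P\<^esub> \<tau> s) \<otimes>\<^bsub>ext_group\<^esub> r = \<one>\<^bsub>ext_group\<^esub>"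
      unfolding r using relator_one[OF rd] by (simp add: relator_mult[OF rd' rd])
    then have "inv\<^bsub>ext_group\<^esub> r = relator I J (\<lambda>w. inv\<^bsub>P\<^esub> \<phi> w) (\<lambda>s. inv\<^bsub>P\<^esub> \<tau> s)"
      unfolding r using relator_closed[OF rd] relator_closed[OF rd'] by (intro E.inv_equality) auto
    then show "inv\<^bsub>ext_group\<^esub> r \<in> relators" using relatorsI[OF rd'] by simp
  next
    fix r r' assume "r \<in> relators" "r' \<in> relators"
    then obtain I J \<phi> \<tau> I' J' \<phi>' \<tau>' where r: "r = relator I J \<phi> \<tau>" "relator_data I J \<phi> \<tau>"
      and r': "r' = relator I' J' \<phi>' \<tau>'" "relator_data I' J' \<phi>' \<tau>'"
      by (auto simp: relators_def)
    have weights_mono: "w \<in> weights K'" if "w \<in> weights K" "K \<subseteq> K'" "finite K'" "K' \<subseteq> carrier Q" for w K K'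
      using that finprod_weight_mono[of K' K w] by (auto simp: weights_def)
    have IJ: "finite (I \<union> I')" "I \<union> I' \<subseteq> weights (J \<union> J')" "finite (J \<union> J')" "J \<union> J' \<subseteq> carrier Q"
      using r(2) r'(2) weights_mono[of _ J "J \<union> J'"] weights_mono[of _ J' "J \<union> J'"]
      by (auto simp: relator_data_def)
    note ext = relator_data_mono[OF r(2) _ _ IJ, simplified] relator_data_mono[OF r'(2) _ _ IJ, simplified]
    have "r \<otimes>\<^bsub>ext_group\<^esub> r' = relator (I \<union> I') (J \<union> J') (\<lambda>w. \<phi> w \<otimes>\<^bsub>P\<^esub> \<phi>' w) (\<lambda>s. \<tau> s \<otimes>\<^bsub>P\<^esub> \<tau>' s)"
      unfolding r r' using ext relator_mult[OF ext(1) ext(3)] by simp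
    then show "r \<otimes>\<^bsub>ext_group\<^esub> r' \<in> relators"
      using relatorsI[OF relator_data_mult[OF ext(1) ext(3)]] by simp
  qed
qed

text \<open>The heart of the extension argument: a relator with trivial function part has column
  products \<open>\<tau> s\<close>, so its C-part is the quotient of the two evaluations compared by
  \<open>balanced\<close>. Hence factoring out the relators leaves C intact.\<close>

lemma relators_inter_C:
  assumes "(\<lambda>s\<in>carrier Q. \<one>\<^bsub>P\<^esub>, c) \<in> relators"
  shows "c = \<one>\<^bsub>C\<^esub>"
proof -
  obtain I J \<phi> \<tau> where r: "(\<lambda>s\<in>carrier Q. \<one>\<^bsub>P\<^esub>, c) = relator I J \<phi> \<tau>" and rd: "relator_data I J \<phi> \<tau>"
    using assms by (auto simp: relators_def)
  have \<phi>: "\<phi> w \<in> carrier P" "w \<notin> I \<Longrightarrow> \<phi> w = \<one>\<^bsub>P\<^esub>" for w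
    using rd by (auto simp: relator_data_def)
  have \<tau>: "\<tau> s \<in> U" "s \<notin> J \<Longrightarrow> \<tau> s = \<one>\<^bsub>P\<^esub>" for s
    using rd by (auto simp: relator_data_def)
  have J: "s \<in> J \<Longrightarrow> s \<in> carrier Q" for s using rd by (auto simp: relator_data_def)
  have evV: "finprod Q (\<lambda>s. s [^]\<^bsub>Q\<^esub> w s) J \<in> V" if "w \<in> I" for w
    using that rd by (auto simp: relator_data_def weights_def)
  have col: "finprod P (\<lambda>w. \<phi> w [^]\<^bsub>P\<^esub> w s) I = \<tau> s" if "s \<in> carrier Q" for s
  proof -
    have "finprod P (\<lambda>w. \<phi> w [^]\<^bsub>P\<^esub> w s) I \<otimes>\<^bsub>P\<^esub> inv\<^bsub>P\<^esub> \<tau> s = \<one>\<^bsub>P\<^esub>"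
      using r that by (auto simp: relator_def fun_eq_iff restrict_def split: if_splits)
    moreover have "finprod P (\<lambda>w. \<phi> w [^]\<^bsub>P\<^esub> w s) I \<in> carrier P"
      using \<phi> by (intro P.finprod_closed) auto
    ultimately show ?thesis using \<tau>(1)[of s] U.subset
      by (metis P.inv_closed P.inv_inv P.inv_equality U.mem_carrier)
  qed
  have "finite I" "finite J" using rd by (auto simp: relator_data_def)
  \<comment> \<open>The weights themselves index the rows and the elements of \<open>J\<close> the
    columns, with a = \<open>\<phi>\<close> and y the identity. Row products lie in \<open>V\<close>
    by definition of \<open>weights\<close>, column products equal \<open>\<tau> s\<close> and lie
    in \<open>U\<close>.\<close>
  then have "balanced I J (\<lambda>w s. w s)" by (rule balanced_all)
  then have "finprod C (\<lambda>w. f (\<phi> w) (finprod Q (\<lambda>s. s [^]\<^bsub>Q\<^esub> w s) J)) I =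
    finprod C (\<lambda>s. g (finprod P (\<lambda>w. \<phi> w [^]\<^bsub>P\<^esub> w s) I) s) J"
    unfolding balanced_def using \<phi> J evV col \<tau> by (auto simp: Pi_iff)
  also have "\<dots> = finprod C (\<lambda>s. g (\<tau> s) s) J"
    using J \<tau> col by (intro C.finprod_cong') (auto simp: g_closed)
  finally have "finprod C (\<lambda>w. f (\<phi> w) (finprod Q (\<lambda>s. s [^]\<^bsub>Q\<^esub> w s) J)) I = finprod C (\<lambda>s. g (\<tau> s) s) J" .
  moreover have "finprod C (\<lambda>s. g (\<tau> s) s) J \<in> carrier C"
    using J \<tau> by (intro C.finprod_closed) (auto simp: g_closed)
  ultimately show ?thesis using r by (auto simp: relator_def)
qed

section \<open>Elementary relators and the extended bilinear map\<close>

definition delta :: "'y \<Rightarrow> 'x \<Rightarrow> 'y \<Rightarrow> 'x" where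
  "delta y x = (\<lambda>s\<in>carrier Q. if s = y then x else \<one>\<^bsub>P\<^esub>)"

lemma delta_closed: "x \<in> carrier P \<Longrightarrow> c \<in> carrier C \<Longrightarrow> (delta y x, c) \<in> carrier ext_group"
  by (auto simp: delta_def ext_group_def)

text \<open>Both the values of \<open>f\<close> and additivity in the second argument come from this
  one family, by choice of the weight.\<close>

lemma relator_single:
  assumes x: "x \<in> carrier P" and w: "w \<in> weights J" and J: "finite J" "J \<subseteq> carrier Q"
  shows "(\<lambda>s\<in>carrier Q. x [^]\<^bsub>P\<^esub> w s, inv\<^bsub>C\<^esub> f x (finprod Q (\<lambda>s. s [^]\<^bsub>Q\<^esub> w s) J)) \<in> relators"
proof -
  interpret S: partial_bilinear Q P C V U "\<lambda>y x. g x y" "\<lambda>y x. f x y" n by (rule swap)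
  define \<phi> where "\<phi> = (\<lambda>_. \<one>\<^bsub>P\<^esub>)(w := x)"
  have rd: "relator_data {w} J \<phi> (\<lambda>_. \<one>\<^bsub>P\<^esub>)"
    using assms by (auto simp: relator_data_def \<phi>_def)
  have ev: "finprod Q (\<lambda>s. s [^]\<^bsub>Q\<^esub> w s) J \<in> V" using w by (simp add: weights_def)
  have "finprod C (\<lambda>s. g \<one>\<^bsub>P\<^esub> s) J = \<one>\<^bsub>C\<^esub>"
    using J by (intro C.finprod_one_eqI S.f_one_right) auto
  then have "relator {w} J \<phi> (\<lambda>_. \<one>\<^bsub>P\<^esub>) =
    (\<lambda>s\<in>carrier Q. x [^]\<^bsub>P\<^esub> w s, inv\<^bsub>C\<^esub> f x (finprod Q (\<lambda>s. s [^]\<^bsub>Q\<^esub> w s) J))"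
    using x ev by (simp add: relator_def \<phi>_def f_closed)
  then show ?thesis using relatorsI[OF rd] by simp
qed

lemma relator_f:
  assumes "x \<in> carrier P" "v \<in> V"
  shows "(delta v x, inv\<^bsub>C\<^esub> f x v) \<in> relators"
proof -
  define w :: "'y \<Rightarrow> int" where "w s = (if s = v then 1 else 0)" for s
  have v: "v \<in> carrier Q" using assms V.subset by auto
  have ev: "finprod Q (\<lambda>s. s [^]\<^bsub>Q\<^esub> w s) {v} = v" using v by (simp add: w_def)
  have "w \<in> weights {v}" unfolding weights_def using assms ev by (auto simp: w_def)
  from relator_single[OF assms(1) this] v ev
  have "(\<lambda>s\<in>carrier Q. x [^]\<^bsub>P\<^esub> w s, inv\<^bsub>C\<^esub> f x v) \<in> relators" by simp
  moreover have "(\<lambda>s\<in>carrier Q. x [^]\<^bsub>P\<^esub> w s) = delta v x"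
    using assms by (auto simp: delta_def w_def)
  ultimately show ?thesis by simp
qed

lemma relator_g:
  assumes u: "u \<in> U" and y: "y \<in> carrier Q"
  shows "(delta y u, inv\<^bsub>C\<^esub> g u y) \<in> relators"
proof -
  interpret S: partial_bilinear Q P C V U "\<lambda>y x. g x y" "\<lambda>y x. f x y" n by (rule swap)
  \<comment> \<open>A relator contains the inverse of \<open>\<tau>\<close> in its function part, so
    the value at y has to be the inverse of u.\<close>
  define \<tau> where "\<tau> = (\<lambda>_. \<one>\<^bsub>P\<^esub>)(y := inv\<^bsub>P\<^esub> u)"
  have uc: "u \<in> carrier P" using u U.subset by auto
  have rd: "relator_data {} {y} (\<lambda>_. \<one>\<^bsub>P\<^esub>) \<tau>"
    using assms by (auto simp: relator_data_def \<tau>_def)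
  have "g (inv\<^bsub>P\<^esub> u) y = inv\<^bsub>C\<^esub> g u y"
    using S.f_pow_right[OF y u, of "-1"] uc g_closed[OF u y] by (simp add: P.int_pow_neg C.int_pow_neg)
  then have "relator {} {y} (\<lambda>_. \<one>\<^bsub>P\<^esub>) \<tau> = (delta y u, inv\<^bsub>C\<^esub> g u y)"
    using y uc g_closed[OF u y] by (auto simp: relator_def delta_def \<tau>_def)
  then show ?thesis using relatorsI[OF rd] by simp
qed

lemma relator_add:
  assumes x: "x \<in> carrier P" and y: "y \<in> carrier Q" "y' \<in> carrier Q"
  shows "(\<lambda>s\<in>carrier Q. delta (y \<otimes>\<^bsub>Q\<^esub> y') x s \<otimes>\<^bsub>P\<^esub> (inv\<^bsub>P\<^esub> delta y x s \<otimes>\<^bsub>P\<^esub> inv\<^bsub>P\<^esub> delta y' x s), \<one>\<^bsub>C\<^esub>) \<in> relators"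
proof -
  define d :: "'y \<Rightarrow> 'y \<Rightarrow> int" where "d t s = (if s = t then 1 else 0)" for t s
  \<comment> \<open>The weight is a sum of indicator functions, not a case distinction, because y,
    y' and their product may coincide. Its evaluation is the neutral element of Q, where
    \<open>f x\<close> is trivial.\<close>
  define w where "w s = d (y \<otimes>\<^bsub>Q\<^esub> y') s + (- d y s + - d y' s)" for s
  define J where "J = {y, y', y \<otimes>\<^bsub>Q\<^esub> y'}"
  have J: "finite J" "J \<subseteq> carrier Q" using y by (auto simp: J_def)
  have J_mem: "y \<in> J" "y' \<in> J" "y \<otimes>\<^bsub>Q\<^esub> y' \<in> J" by (simp_all add: J_def)
  have single: "finprod Q (\<lambda>s. s [^]\<^bsub>Q\<^esub> d t s) J = t" if "t \<in> J" for t
    using that J by (subst Q.finprod_single_support[of J t]) (auto simp: d_def)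
  have single': "finprod Q (\<lambda>s. s [^]\<^bsub>Q\<^esub> - d t s) J = inv\<^bsub>Q\<^esub> t" if "t \<in> J" for t
    using that J by (subst Q.finprod_single_support[of J t]) (auto simp: d_def Q.int_pow_neg)
  have "finprod Q (\<lambda>s. s [^]\<^bsub>Q\<^esub> w s) J =
    finprod Q (\<lambda>s. s [^]\<^bsub>Q\<^esub> d (y \<otimes>\<^bsub>Q\<^esub> y') s \<otimes>\<^bsub>Q\<^esub> (s [^]\<^bsub>Q\<^esub> - d y s \<otimes>\<^bsub>Q\<^esub> s [^]\<^bsub>Q\<^esub> - d y' s)) J"
    unfolding w_def using J by (intro Q.finprod_cong') (auto simp only: Q.int_pow_mult Q.int_pow_closed Q.m_closed Pi_iff subsetD)
  also have "\<dots> = finprod Q (\<lambda>s. s [^]\<^bsub>Q\<^esub> d (y \<otimes>\<^bsub>Q\<^esub> y') s) J \<otimes>\<^bsub>Q\<^esub>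
      (finprod Q (\<lambda>s. s [^]\<^bsub>Q\<^esub> - d y s) J \<otimes>\<^bsub>Q\<^esub> finprod Q (\<lambda>s. s [^]\<^bsub>Q\<^esub> - d y' s) J)"
    using J by (subst Q.finprod_multf, simp_all add: Pi_iff subsetD)
  also have "\<dots> = \<one>\<^bsub>Q\<^esub>"
    using y single[of "y \<otimes>\<^bsub>Q\<^esub> y'"] single'[of y] single'[of y']
    by (simp add: J_mem flip: Q.inv_mult)
  finally have ev: "finprod Q (\<lambda>s. s [^]\<^bsub>Q\<^esub> w s) J = \<one>\<^bsub>Q\<^esub>" .
  have "w \<in> weights J" unfolding weights_def using ev by (auto simp: w_def d_def J_def)
  from relator_single[OF x this J]
  have "(\<lambda>s\<in>carrier Q. x [^]\<^bsub>P\<^esub> w s, \<one>\<^bsub>C\<^esub>) \<in> relators" using x by (simp add: ev f_one_right)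
  moreover have "(\<lambda>s\<in>carrier Q. x [^]\<^bsub>P\<^esub> w s) =
    (\<lambda>s\<in>carrier Q. delta (y \<otimes>\<^bsub>Q\<^esub> y') x s \<otimes>\<^bsub>P\<^esub> (inv\<^bsub>P\<^esub> delta y x s \<otimes>\<^bsub>P\<^esub> inv\<^bsub>P\<^esub> delta y' x s))"
  proof (rule restrict_ext)
    fix s assume s: "s \<in> carrier Q"
    have "x [^]\<^bsub>P\<^esub> d t s = delta t x s" "x [^]\<^bsub>P\<^esub> - d t s = inv\<^bsub>P\<^esub> delta t x s" for t
      using s x by (auto simp: d_def delta_def P.int_pow_neg)
    then show "x [^]\<^bsub>P\<^esub> w s =
      delta (y \<otimes>\<^bsub>Q\<^esub> y') x s \<otimes>\<^bsub>P\<^esub> (inv\<^bsub>P\<^esub> delta y x s \<otimes>\<^bsub>P\<^esub> inv\<^bsub>P\<^esub> delta y' x s)"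
      unfolding w_def using x by (simp only: P.int_pow_mult)
  qed
  ultimately show ?thesis by simp
qed

text \<open>\<open>E\<close> is \<open>ext_group\<close> modulo the relators. Additivity in the
  first argument already holds for the functions \<open>delta\<close>; the remaining laws are
  relators. Injectivity on C is \<open>relators_inter_C\<close>, and the exponent n is inherited
  from P and C.\<close>

theorem bilinear_extension:
  assumes exp_C: "\<And>c. c \<in> carrier C \<Longrightarrow> c [^]\<^bsub>C\<^esub> n = \<one>\<^bsub>C\<^esub>"
  obtains E :: "(('y \<Rightarrow> 'x) \<times> 'c) set monoid" and \<iota> b
  where "comm_group E" "\<forall>e\<in>carrier E. e [^]\<^bsub>E\<^esub> n = \<one>\<^bsub>E\<^esub>"
    and "\<iota> \<in> hom C E" "inj_on \<iota> (carrier C)"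
    and "\<forall>x\<in>carrier P. \<forall>y\<in>carrier Q. b x y \<in> carrier E"
    and "\<forall>x\<in>carrier P. \<forall>x'\<in>carrier P. \<forall>y\<in>carrier Q. b (x \<otimes>\<^bsub>P\<^esub> x') y = b x y \<otimes>\<^bsub>E\<^esub> b x' y"
    and "\<forall>x\<in>carrier P. \<forall>y\<in>carrier Q. \<forall>y'\<in>carrier Q. b x (y \<otimes>\<^bsub>Q\<^esub> y') = b x y \<otimes>\<^bsub>E\<^esub> b x y'"
    and "\<forall>x\<in>carrier P. \<forall>v\<in>V. b x v = \<iota> (f x v)"
    and "\<forall>u\<in>U. \<forall>y\<in>carrier Q. b u y = \<iota> (g u y)"
proof -
  interpret H: comm_group ext_group by (rule comm_group_ext_group)
  note R = subgroup_relators
  interpret N: normal relators ext_group using H.subgroup_imp_normal[OF R] .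
  define E where "E = ext_group Mod relators"
  define \<pi> where "\<pi> h = relators #>\<^bsub>ext_group\<^esub> h" for h
  have cgE: "comm_group E" unfolding E_def by (rule H.abelian_FactGroup[OF R])
  interpret E: comm_group E by (rule cgE)
  have \<pi>: "\<pi> \<in> hom ext_group E" unfolding \<pi>_def E_def by (rule N.r_coset_hom_Mod)
  interpret \<pi>: group_hom ext_group E \<pi> by unfold_locales (rule \<pi>)
  have \<pi>_eq: "\<pi> (r \<otimes>\<^bsub>ext_group\<^esub> h) = \<pi> h" if "r \<in> relators" "h \<in> carrier ext_group" for r h
    unfolding \<pi>_def using H.rcoset_mult_left[OF R that] .
  have mult: "(h, c) \<otimes>\<^bsub>ext_group\<^esub> (h', c') = (\<lambda>s\<in>carrier Q. h s \<otimes>\<^bsub>P\<^esub> h' s, c \<otimes>\<^bsub>C\<^esub> c')" for h h' c c'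
    by (simp add: ext_group_def)
  define zero where "zero = (\<lambda>s\<in>carrier Q. \<one>\<^bsub>P\<^esub>)"
  have zero: "(zero, c) \<in> carrier ext_group" if "c \<in> carrier C" for c
    using that by (auto simp: zero_def ext_group_def)
  define \<iota> where "\<iota> c = \<pi> (zero, c)" for c
  define b where "b x y = \<pi> (delta y x, \<one>\<^bsub>C\<^esub>)" for x y
  have iota_hom: "\<iota> \<in> hom C E"
  proof (rule homI)
    show "\<iota> c \<in> carrier E" if "c \<in> carrier C" for c
      using zero[OF that] by (simp add: \<iota>_def)
    show "\<iota> (c \<otimes>\<^bsub>C\<^esub> c') = \<iota> c \<otimes>\<^bsub>E\<^esub> \<iota> c'" if "c \<in> carrier C" "c' \<in> carrier C" for c c'
    proof -
      have "(zero, c) \<otimes>\<^bsub>ext_group\<^esub> (zero, c') = (zero, c \<otimes>\<^bsub>C\<^esub> c')"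
        by (auto simp: mult zero_def)
      then show ?thesis using that zero by (simp add: \<iota>_def flip: \<pi>.hom_mult)
    qed
  qed
  interpret \<iota>: group_hom C E \<iota> by unfold_locales (rule iota_hom)
  have kernel: "c = \<one>\<^bsub>C\<^esub>" if "c \<in> carrier C" "\<iota> c = \<one>\<^bsub>E\<^esub>" for c
  proof -
    have "relators #>\<^bsub>ext_group\<^esub> (zero, c) = relators" using that by (simp add: \<iota>_def \<pi>_def E_def)
    then have "(zero, c) \<in> relators" using H.coset_join1[OF _ _ R] zero[OF that(1)] N.subset by simp
    then show ?thesis unfolding zero_def by (rule relators_inter_C)
  qed
  show thesis
  proof (rule that[OF cgE _ iota_hom]; (intro ballI)?)
    fix e assume "e \<in> carrier E"
    then obtain h where h: "h \<in> carrier ext_group" "e = \<pi> h"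
      by (auto simp: E_def carrier_FactGroup \<pi>_def)
    obtain h1 h2 where hh: "h = (h1, h2)" by force
    have "h [^]\<^bsub>ext_group\<^esub> n = (\<lambda>i\<in>carrier Q. h1 i [^]\<^bsub>P\<^esub> n, h2 [^]\<^bsub>C\<^esub> n)"
      by (simp add: hh ext_group_def nat_pow_DirProd nat_pow_product_group)
    also have "\<dots> = \<one>\<^bsub>ext_group\<^esub>"
      using h by (auto simp: hh ext_group_def exp_P exp_C PiE_iff intro!: restrict_ext)
    finally show "e [^]\<^bsub>E\<^esub> n = \<one>\<^bsub>E\<^esub>" using h by (simp flip: \<pi>.hom_nat_pow)
  next
    show "inj_on \<iota> (carrier C)"
      using kernel by (intro \<iota>.inj_on_one_iff[THEN iffD2]) auto
  next
    show "b x y \<in> carrier E" if "x \<in> carrier P" for x y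
      using delta_closed[OF that] by (simp add: b_def)
  next
    fix x x' y assume x: "x \<in> carrier P" "x' \<in> carrier P" and y: "y \<in> carrier Q"
    have "(delta y x, \<one>\<^bsub>C\<^esub>) \<otimes>\<^bsub>ext_group\<^esub> (delta y x', \<one>\<^bsub>C\<^esub>) = (delta y (x \<otimes>\<^bsub>P\<^esub> x'), \<one>\<^bsub>C\<^esub>)"
      by (auto simp: mult delta_def)
    then show "b (x \<otimes>\<^bsub>P\<^esub> x') y = b x y \<otimes>\<^bsub>E\<^esub> b x' y"
      using x delta_closed by (simp add: b_def flip: \<pi>.hom_mult)
  next
    fix x y y' assume x: "x \<in> carrier P" and y: "y \<in> carrier Q" "y' \<in> carrier Q"
    define r where "r = (\<lambda>s\<in>carrier Q. delta (y \<otimes>\<^bsub>Q\<^esub> y') x s \<otimes>\<^bsub>P\<^esub>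
      (inv\<^bsub>P\<^esub> delta y x s \<otimes>\<^bsub>P\<^esub> inv\<^bsub>P\<^esub> delta y' x s), \<one>\<^bsub>C\<^esub>)"
    have r: "r \<in> relators" unfolding r_def by (rule relator_add[OF x y])
    \<comment> \<open>Multiplying by the relator merges the two deltas at y and y' into one delta at
      their product, inside the same coset.\<close>
    have "r \<otimes>\<^bsub>ext_group\<^esub> ((delta y x, \<one>\<^bsub>C\<^esub>) \<otimes>\<^bsub>ext_group\<^esub> (delta y' x, \<one>\<^bsub>C\<^esub>)) = (delta (y \<otimes>\<^bsub>Q\<^esub> y') x, \<one>\<^bsub>C\<^esub>)"
    proof -
      have "delta (y \<otimes>\<^bsub>Q\<^esub> y') x s \<otimes>\<^bsub>P\<^esub> (inv\<^bsub>P\<^esub> delta y x s \<otimes>\<^bsub>P\<^esub> inv\<^bsub>P\<^esub> delta y' x s) \<otimes>\<^bsub>P\<^esub>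
        (delta y x s \<otimes>\<^bsub>P\<^esub> delta y' x s) = delta (y \<otimes>\<^bsub>Q\<^esub> y') x s" if "s \<in> carrier Q" for s
      proof -
        have c: "delta t x s \<in> carrier P" for t using x that by (simp add: delta_def)
        then show ?thesis by (simp add: P.m_assoc flip: P.inv_mult)
      qed
      then have "(\<lambda>s\<in>carrier Q. delta (y \<otimes>\<^bsub>Q\<^esub> y') x s \<otimes>\<^bsub>P\<^esub>
        (inv\<^bsub>P\<^esub> delta y x s \<otimes>\<^bsub>P\<^esub> inv\<^bsub>P\<^esub> delta y' x s) \<otimes>\<^bsub>P\<^esub> (delta y x s \<otimes>\<^bsub>P\<^esub> delta y' x s))
        = restrict (delta (y \<otimes>\<^bsub>Q\<^esub> y') x) (carrier Q)"
        by (intro restrict_ext)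
      then show ?thesis by (simp add: r_def mult cong: restrict_cong) (simp add: delta_def)
    qed
    then show "b x (y \<otimes>\<^bsub>Q\<^esub> y') = b x y \<otimes>\<^bsub>E\<^esub> b x y'"
      using \<pi>_eq[OF r] delta_closed x by (simp add: b_def flip: \<pi>.hom_mult) (metis C.one_closed H.m_closed)
  next
    fix x v assume x: "x \<in> carrier P" and v: "v \<in> V"
    have "(delta v x, inv\<^bsub>C\<^esub> f x v) \<otimes>\<^bsub>ext_group\<^esub> (zero, f x v) = (delta v x, \<one>\<^bsub>C\<^esub>)"
      using x f_closed[OF x v] by (auto simp: mult delta_def zero_def)
    then show "b x v = \<iota> (f x v)"
      using \<pi>_eq[OF relator_f[OF x v] zero[OF f_closed[OF x v]]] by (simp add: b_def \<iota>_def)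
  next
    fix u y assume u: "u \<in> U" and y: "y \<in> carrier Q"
    have "(delta y u, inv\<^bsub>C\<^esub> g u y) \<otimes>\<^bsub>ext_group\<^esub> (zero, g u y) = (delta y u, \<one>\<^bsub>C\<^esub>)"
      using U.subset u g_closed[OF u y] by (auto simp: mult delta_def zero_def)
    then show "b u y = \<iota> (g u y)"
      using \<pi>_eq[OF relator_g[OF u y] zero[OF g_closed[OF u y]]] by (simp add: b_def \<iota>_def)
  qed
qed

end

section \<open>Groups in the variety\<close>

definition verbal :: "nat \<Rightarrow> ('a, 'r) monoid_scheme \<Rightarrow> 'a set" where
  "verbal n G = power_subgroup G n <#>\<^bsub>G\<^esub> commutator_subgroup G"

context group
begin

section \<open>Commutators, the center and G^n G' in arbitrary groups\<close>

lemma commutator_closed [simp, intro]: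
  "x \<in> carrier G \<Longrightarrow> y \<in> carrier G \<Longrightarrow> commutator G x y \<in> carrier G"
  by (simp add: commutator_def)

lemma mult_commutator:
  assumes "x \<in> carrier G" "y \<in> carrier G"
  shows "y \<otimes> x \<otimes> commutator G x y = x \<otimes> y"
proof -
  have "commutator G x y = inv (y \<otimes> x) \<otimes> (x \<otimes> y)"
    using assms by (simp add: commutator_def inv_mult_group m_assoc)
  then show ?thesis using assms by (simp add: m_assoc[symmetric])
qed

lemma commutatorI:
  assumes "x \<in> carrier G" "y \<in> carrier G" "z \<in> carrier G" "y \<otimes> x \<otimes> z = x \<otimes> y"
  shows "commutator G x y = z"
  using assms mult_commutator[of x y] by (metis commutator_closed l_cancel m_closed)

lemma commutator_eq_one_iff:
  assumes "x \<in> carrier G" "y \<in> carrier G"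
  shows "commutator G x y = \<one> \<longleftrightarrow> x \<otimes> y = y \<otimes> x"
  using assms mult_commutator[of x y] commutatorI[of x y \<one>] by auto

lemma commutator_swap:
  assumes "x \<in> carrier G" "y \<in> carrier G"
  shows "commutator G y x = inv (commutator G x y)"
  using assms by (simp add: commutator_def inv_mult_group m_assoc)

lemma subgroup_center: "subgroup (center G) G"
proof (rule subgroupI)
  have "\<one> \<in> center G" by (simp add: center_def)
  then show "center G \<noteq> {}" by blast
next
  fix x assume "x \<in> center G"
  then have x: "x \<in> carrier G" "\<And>y. y \<in> carrier G \<Longrightarrow> x \<otimes> y = y \<otimes> x" by (auto simp: center_def)
  have "inv x \<otimes> y = y \<otimes> inv x" if y: "y \<in> carrier G" for y
  proof -
    have "inv x \<otimes> y = inv x \<otimes> (y \<otimes> x) \<otimes> inv x" using x(1) y by (simp add: m_assoc)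
    also have "\<dots> = inv x \<otimes> (x \<otimes> y) \<otimes> inv x" using x(2)[OF y] by simp
    also have "\<dots> = y \<otimes> inv x" using x(1) y by (simp flip: m_assoc)
    finally show ?thesis .
  qed
  with x(1) show "inv x \<in> center G" by (simp add: center_def)
next
  fix x y assume "x \<in> center G" "y \<in> center G"
  then have xy: "x \<in> carrier G" "\<And>z. z \<in> carrier G \<Longrightarrow> x \<otimes> z = z \<otimes> x"
    "y \<in> carrier G" "\<And>z. z \<in> carrier G \<Longrightarrow> y \<otimes> z = z \<otimes> y" by (auto simp: center_def)
  have "x \<otimes> y \<otimes> z = z \<otimes> (x \<otimes> y)" if z: "z \<in> carrier G" for z
  proof -
    have "x \<otimes> y \<otimes> z = x \<otimes> (z \<otimes> y)" using xy(1,3) z xy(4)[OF z] by (simp add: m_assoc)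
    also have "\<dots> = (z \<otimes> x) \<otimes> y" using xy(1,3) z xy(2)[OF z] by (simp flip: m_assoc)
    finally show ?thesis using xy(1,3) z by (simp add: m_assoc)
  qed
  with xy(1,3) show "x \<otimes> y \<in> center G" by (simp add: center_def)
qed (auto simp: center_def)

text \<open>Minimality of G^n G' replaces computations with its elements: it is applied to centers,
  kernels and preimages of centers. For n = 0 the power part is trivial and lies in every
  subgroup.\<close>

lemma verbal_subset:
  assumes S: "subgroup S G" and pow: "\<And>x. x \<in> carrier G \<Longrightarrow> x [^] n \<in> S"
    and comm: "\<And>x y. x \<in> carrier G \<Longrightarrow> y \<in> carrier G \<Longrightarrow> commutator G x y \<in> S"
  shows "verbal n G \<subseteq> S"
proof -
  have "power_subgroup G n \<subseteq> S"
  proof (cases "n = 0")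
    case True
    then show ?thesis using subgroup.one_closed[OF S] by (simp add: power_subgroup_def)
  next
    case False
    have "generate G {x [^] n | x. x \<in> carrier G} \<subseteq> S"
      using pow by (intro generate_subgroup_incl S) auto
    with False show ?thesis by (simp add: power_subgroup_def)
  qed
  moreover have "commutator_subgroup G \<subseteq> S"
    unfolding commutator_subgroup_eq using comm S by (intro generate_subgroup_incl) auto
  ultimately show ?thesis
    using S by (auto simp: verbal_def set_mult_def intro!: subgroup.m_closed[OF S])
qed

lemma subgroup_power_subgroup: "subgroup (power_subgroup G n) G"
  unfolding power_subgroup_def using triv_subgroup by (auto intro: generate_is_subgroup)

lemma pow_in_power_subgroup: "x \<in> carrier G \<Longrightarrow> n = 0 \<or> x [^] n \<in> power_subgroup G n"
  unfolding power_subgroup_def by (auto intro: generate.incl)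

lemma subgroup_commutator_subgroup: "subgroup (commutator_subgroup G) G"
  by (rule derived_is_subgroup) simp

lemma normal_if_central:
  assumes "subgroup S G" "S \<subseteq> center G"
  shows "S \<lhd> G"
  unfolding normal_inv_iff
proof (intro conjI ballI)
  fix x h assume xh: "x \<in> carrier G" "h \<in> S"
  then have "h \<in> carrier G" "h \<otimes> x = x \<otimes> h" using assms(2) by (auto simp: center_def)
  then have "x \<otimes> h \<otimes> inv x = h" using xh by (metis inv_solve_right m_closed)
  with xh show "x \<otimes> h \<otimes> inv x \<in> S" by simp
qed fact

lemma rcoset_eqD:
  assumes "subgroup S G" "x \<in> carrier G" "y \<in> carrier G" "S #> x = S #> y"
  obtains z where "z \<in> S" "x = z \<otimes> y"
proof -
  have "x \<in> S #> y" using assms(1,2,4) rcos_self[of x S] by simp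
  then show thesis using that by (auto simp: r_coset_def)
qed

end

locale variety_group = group G for G (structure) and m n :: nat +
  assumes in_variety: "in_variety m n G"
begin

section \<open>Consequences of the identities of the variety\<close>

lemma pow_m [simp]: "x \<in> carrier G \<Longrightarrow> x [^] m = \<one>"
  using in_variety by (simp add: in_variety_def)

lemma commutator_pow_n [simp]:
  "x \<in> carrier G \<Longrightarrow> y \<in> carrier G \<Longrightarrow> commutator G x y [^] n = \<one>"
  using in_variety by (simp add: in_variety_def)

lemma commutator_commutes:
  "x \<in> carrier G \<Longrightarrow> y \<in> carrier G \<Longrightarrow> z \<in> carrier G \<Longrightarrow> commutator G x y \<otimes> z = z \<otimes> commutator G x y"
  using in_variety commutator_eq_one_iff[of "commutator G x y" z] by (simp add: in_variety_def)

text \<open>Class two lets [x, z] move past y; the rest is regrouping. Bilinearity of the commutator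
  underlies every later computation.\<close>

lemma commutator_mult_left:
  assumes "x \<in> carrier G" "y \<in> carrier G" "z \<in> carrier G"
  shows "commutator G (x \<otimes> y) z = commutator G x z \<otimes> commutator G y z"
proof (rule commutatorI)
  have "z \<otimes> (x \<otimes> y) \<otimes> (commutator G x z \<otimes> commutator G y z)
    = z \<otimes> x \<otimes> (y \<otimes> commutator G x z) \<otimes> commutator G y z" using assms by (simp add: m_assoc)
  also have "\<dots> = z \<otimes> x \<otimes> (commutator G x z \<otimes> y) \<otimes> commutator G y z"
    using assms by (simp add: commutator_commutes)
  also have "\<dots> = (z \<otimes> x \<otimes> commutator G x z) \<otimes> y \<otimes> commutator G y z"
    using assms by (simp add: m_assoc)
  also have "\<dots> = x \<otimes> (z \<otimes> y \<otimes> commutator G y z)"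
    using assms by (subst mult_commutator) (auto simp: m_assoc)
  also have "\<dots> = x \<otimes> y \<otimes> z"
    using assms by (subst mult_commutator) (auto simp: m_assoc)
  finally show "z \<otimes> (x \<otimes> y) \<otimes> (commutator G x z \<otimes> commutator G y z) = x \<otimes> y \<otimes> z" .
qed (use assms in auto)

lemma commutator_mult_right:
  assumes "x \<in> carrier G" "y \<in> carrier G" "z \<in> carrier G"
  shows "commutator G x (y \<otimes> z) = commutator G x y \<otimes> commutator G x z"
proof -
  have "commutator G x (y \<otimes> z) = inv (commutator G y x \<otimes> commutator G z x)"
    using assms commutator_swap[of "y \<otimes> z" x] by (simp add: commutator_mult_left)
  also have "\<dots> = inv (commutator G z x) \<otimes> inv (commutator G y x)"
    using assms by (simp add: inv_mult_group)
  also have "\<dots> = commutator G x z \<otimes> commutator G x y"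
    using assms commutator_swap[of z x] commutator_swap[of y x] by simp
  finally show ?thesis using assms commutator_commutes[of x z "commutator G x y"] by simp
qed

lemma commutator_pow_left:
  assumes "x \<in> carrier G" "y \<in> carrier G"
  shows "commutator G (x [^] (k :: nat)) y = commutator G x y [^] k"
proof -
  interpret h: group_hom G G "\<lambda>x. commutator G x y"
    by unfold_locales (use assms in \<open>auto simp: hom_def commutator_mult_left\<close>)
  show ?thesis using assms by (simp add: h.hom_nat_pow)
qed

lemma commutator_pow_right:
  assumes "x \<in> carrier G" "y \<in> carrier G"
  shows "commutator G x (y [^] (k :: nat)) = commutator G x y [^] k"
proof -
  interpret h: group_hom G G "\<lambda>y. commutator G x y"
    by unfold_locales (use assms in \<open>auto simp: hom_def commutator_mult_right\<close>)
  show ?thesis using assms by (simp add: h.hom_nat_pow)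
qed

lemma commutator_inv_left:
  assumes "x \<in> carrier G" "y \<in> carrier G"
  shows "commutator G (inv x) y = inv (commutator G x y)"
proof -
  interpret h: group_hom G G "\<lambda>x. commutator G x y"
    by unfold_locales (use assms in \<open>auto simp: hom_def commutator_mult_left\<close>)
  show ?thesis using assms by simp
qed

lemma commutator_center_left: "z \<in> center G \<Longrightarrow> x \<in> carrier G \<Longrightarrow> commutator G z x = \<one>"
  by (auto simp: center_def commutator_eq_one_iff)

lemma commutator_center_right: "z \<in> center G \<Longrightarrow> x \<in> carrier G \<Longrightarrow> commutator G x z = \<one>"
  by (auto simp: center_def commutator_eq_one_iff)

lemma commutator_in_center: "x \<in> carrier G \<Longrightarrow> y \<in> carrier G \<Longrightarrow> commutator G x y \<in> center G"
  by (simp add: center_def commutator_commutes)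

lemma pow_n_in_center:
  assumes x: "x \<in> carrier G"
  shows "x [^] n \<in> center G"
proof -
  have "commutator G (x [^] n) y = \<one>" if "y \<in> carrier G" for y
    using x that by (simp add: commutator_pow_left)
  then show ?thesis using x by (simp add: center_def commutator_eq_one_iff)
qed

lemma verbal_subset_center: "verbal n G \<subseteq> center G"
  by (intro verbal_subset subgroup_center pow_n_in_center commutator_in_center)

lemma verbal_carrier: "x \<in> verbal n G \<Longrightarrow> x \<in> carrier G"
  using verbal_subset_center by (auto simp: center_def)

lemma verbal_commutes: "z \<in> verbal n G \<Longrightarrow> x \<in> carrier G \<Longrightarrow> z \<otimes> x = x \<otimes> z"
  using verbal_subset_center by (auto simp: center_def)

lemma subgroup_verbal: "subgroup (verbal n G) G"
proof -
  have "commutator_subgroup G \<subseteq> center G"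
    unfolding commutator_subgroup_eq
    by (intro generate_subgroup_incl subgroup_center) (auto simp: commutator_in_center)
  then have "commutator_subgroup G \<lhd> G"
    by (intro normal_if_central subgroup_commutator_subgroup)
  then show ?thesis
    unfolding verbal_def
    using mult_norm_subgroup[OF _ subgroup_power_subgroup] commut_normal[OF subgroup_power_subgroup]
    by simp
qed

lemma normal_verbal: "verbal n G \<lhd> G"
  by (rule normal_if_central[OF subgroup_verbal verbal_subset_center])

lemma commutator_in_verbal:
  assumes "x \<in> carrier G" "y \<in> carrier G"
  shows "commutator G x y \<in> verbal n G"
proof -
  have "commutator G x y \<in> commutator_subgroup G"
    unfolding commutator_subgroup_eq using assms by (auto intro: generate.incl)
  then have "\<one> \<otimes> commutator G x y \<in> verbal n G"
    unfolding verbal_def set_mult_def using subgroup.one_closed[OF subgroup_power_subgroup] by blast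
  then show ?thesis using assms by simp
qed

lemma pow_n_in_verbal:
  assumes "x \<in> carrier G"
  shows "x [^] n \<in> verbal n G"
proof (cases "n = 0")
  case True
  then show ?thesis using subgroup.one_closed[OF subgroup_verbal] by simp
next
  case False
  then have "x [^] n \<in> power_subgroup G n" using pow_in_power_subgroup[OF assms, of n] by simp
  then have "x [^] n \<otimes> \<one> \<in> verbal n G"
    unfolding verbal_def set_mult_def using subgroup.one_closed[OF subgroup_commutator_subgroup] by blast
  then show ?thesis using assms by simp
qed

text \<open>The commutators lie in this subgroup, which unlike the whole verbal subgroup has exponent \<open>n\<close>.\<close>

abbreviation torsion_verbal :: "'a set" where
  "torsion_verbal \<equiv> {x \<in> verbal n G. x [^] n = \<one>}"

lemma subgroup_torsion_verbal: "subgroup torsion_verbal G"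
proof (rule subgroupI)
  note S = subgroup_verbal
  have "\<one> \<in> torsion_verbal" using subgroup.one_closed[OF S] by simp
  then show "torsion_verbal \<noteq> {}" by blast
  show "inv x \<in> torsion_verbal" if "x \<in> torsion_verbal" for x
    using that verbal_carrier[of x] subgroup.m_inv_closed[OF S] by (simp add: nat_pow_inv)
  show "x \<otimes> y \<in> torsion_verbal" if "x \<in> torsion_verbal" "y \<in> torsion_verbal" for x y
    using that verbal_carrier[of x] verbal_carrier[of y] subgroup.m_closed[OF S]
      pow_mult_distrib[of x y n] verbal_commutes[of x y] by simp
qed (auto dest: verbal_carrier)

lemma commutator_in_torsion_verbal:
  "x \<in> carrier G \<Longrightarrow> y \<in> carrier G \<Longrightarrow> commutator G x y \<in> torsion_verbal"
  by (simp add: commutator_in_verbal)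

lemma comm_group_torsion_verbal: "comm_group (G\<lparr>carrier := torsion_verbal\<rparr>)"
proof -
  interpret T: group "G\<lparr>carrier := torsion_verbal\<rparr>"
    using subgroup.subgroup_is_group[OF subgroup_torsion_verbal group_axioms] .
  show ?thesis
    by (rule T.group_comm_groupI) (auto intro: verbal_commutes dest: verbal_carrier)
qed

lemma comm_group_quotient: "comm_group (G Mod verbal n G)"
proof -
  interpret N: normal "verbal n G" G by (rule normal_verbal)
  interpret Q: group "G Mod verbal n G" by (rule N.factorgroup_is_group)
  show ?thesis
  proof (rule Q.group_comm_groupI)
    fix \<xi> \<eta> assume "\<xi> \<in> carrier (G Mod verbal n G)" "\<eta> \<in> carrier (G Mod verbal n G)"
    then obtain x y where xy: "x \<in> carrier G" "y \<in> carrier G" "\<xi> = verbal n G #> x" "\<eta> = verbal n G #> y"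
      by (auto simp: carrier_FactGroup)
    have "x \<otimes> y = commutator G x y \<otimes> (y \<otimes> x)"
      using xy mult_commutator[of x y] commutator_commutes[of x y "y \<otimes> x"] by simp
    then have "verbal n G #> (x \<otimes> y) = verbal n G #> (y \<otimes> x)"
      using xy commutator_in_verbal[of x y]
      by (metis coset_join2 coset_mult_assoc m_closed N.subset commutator_closed subgroup_verbal)
    then show "\<xi> \<otimes>\<^bsub>G Mod verbal n G\<^esub> \<eta> = \<eta> \<otimes>\<^bsub>G Mod verbal n G\<^esub> \<xi>"
      using xy by (simp add: N.rcos_sum)
  qed
qed

lemma quotient_pow_n:
  assumes "\<xi> \<in> carrier (G Mod verbal n G)"
  shows "\<xi> [^]\<^bsub>G Mod verbal n G\<^esub> n = \<one>\<^bsub>G Mod verbal n G\<^esub>"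
proof -
  interpret N: normal "verbal n G" G by (rule normal_verbal)
  obtain x where x: "x \<in> carrier G" "\<xi> = verbal n G #> x"
    using assms by (auto simp: carrier_FactGroup)
  have "verbal n G #> (x [^] n) = verbal n G"
    using x pow_n_in_verbal[of x] by (intro coset_join2 subgroup_verbal) auto
  then show ?thesis using x by (simp add: N.FactGroup_pow)
qed

end

lemma in_variety_surj_hom:
  assumes M: "in_variety m n M" and N: "group N"
    and h: "h \<in> hom M N" and surj: "h ` carrier M = carrier N"
  shows "in_variety m n N"
proof -
  have gM: "group M" using M by (simp add: in_variety_def)
  interpret h: group_hom M N h
    using N gM h by (simp add: group_hom_def group_hom_axioms_def)
  have h_comm: "commutator N (h x) (h y) = h (commutator M x y)"
    if "x \<in> carrier M" "y \<in> carrier M" for x y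
    using that by (simp add: commutator_def)
  have vM: "x [^]\<^bsub>M\<^esub> m = \<one>\<^bsub>M\<^esub>" "commutator M x y [^]\<^bsub>M\<^esub> n = \<one>\<^bsub>M\<^esub>"
    "commutator M (commutator M x y) z = \<one>\<^bsub>M\<^esub>"
    if "x \<in> carrier M" "y \<in> carrier M" "z \<in> carrier M" for x y z
    using that M by (auto simp: in_variety_def)
  have "h x [^]\<^bsub>N\<^esub> m = \<one>\<^bsub>N\<^esub>" if "x \<in> carrier M" for x
    using that vM(1)[of x x x] h.hom_nat_pow[of x m] by simp
  moreover have "commutator N (h x) (h y) [^]\<^bsub>N\<^esub> n = \<one>\<^bsub>N\<^esub>"
    if "x \<in> carrier M" "y \<in> carrier M" for x y
    using that vM(2)[of x y x] h.hom_nat_pow[of "commutator M x y" n] by (simp add: h_comm)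
  moreover have "commutator N (commutator N (h x) (h y)) (h z) = \<one>\<^bsub>N\<^esub>"
    if "x \<in> carrier M" "y \<in> carrier M" "z \<in> carrier M" for x y z
    using that vM(3)[of x y z] by (simp add: h_comm)
  ultimately show ?thesis
    unfolding in_variety_def using N by (simp flip: surj)
qed

section \<open>Twisted products\<close>

text \<open>The two divisibilities needed for m-th powers in the twisted product. For m = 2j the
  hypothesis says that n divides j, and the binomial coefficient is j(m-1); for odd m it is m times
  the integer (m-1)/2.\<close>

lemma dvd_choose_two:
  fixes m n :: nat
  assumes "n dvd m div gcd 2 m"
  shows "n dvd m" "n dvd m choose 2"
proof -
  have "m div gcd 2 m dvd m" by (metis dvd_def dvd_mult_div_cancel gcd_dvd2 mult.commute)
  with assms show "n dvd m" by (rule dvd_trans)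
  show "n dvd m choose 2"
  proof (cases "even m")
    case True
    then obtain j where j: "m = 2 * j" by blast
    then have "n dvd j" using assms by simp
    moreover have "m choose 2 = j * (m - 1)" using j by (simp add: choose_two)
    ultimately show ?thesis by simp
  next
    case False
    then have "even (m - 1)" by simp
    then obtain j where j: "m - 1 = 2 * j" by blast
    have "m choose 2 = m * j" unfolding choose_two j by simp
    with \<open>n dvd m\<close> show ?thesis by simp
  qed
qed

text \<open>A prescribed bilinear map \<open>c\<close> is to be realized as the commutator of
  elements of A with elements of B. Exponent n of \<open>E\<close> matches the identity on n-th
  powers of commutators.\<close>

locale twisted_product =
  A: variety_group A m n + B: variety_group B m n + E: comm_group E
  for A :: "('a, 'r) monoid_scheme" and B :: "('b, 's) monoid_scheme"
    and E :: "('e, 't) monoid_scheme" and m n +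
  fixes c :: "'a \<Rightarrow> 'b \<Rightarrow> 'e"
  assumes dvd: "n dvd m div gcd 2 m"
    and exp_E: "e \<in> carrier E \<Longrightarrow> e [^]\<^bsub>E\<^esub> n = \<one>\<^bsub>E\<^esub>"
    and c_closed [simp]: "a \<in> carrier A \<Longrightarrow> b \<in> carrier B \<Longrightarrow> c a b \<in> carrier E"
    and c_mult_left: "a \<in> carrier A \<Longrightarrow> a' \<in> carrier A \<Longrightarrow> b \<in> carrier B \<Longrightarrow>
      c (a \<otimes>\<^bsub>A\<^esub> a') b = c a b \<otimes>\<^bsub>E\<^esub> c a' b"
    and c_mult_right: "a \<in> carrier A \<Longrightarrow> b \<in> carrier B \<Longrightarrow> b' \<in> carrier B \<Longrightarrow>
      c a (b \<otimes>\<^bsub>B\<^esub> b') = c a b \<otimes>\<^bsub>E\<^esub> c a b'"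
begin

section \<open>The bilinear map vanishes on the verbal subgroups\<close>

lemma c_hom_left: "b \<in> carrier B \<Longrightarrow> group_hom A E (\<lambda>a. c a b)"
  by unfold_locales (auto simp: hom_def c_mult_left)

lemma c_hom_right: "a \<in> carrier A \<Longrightarrow> group_hom B E (c a)"
  by unfold_locales (auto simp: hom_def c_mult_right)

lemma c_one_left [simp]: "b \<in> carrier B \<Longrightarrow> c \<one>\<^bsub>A\<^esub> b = \<one>\<^bsub>E\<^esub>"
  using group_hom.hom_one[OF c_hom_left] .

lemma c_one_right [simp]: "a \<in> carrier A \<Longrightarrow> c a \<one>\<^bsub>B\<^esub> = \<one>\<^bsub>E\<^esub>"
  using group_hom.hom_one[OF c_hom_right] .

lemma c_inv_left: "a \<in> carrier A \<Longrightarrow> b \<in> carrier B \<Longrightarrow> c (inv\<^bsub>A\<^esub> a) b = inv\<^bsub>E\<^esub> c a b"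
  using group_hom.hom_inv[OF c_hom_left] .

lemma c_inv_right: "a \<in> carrier A \<Longrightarrow> b \<in> carrier B \<Longrightarrow> c a (inv\<^bsub>B\<^esub> b) = inv\<^bsub>E\<^esub> c a b"
  using group_hom.hom_inv[OF c_hom_right] .

lemma c_pow_left: "a \<in> carrier A \<Longrightarrow> b \<in> carrier B \<Longrightarrow> c (a [^]\<^bsub>A\<^esub> (k :: nat)) b = c a b [^]\<^bsub>E\<^esub> k"
  using group_hom.hom_nat_pow[OF c_hom_left] .

lemma c_pow_right: "a \<in> carrier A \<Longrightarrow> b \<in> carrier B \<Longrightarrow> c a (b [^]\<^bsub>B\<^esub> (k :: nat)) = c a b [^]\<^bsub>E\<^esub> k"
  using group_hom.hom_nat_pow[OF c_hom_right] .

lemma c_commutator_left: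
  assumes "a \<in> carrier A" "a' \<in> carrier A" "b \<in> carrier B"
  shows "c (commutator A a a') b = \<one>\<^bsub>E\<^esub>"
  using assms by (simp add: commutator_def c_mult_left c_inv_left E.m_assoc flip: E.inv_mult)

lemma c_commutator_right:
  assumes "a \<in> carrier A" "b \<in> carrier B" "b' \<in> carrier B"
  shows "c a (commutator B b b') = \<one>\<^bsub>E\<^esub>"
  using assms by (simp add: commutator_def c_mult_right c_inv_right E.m_assoc flip: E.inv_mult)

text \<open>The kernel of c(-, b) contains the n-th powers because \<open>E\<close> has exponent n,
  and the commutators because \<open>E\<close> is abelian.\<close>

lemma c_verbal_left [simp]:
  assumes "x \<in> verbal n A" "b \<in> carrier B"
  shows "c x b = \<one>\<^bsub>E\<^esub>"
proof -
  have "verbal n A \<subseteq> kernel A E (\<lambda>a. c a b)"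
    using assms(2) group_hom.subgroup_kernel[OF c_hom_left]
    by (intro A.verbal_subset) (auto simp: kernel_def c_pow_left c_commutator_left exp_E)
  with assms show ?thesis by (auto simp: kernel_def)
qed

lemma c_verbal_right [simp]:
  assumes "a \<in> carrier A" "y \<in> verbal n B"
  shows "c a y = \<one>\<^bsub>E\<^esub>"
proof -
  have "verbal n B \<subseteq> kernel B E (c a)"
    using assms(1) group_hom.subgroup_kernel[OF c_hom_right]
    by (intro B.verbal_subset) (auto simp: kernel_def c_pow_right c_commutator_right exp_E)
  with assms show ?thesis by (auto simp: kernel_def)
qed

text \<open>The cocycle is chosen such that \<open>[a, b] = c a b\<close>.\<close>

definition twisted :: "('a \<times> 'b \<times> 'e) monoid" where
  "twisted = \<lparr>carrier = carrier A \<times> carrier B \<times> carrier E,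
     monoid.mult = (\<lambda>(a, b, e) (a', b', e'). (a \<otimes>\<^bsub>A\<^esub> a', b \<otimes>\<^bsub>B\<^esub> b', e \<otimes>\<^bsub>E\<^esub> e' \<otimes>\<^bsub>E\<^esub> inv\<^bsub>E\<^esub> c a' b)),
     one = (\<one>\<^bsub>A\<^esub>, \<one>\<^bsub>B\<^esub>, \<one>\<^bsub>E\<^esub>)\<rparr>"

section \<open>The twisted product lies in the variety\<close>

lemma carrier_twisted [simp]: "carrier twisted = carrier A \<times> carrier B \<times> carrier E"
  and one_twisted [simp]: "\<one>\<^bsub>twisted\<^esub> = (\<one>\<^bsub>A\<^esub>, \<one>\<^bsub>B\<^esub>, \<one>\<^bsub>E\<^esub>)"
  and mult_twisted [simp]: "(a, b, e) \<otimes>\<^bsub>twisted\<^esub> (a', b', e') =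
    (a \<otimes>\<^bsub>A\<^esub> a', b \<otimes>\<^bsub>B\<^esub> b', e \<otimes>\<^bsub>E\<^esub> e' \<otimes>\<^bsub>E\<^esub> inv\<^bsub>E\<^esub> c a' b)"
  by (simp_all add: twisted_def)

lemma group_twisted: "group twisted"
proof (rule groupI)
  fix x y z assume "x \<in> carrier twisted" "y \<in> carrier twisted" "z \<in> carrier twisted"
  then obtain a b e a' b' e' a'' b'' e'' where "x = (a, b, e)" "y = (a', b', e')" "z = (a'', b'', e'')"
    "a \<in> carrier A" "b \<in> carrier B" "e \<in> carrier E" "a' \<in> carrier A" "b' \<in> carrier B" "e' \<in> carrier E"
    "a'' \<in> carrier A" "b'' \<in> carrier B" "e'' \<in> carrier E"
    by auto
  then show "x \<otimes>\<^bsub>twisted\<^esub> y \<otimes>\<^bsub>twisted\<^esub> z = x \<otimes>\<^bsub>twisted\<^esub> (y \<otimes>\<^bsub>twisted\<^esub> z)"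
    by (simp add: A.m_assoc B.m_assoc c_mult_left c_mult_right E.inv_mult E.m_ac)
next
  fix x assume "x \<in> carrier twisted"
  then obtain a b e where x: "x = (a, b, e)" "a \<in> carrier A" "b \<in> carrier B" "e \<in> carrier E" by auto
  \<comment> \<open>The product with x has the cocycle term \<open>inv c a (inv b)\<close>, which is
    \<open>c a b\<close>; the last factor of the third entry cancels it.\<close>
  let ?y = "(inv\<^bsub>A\<^esub> a, inv\<^bsub>B\<^esub> b, inv\<^bsub>E\<^esub> e \<otimes>\<^bsub>E\<^esub> inv\<^bsub>E\<^esub> c a b)"
  have "?y \<otimes>\<^bsub>twisted\<^esub> x = \<one>\<^bsub>twisted\<^esub>" "?y \<in> carrier twisted"
    using x by (simp_all add: c_inv_right E.m_ac)
  then show "\<exists>y\<in>carrier twisted. y \<otimes>\<^bsub>twisted\<^esub> x = \<one>\<^bsub>twisted\<^esub>" by blast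
qed auto

text \<open>Passing from exponent k to k + 1 adds the cocycle term of \<open>a\<close> with the k-th
  power of \<open>b\<close>, that is, k copies of \<open>inv c a b\<close>. Summing 0, ..., k - 1
  gives the binomial coefficient.\<close>

lemma pow_twisted:
  assumes "a \<in> carrier A" "b \<in> carrier B" "e \<in> carrier E"
  shows "(a, b, e) [^]\<^bsub>twisted\<^esub> (k :: nat) =
    (a [^]\<^bsub>A\<^esub> k, b [^]\<^bsub>B\<^esub> k, e [^]\<^bsub>E\<^esub> k \<otimes>\<^bsub>E\<^esub> inv\<^bsub>E\<^esub> (c a b [^]\<^bsub>E\<^esub> (k choose 2)))"
proof (induction k)
  case (Suc k)
  have "Suc k choose 2 = k + (k choose 2)" by (simp add: numeral_2_eq_2)
  with Suc assms show ?case
    by (simp add: c_pow_right E.inv_mult E.m_ac flip: E.nat_pow_mult)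
qed (simp add: binomial_eq_0)

lemma commutator_twisted:
  assumes "a \<in> carrier A" "b \<in> carrier B" "e \<in> carrier E"
    and "a' \<in> carrier A" "b' \<in> carrier B" "e' \<in> carrier E"
  shows "commutator twisted (a, b, e) (a', b', e') =
    (commutator A a a', commutator B b b', c a b' \<otimes>\<^bsub>E\<^esub> inv\<^bsub>E\<^esub> c a' b)"
proof (rule group.commutatorI[OF group_twisted])
  \<comment> \<open>Multiplying by the claimed commutator adds no cocycle term, because
    \<open>c\<close> is trivial on \<open>commutator A a a'\<close>; what remains is an identity in
    \<open>E\<close>.\<close>
  have "e' \<otimes>\<^bsub>E\<^esub> e \<otimes>\<^bsub>E\<^esub> inv\<^bsub>E\<^esub> c a b' \<otimes>\<^bsub>E\<^esub> (c a b' \<otimes>\<^bsub>E\<^esub> inv\<^bsub>E\<^esub> c a' b) = e \<otimes>\<^bsub>E\<^esub> e' \<otimes>\<^bsub>E\<^esub> inv\<^bsub>E\<^esub> c a' b"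
  proof -
    have "inv\<^bsub>E\<^esub> c a b' \<otimes>\<^bsub>E\<^esub> (c a b' \<otimes>\<^bsub>E\<^esub> inv\<^bsub>E\<^esub> c a' b) = inv\<^bsub>E\<^esub> c a' b"
      using assms by (simp flip: E.m_assoc)
    then show ?thesis using assms E.m_comm[of e' e] by (simp add: E.m_assoc)
  qed
  then show "(a', b', e') \<otimes>\<^bsub>twisted\<^esub> (a, b, e) \<otimes>\<^bsub>twisted\<^esub>
      (commutator A a a', commutator B b b', c a b' \<otimes>\<^bsub>E\<^esub> inv\<^bsub>E\<^esub> c a' b) =
    (a, b, e) \<otimes>\<^bsub>twisted\<^esub> (a', b', e')"
    using assms by (simp add: A.mult_commutator B.mult_commutator c_commutator_left)
qed (use assms in auto)

lemma in_variety_twisted: "in_variety m n twisted"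
  unfolding in_variety_def
proof (intro conjI ballI)
  have E_pow: "e [^]\<^bsub>E\<^esub> k = \<one>\<^bsub>E\<^esub>" if e: "e \<in> carrier E" and k: "n dvd k" for e k
  proof -
    obtain j where "k = n * j" using k by blast
    then show ?thesis using e exp_E by (simp flip: E.nat_pow_pow)
  qed
  show "group twisted" by (rule group_twisted)
  show "x [^]\<^bsub>twisted\<^esub> m = \<one>\<^bsub>twisted\<^esub>" if "x \<in> carrier twisted" for x
    using that dvd_choose_two[OF dvd] by (auto simp: pow_twisted E_pow)
  show "commutator twisted x y [^]\<^bsub>twisted\<^esub> n = \<one>\<^bsub>twisted\<^esub>"
    if "x \<in> carrier twisted" "y \<in> carrier twisted" for x y
    using that by (auto simp: commutator_twisted pow_twisted E_pow c_commutator_left)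
  show "commutator twisted (commutator twisted x y) z = \<one>\<^bsub>twisted\<^esub>"
    if "x \<in> carrier twisted" "y \<in> carrier twisted" "z \<in> carrier twisted" for x y z
    using that by (auto simp: commutator_twisted c_commutator_left c_commutator_right
        A.commutator_center_left B.commutator_center_left A.commutator_in_center B.commutator_in_center)
qed

text \<open>The groups \<open>S\<close> and \<open>T\<close> hold the commutators with D, and
  \<open>\<sigma>\<close> and \<open>\<tau>\<close> place them in \<open>E\<close>. The conditions
  on \<open>c\<close> say that [a, d] and [d, b] in the twisted product agree with their values in A
  and B; this makes the subgroup of identifications normal. Assumption \<open>sep\<close> makes it
  avoid A and B; taking one of x, y and d trivial, it contains the injectivity of
  \<open>\<sigma>\<close> and \<open>\<tau>\<close>.\<close>

lemma weak_embedding_quotient: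
  fixes D :: "('d, 'u) monoid_scheme"
  assumes D: "group D" and \<alpha>: "\<alpha> \<in> hom D A" and \<beta>: "\<beta> \<in> hom D B"
    and S: "subgroup S A" "S \<subseteq> verbal n A" "\<And>a d. a \<in> carrier A \<Longrightarrow> d \<in> carrier D \<Longrightarrow> commutator A a (\<alpha> d) \<in> S"
    and T: "subgroup T B" "T \<subseteq> verbal n B" "\<And>b d. b \<in> carrier B \<Longrightarrow> d \<in> carrier D \<Longrightarrow> commutator B (\<beta> d) b \<in> T"
    and \<sigma>: "\<sigma> \<in> hom (A\<lparr>carrier := S\<rparr>) E" and \<tau>: "\<tau> \<in> hom (B\<lparr>carrier := T\<rparr>) E"
    and c\<sigma>: "\<And>a d. a \<in> carrier A \<Longrightarrow> d \<in> carrier D \<Longrightarrow> c a (\<beta> d) = \<sigma> (commutator A a (\<alpha> d))"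
    and c\<tau>: "\<And>b d. b \<in> carrier B \<Longrightarrow> d \<in> carrier D \<Longrightarrow> c (\<alpha> d) b = \<tau> (commutator B (\<beta> d) b)"
    and sep: "\<And>x y d. x \<in> S \<Longrightarrow> y \<in> T \<Longrightarrow> \<sigma> x = \<tau> y \<Longrightarrow> d \<in> carrier D \<Longrightarrow> x = \<alpha> d \<longleftrightarrow> y = \<beta> d"
  obtains M :: "('a \<times> 'b \<times> 'e) set monoid" and \<phi> \<psi> where "weak_embedding m n A B D \<alpha> \<beta> M \<phi> \<psi>"
proof -
  interpret D: group D by (rule D)
  interpret \<alpha>: group_hom D A \<alpha> by unfold_locales (rule \<alpha>)
  interpret \<beta>: group_hom D B \<beta> by unfold_locales (rule \<beta>)
  interpret F: group twisted by (rule group_twisted)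
  interpret S: subgroup S A by (rule S(1))
  interpret T: subgroup T B by (rule T(1))
  interpret \<sigma>: group_hom "A\<lparr>carrier := S\<rparr>" E \<sigma>
    using S.subgroup_is_group[OF A.group_axioms] \<sigma> E.group_axioms
    by (simp add: group_hom_def group_hom_axioms_def)
  interpret \<tau>: group_hom "B\<lparr>carrier := T\<rparr>" E \<tau>
    using T.subgroup_is_group[OF B.group_axioms] \<tau> E.group_axioms
    by (simp add: group_hom_def group_hom_axioms_def)
  have \<sigma>_mult: "\<sigma> (x \<otimes>\<^bsub>A\<^esub> x') = \<sigma> x \<otimes>\<^bsub>E\<^esub> \<sigma> x'" if "x \<in> S" "x' \<in> S" for x x'
    using \<sigma>.hom_mult[of x x'] that by simp
  have \<tau>_mult: "\<tau> (x \<otimes>\<^bsub>B\<^esub> x') = \<tau> x \<otimes>\<^bsub>E\<^esub> \<tau> x'" if "x \<in> T" "x' \<in> T" for x x'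
    using \<tau>.hom_mult[of x x'] that by simp
  have \<sigma>_inv: "\<sigma> (inv\<^bsub>A\<^esub> x) = inv\<^bsub>E\<^esub> \<sigma> x" if "x \<in> S" for x
    using \<sigma>.hom_inv[of x] that by (simp add: A.m_inv_consistent[OF S(1)])
  have \<tau>_inv: "\<tau> (inv\<^bsub>B\<^esub> x) = inv\<^bsub>E\<^esub> \<tau> x" if "x \<in> T" for x
    using \<tau>.hom_inv[of x] that by (simp add: B.m_inv_consistent[OF T(1)])
  have [simp]: "\<sigma> x \<in> carrier E" if "x \<in> S" for x using \<sigma>.hom_closed[of x] that by simp
  have [simp]: "\<tau> x \<in> carrier E" if "x \<in> T" for x using \<tau>.hom_closed[of x] that by simp
  have \<sigma>_one: "\<sigma> \<one>\<^bsub>A\<^esub> = \<one>\<^bsub>E\<^esub>" using \<sigma>.hom_one by simp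
  have \<tau>_one: "\<tau> \<one>\<^bsub>B\<^esub> = \<one>\<^bsub>E\<^esub>" using \<tau>.hom_one by simp
  have SV: "x \<in> verbal n A" if "x \<in> S" for x using S(2) that by auto
  have TV: "x \<in> verbal n B" if "x \<in> T" for x using T(2) that by auto
  note S_comm = A.verbal_commutes[OF SV] and T_comm = B.verbal_commutes[OF TV]

  \<comment> \<open>\<open>N\<close> identifies \<open>\<alpha> d\<close> with \<open>\<beta> d\<close>, and \<open>S\<close> and \<open>T\<close> with their images in \<open>E\<close>.\<close>
  define N where "N = {(\<alpha> d \<otimes>\<^bsub>A\<^esub> x, inv\<^bsub>B\<^esub> \<beta> d \<otimes>\<^bsub>B\<^esub> y, inv\<^bsub>E\<^esub> \<sigma> x \<otimes>\<^bsub>E\<^esub> inv\<^bsub>E\<^esub> \<tau> y) | d x y.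
    d \<in> carrier D \<and> x \<in> S \<and> y \<in> T}"
  have NI: "(a, b, e) \<in> N" if "d \<in> carrier D" "x \<in> S" "y \<in> T" "a = \<alpha> d \<otimes>\<^bsub>A\<^esub> x" "b = inv\<^bsub>B\<^esub> \<beta> d \<otimes>\<^bsub>B\<^esub> y"
    "e = inv\<^bsub>E\<^esub> \<sigma> x \<otimes>\<^bsub>E\<^esub> inv\<^bsub>E\<^esub> \<tau> y" for a b e d x y
    unfolding N_def using that by blast
  \<comment> \<open>These are the cocycle values occurring inside \<open>N\<close>: the parts x and
    y are verbal and do not contribute, and the rest is prescribed by
    \<open>c\<tau>\<close>.\<close>
  have c_\<alpha>\<beta>: "c (\<alpha> d \<otimes>\<^bsub>A\<^esub> x) (inv\<^bsub>B\<^esub> \<beta> d' \<otimes>\<^bsub>B\<^esub> y) = inv\<^bsub>E\<^esub> \<tau> (commutator B (\<beta> d) (\<beta> d'))"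
    if "d \<in> carrier D" "d' \<in> carrier D" "x \<in> S" "y \<in> T" for d d' x y
    using that T(3) by (simp add: c_mult_left c_mult_right c_inv_right SV TV c\<tau>)
  have N_sub: "subgroup N twisted"
  proof (rule F.subgroupI)
    show "N \<subseteq> carrier twisted" by (auto simp: N_def)
    have "(\<one>\<^bsub>A\<^esub>, \<one>\<^bsub>B\<^esub>, \<one>\<^bsub>E\<^esub>) \<in> N"
      by (rule NI[of "\<one>\<^bsub>D\<^esub>" "\<one>\<^bsub>A\<^esub>" "\<one>\<^bsub>B\<^esub>"]) (simp_all add: \<sigma>_one \<tau>_one)
    then show "N \<noteq> {}" by blast
  next
    fix g assume "g \<in> N"
    then obtain d x y where g: "d \<in> carrier D" "x \<in> S" "y \<in> T"
      "g = (\<alpha> d \<otimes>\<^bsub>A\<^esub> x, inv\<^bsub>B\<^esub> \<beta> d \<otimes>\<^bsub>B\<^esub> y, inv\<^bsub>E\<^esub> \<sigma> x \<otimes>\<^bsub>E\<^esub> inv\<^bsub>E\<^esub> \<tau> y)"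
      unfolding N_def by blast
    define h where "h = (\<alpha> (inv\<^bsub>D\<^esub> d) \<otimes>\<^bsub>A\<^esub> inv\<^bsub>A\<^esub> x, inv\<^bsub>B\<^esub> \<beta> (inv\<^bsub>D\<^esub> d) \<otimes>\<^bsub>B\<^esub> inv\<^bsub>B\<^esub> y,
      inv\<^bsub>E\<^esub> \<sigma> (inv\<^bsub>A\<^esub> x) \<otimes>\<^bsub>E\<^esub> inv\<^bsub>E\<^esub> \<tau> (inv\<^bsub>B\<^esub> y))"
    have h: "h \<in> N" unfolding h_def using g by (intro NI[of "inv\<^bsub>D\<^esub> d" "inv\<^bsub>A\<^esub> x" "inv\<^bsub>B\<^esub> y"]) auto
    \<comment> \<open>The images of d and its inverse commute, so the cocycle term in the product of
      \<open>h\<close> and \<open>g\<close> vanishes.\<close>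
    have "commutator B (\<beta> d) (\<beta> (inv\<^bsub>D\<^esub> d)) = \<one>\<^bsub>B\<^esub>"
      using g by (subst B.commutator_eq_one_iff) auto
    then have "c (\<alpha> d \<otimes>\<^bsub>A\<^esub> x) (inv\<^bsub>B\<^esub> \<beta> (inv\<^bsub>D\<^esub> d) \<otimes>\<^bsub>B\<^esub> inv\<^bsub>B\<^esub> y) = \<one>\<^bsub>E\<^esub>"
      using g by (subst c_\<alpha>\<beta>) (auto simp: \<tau>_one)
    moreover have "\<alpha> (inv\<^bsub>D\<^esub> d) \<otimes>\<^bsub>A\<^esub> inv\<^bsub>A\<^esub> x \<otimes>\<^bsub>A\<^esub> (\<alpha> d \<otimes>\<^bsub>A\<^esub> x) = \<one>\<^bsub>A\<^esub>"
      using g S_comm[of x "\<alpha> d"] by (simp flip: A.inv_mult_group)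
    moreover have "inv\<^bsub>B\<^esub> \<beta> (inv\<^bsub>D\<^esub> d) \<otimes>\<^bsub>B\<^esub> inv\<^bsub>B\<^esub> y \<otimes>\<^bsub>B\<^esub> (inv\<^bsub>B\<^esub> \<beta> d \<otimes>\<^bsub>B\<^esub> y) = \<one>\<^bsub>B\<^esub>"
    proof -
      have "inv\<^bsub>B\<^esub> \<beta> (inv\<^bsub>D\<^esub> d) \<otimes>\<^bsub>B\<^esub> inv\<^bsub>B\<^esub> y = inv\<^bsub>B\<^esub> (inv\<^bsub>B\<^esub> \<beta> d \<otimes>\<^bsub>B\<^esub> y)"
        using g T_comm[of "inv\<^bsub>B\<^esub> y" "\<beta> d"] by (simp add: B.inv_mult_group)
      then show ?thesis using g by simp
    qed
    moreover have "inv\<^bsub>E\<^esub> \<sigma> (inv\<^bsub>A\<^esub> x) \<otimes>\<^bsub>E\<^esub> inv\<^bsub>E\<^esub> \<tau> (inv\<^bsub>B\<^esub> y) \<otimes>\<^bsub>E\<^esub> (inv\<^bsub>E\<^esub> \<sigma> x \<otimes>\<^bsub>E\<^esub> inv\<^bsub>E\<^esub> \<tau> y) = \<one>\<^bsub>E\<^esub>"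
      using g by (simp add: \<sigma>_inv \<tau>_inv flip: E.inv_mult)
    ultimately have "h \<otimes>\<^bsub>twisted\<^esub> g = \<one>\<^bsub>twisted\<^esub>"
      unfolding g(4) h_def by simp
    then have "inv\<^bsub>twisted\<^esub> g = h" using g by (intro F.inv_equality) (auto simp: h_def)
    with h show "inv\<^bsub>twisted\<^esub> g \<in> N" by simp
  next
    fix g g' assume "g \<in> N" "g' \<in> N"
    then obtain d x y d' x' y' where g: "d \<in> carrier D" "x \<in> S" "y \<in> T"
      "g = (\<alpha> d \<otimes>\<^bsub>A\<^esub> x, inv\<^bsub>B\<^esub> \<beta> d \<otimes>\<^bsub>B\<^esub> y, inv\<^bsub>E\<^esub> \<sigma> x \<otimes>\<^bsub>E\<^esub> inv\<^bsub>E\<^esub> \<tau> y)"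
      and g': "d' \<in> carrier D" "x' \<in> S" "y' \<in> T"
      "g' = (\<alpha> d' \<otimes>\<^bsub>A\<^esub> x', inv\<^bsub>B\<^esub> \<beta> d' \<otimes>\<^bsub>B\<^esub> y', inv\<^bsub>E\<^esub> \<sigma> x' \<otimes>\<^bsub>E\<^esub> inv\<^bsub>E\<^esub> \<tau> y')"
      unfolding N_def by blast
    \<comment> \<open>The second coordinate inverts D, hence reverses products. Restoring the order
      costs the inverse of the commutator \<open>z\<close>, whose image under \<open>\<tau>\<close>
      is exactly accounted for by the cocycle term.\<close>
    define z where "z = commutator B (\<beta> d') (\<beta> d)"
    have z: "z \<in> T" unfolding z_def using g g' T(3) by simp
    have 1: "\<alpha> d \<otimes>\<^bsub>A\<^esub> x \<otimes>\<^bsub>A\<^esub> (\<alpha> d' \<otimes>\<^bsub>A\<^esub> x') = \<alpha> (d \<otimes>\<^bsub>D\<^esub> d') \<otimes>\<^bsub>A\<^esub> (x \<otimes>\<^bsub>A\<^esub> x')"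
    proof -
      have "\<alpha> d \<otimes>\<^bsub>A\<^esub> x \<otimes>\<^bsub>A\<^esub> (\<alpha> d' \<otimes>\<^bsub>A\<^esub> x') = \<alpha> d \<otimes>\<^bsub>A\<^esub> (x \<otimes>\<^bsub>A\<^esub> \<alpha> d') \<otimes>\<^bsub>A\<^esub> x'"
        using g g' by (simp add: A.m_assoc)
      also have "x \<otimes>\<^bsub>A\<^esub> \<alpha> d' = \<alpha> d' \<otimes>\<^bsub>A\<^esub> x" using g g' by (intro S_comm) auto
      finally show ?thesis using g g' by (simp add: A.m_assoc)
    qed
    have 2: "inv\<^bsub>B\<^esub> \<beta> d \<otimes>\<^bsub>B\<^esub> y \<otimes>\<^bsub>B\<^esub> (inv\<^bsub>B\<^esub> \<beta> d' \<otimes>\<^bsub>B\<^esub> y') =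
      inv\<^bsub>B\<^esub> \<beta> (d \<otimes>\<^bsub>D\<^esub> d') \<otimes>\<^bsub>B\<^esub> (inv\<^bsub>B\<^esub> z \<otimes>\<^bsub>B\<^esub> (y \<otimes>\<^bsub>B\<^esub> y'))"
    proof -
      have "\<beta> d \<otimes>\<^bsub>B\<^esub> \<beta> d' \<otimes>\<^bsub>B\<^esub> z = \<beta> d' \<otimes>\<^bsub>B\<^esub> \<beta> d"
        unfolding z_def using g g' by (intro B.mult_commutator) auto
      then have "inv\<^bsub>B\<^esub> (\<beta> d' \<otimes>\<^bsub>B\<^esub> \<beta> d) = inv\<^bsub>B\<^esub> (z \<otimes>\<^bsub>B\<^esub> (\<beta> d \<otimes>\<^bsub>B\<^esub> \<beta> d'))"
        using g g' z T_comm[of z "\<beta> d \<otimes>\<^bsub>B\<^esub> \<beta> d'"] by simp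
      then have zz: "inv\<^bsub>B\<^esub> \<beta> d \<otimes>\<^bsub>B\<^esub> inv\<^bsub>B\<^esub> \<beta> d' = inv\<^bsub>B\<^esub> \<beta> (d \<otimes>\<^bsub>D\<^esub> d') \<otimes>\<^bsub>B\<^esub> inv\<^bsub>B\<^esub> z"
        using g g' z by (simp add: B.inv_mult_group)
      have "inv\<^bsub>B\<^esub> \<beta> d \<otimes>\<^bsub>B\<^esub> y \<otimes>\<^bsub>B\<^esub> (inv\<^bsub>B\<^esub> \<beta> d' \<otimes>\<^bsub>B\<^esub> y') = inv\<^bsub>B\<^esub> \<beta> d \<otimes>\<^bsub>B\<^esub> (y \<otimes>\<^bsub>B\<^esub> inv\<^bsub>B\<^esub> \<beta> d') \<otimes>\<^bsub>B\<^esub> y'"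
        using g g' by (simp add: B.m_assoc)
      also have "y \<otimes>\<^bsub>B\<^esub> inv\<^bsub>B\<^esub> \<beta> d' = inv\<^bsub>B\<^esub> \<beta> d' \<otimes>\<^bsub>B\<^esub> y" using g g' by (intro T_comm) auto
      also have "inv\<^bsub>B\<^esub> \<beta> d \<otimes>\<^bsub>B\<^esub> (inv\<^bsub>B\<^esub> \<beta> d' \<otimes>\<^bsub>B\<^esub> y) \<otimes>\<^bsub>B\<^esub> y' = inv\<^bsub>B\<^esub> \<beta> d \<otimes>\<^bsub>B\<^esub> inv\<^bsub>B\<^esub> \<beta> d' \<otimes>\<^bsub>B\<^esub> (y \<otimes>\<^bsub>B\<^esub> y')"
        using g g' by (simp add: B.m_assoc)
      finally show ?thesis unfolding zz using g g' z by (simp add: B.m_assoc)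
    qed
    have 3: "inv\<^bsub>E\<^esub> \<sigma> x \<otimes>\<^bsub>E\<^esub> inv\<^bsub>E\<^esub> \<tau> y \<otimes>\<^bsub>E\<^esub> (inv\<^bsub>E\<^esub> \<sigma> x' \<otimes>\<^bsub>E\<^esub> inv\<^bsub>E\<^esub> \<tau> y') \<otimes>\<^bsub>E\<^esub>
        inv\<^bsub>E\<^esub> c (\<alpha> d' \<otimes>\<^bsub>A\<^esub> x') (inv\<^bsub>B\<^esub> \<beta> d \<otimes>\<^bsub>B\<^esub> y) =
      inv\<^bsub>E\<^esub> \<sigma> (x \<otimes>\<^bsub>A\<^esub> x') \<otimes>\<^bsub>E\<^esub> inv\<^bsub>E\<^esub> \<tau> (inv\<^bsub>B\<^esub> z \<otimes>\<^bsub>B\<^esub> (y \<otimes>\<^bsub>B\<^esub> y'))"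
      using g g' z by (simp add: c_\<alpha>\<beta> \<sigma>_mult \<tau>_mult \<tau>_inv E.inv_mult E.m_ac flip: z_def)
    show "g \<otimes>\<^bsub>twisted\<^esub> g' \<in> N"
      unfolding g(4) g'(4) mult_twisted 1 2 3
      using g g' z by (intro NI[of "d \<otimes>\<^bsub>D\<^esub> d'" "x \<otimes>\<^bsub>A\<^esub> x'" "inv\<^bsub>B\<^esub> z \<otimes>\<^bsub>B\<^esub> (y \<otimes>\<^bsub>B\<^esub> y')"]) auto
  qed
  have "N \<lhd> twisted"
    unfolding F.normal_inv_iff
  proof (intro conjI ballI N_sub)
    fix f g assume f: "f \<in> carrier twisted" and "g \<in> N"
    then obtain d x y where g: "d \<in> carrier D" "x \<in> S" "y \<in> T"
      "g = (\<alpha> d \<otimes>\<^bsub>A\<^esub> x, inv\<^bsub>B\<^esub> \<beta> d \<otimes>\<^bsub>B\<^esub> y, inv\<^bsub>E\<^esub> \<sigma> x \<otimes>\<^bsub>E\<^esub> inv\<^bsub>E\<^esub> \<tau> y)"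
      unfolding N_def by blast
    obtain a b e where f': "f = (a, b, e)" and abe: "a \<in> carrier A" "b \<in> carrier B" "e \<in> carrier E"
      using f by auto
    \<comment> \<open>Conjugation by (a, b, e) multiplies x by [a, d] and y by [d, b]. The
      prescribed values of \<open>c\<close> change the E-coordinate to match, so the conjugate has
      again the form required by \<open>N\<close>. The computation is done as f g = h f.\<close>
    define x1 where "x1 = commutator A a (\<alpha> d)"
    define y1 where "y1 = commutator B (\<beta> d) b"
    have x1: "x1 \<in> S" and y1: "y1 \<in> T" unfolding x1_def y1_def using S(3) T(3) g abe by auto
    define h where "h = (\<alpha> d \<otimes>\<^bsub>A\<^esub> (x \<otimes>\<^bsub>A\<^esub> x1), inv\<^bsub>B\<^esub> \<beta> d \<otimes>\<^bsub>B\<^esub> (y \<otimes>\<^bsub>B\<^esub> y1),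
      inv\<^bsub>E\<^esub> \<sigma> (x \<otimes>\<^bsub>A\<^esub> x1) \<otimes>\<^bsub>E\<^esub> inv\<^bsub>E\<^esub> \<tau> (y \<otimes>\<^bsub>B\<^esub> y1))"
    have h: "h \<in> N" unfolding h_def
      using g x1 y1 by (intro NI[of d "x \<otimes>\<^bsub>A\<^esub> x1" "y \<otimes>\<^bsub>B\<^esub> y1"]) auto
    have 1: "a \<otimes>\<^bsub>A\<^esub> (\<alpha> d \<otimes>\<^bsub>A\<^esub> x) = \<alpha> d \<otimes>\<^bsub>A\<^esub> (x \<otimes>\<^bsub>A\<^esub> x1) \<otimes>\<^bsub>A\<^esub> a"
    proof -
      have "a \<otimes>\<^bsub>A\<^esub> (\<alpha> d \<otimes>\<^bsub>A\<^esub> x) = \<alpha> d \<otimes>\<^bsub>A\<^esub> a \<otimes>\<^bsub>A\<^esub> x1 \<otimes>\<^bsub>A\<^esub> x"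
        unfolding x1_def using abe g by (simp add: A.mult_commutator flip: A.m_assoc)
      also have "\<dots> = \<alpha> d \<otimes>\<^bsub>A\<^esub> (a \<otimes>\<^bsub>A\<^esub> (x1 \<otimes>\<^bsub>A\<^esub> x))" using abe g x1 by (simp add: A.m_assoc)
      also have "a \<otimes>\<^bsub>A\<^esub> (x1 \<otimes>\<^bsub>A\<^esub> x) = x1 \<otimes>\<^bsub>A\<^esub> x \<otimes>\<^bsub>A\<^esub> a"
        using abe g x1 by (intro S_comm[symmetric]) auto
      also have "x1 \<otimes>\<^bsub>A\<^esub> x = x \<otimes>\<^bsub>A\<^esub> x1" using g x1 by (intro S_comm) auto
      finally show ?thesis using abe g x1 by (simp add: A.m_assoc)
    qed
    have 2: "b \<otimes>\<^bsub>B\<^esub> (inv\<^bsub>B\<^esub> \<beta> d \<otimes>\<^bsub>B\<^esub> y) = inv\<^bsub>B\<^esub> \<beta> d \<otimes>\<^bsub>B\<^esub> (y \<otimes>\<^bsub>B\<^esub> y1) \<otimes>\<^bsub>B\<^esub> b"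
    proof -
      have "y1 = commutator B b (inv\<^bsub>B\<^esub> \<beta> d)"
        unfolding y1_def using abe g B.commutator_swap[of "inv\<^bsub>B\<^esub> \<beta> d" b] by (simp add: B.commutator_inv_left)
      then have "b \<otimes>\<^bsub>B\<^esub> (inv\<^bsub>B\<^esub> \<beta> d \<otimes>\<^bsub>B\<^esub> y) = inv\<^bsub>B\<^esub> \<beta> d \<otimes>\<^bsub>B\<^esub> b \<otimes>\<^bsub>B\<^esub> y1 \<otimes>\<^bsub>B\<^esub> y"
        using abe g by (simp add: B.mult_commutator flip: B.m_assoc)
      also have "\<dots> = inv\<^bsub>B\<^esub> \<beta> d \<otimes>\<^bsub>B\<^esub> (b \<otimes>\<^bsub>B\<^esub> (y1 \<otimes>\<^bsub>B\<^esub> y))" using abe g y1 by (simp add: B.m_assoc)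
      also have "b \<otimes>\<^bsub>B\<^esub> (y1 \<otimes>\<^bsub>B\<^esub> y) = y1 \<otimes>\<^bsub>B\<^esub> y \<otimes>\<^bsub>B\<^esub> b"
        using abe g y1 by (intro T_comm[symmetric]) auto
      also have "y1 \<otimes>\<^bsub>B\<^esub> y = y \<otimes>\<^bsub>B\<^esub> y1" using g y1 by (intro T_comm) auto
      finally show ?thesis using abe g y1 by (simp add: B.m_assoc)
    qed
    have 3: "e \<otimes>\<^bsub>E\<^esub> (inv\<^bsub>E\<^esub> \<sigma> x \<otimes>\<^bsub>E\<^esub> inv\<^bsub>E\<^esub> \<tau> y) \<otimes>\<^bsub>E\<^esub> inv\<^bsub>E\<^esub> c (\<alpha> d \<otimes>\<^bsub>A\<^esub> x) b =
      inv\<^bsub>E\<^esub> \<sigma> (x \<otimes>\<^bsub>A\<^esub> x1) \<otimes>\<^bsub>E\<^esub> inv\<^bsub>E\<^esub> \<tau> (y \<otimes>\<^bsub>B\<^esub> y1) \<otimes>\<^bsub>E\<^esub> e \<otimes>\<^bsub>E\<^esub> inv\<^bsub>E\<^esub> c a (inv\<^bsub>B\<^esub> \<beta> d \<otimes>\<^bsub>B\<^esub> (y \<otimes>\<^bsub>B\<^esub> y1))"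
    proof -
      have "c (\<alpha> d \<otimes>\<^bsub>A\<^esub> x) b = \<tau> y1" unfolding y1_def using abe g T(3) by (simp add: c_mult_left SV c\<tau>)
      moreover have "c a (inv\<^bsub>B\<^esub> \<beta> d \<otimes>\<^bsub>B\<^esub> (y \<otimes>\<^bsub>B\<^esub> y1)) = inv\<^bsub>E\<^esub> \<sigma> x1"
        using abe g y1 S(3) by (simp add: c_mult_right c_inv_right TV c\<sigma> x1_def)
      moreover have "inv\<^bsub>E\<^esub> (\<sigma> x \<otimes>\<^bsub>E\<^esub> \<sigma> x1) \<otimes>\<^bsub>E\<^esub> inv\<^bsub>E\<^esub> (\<tau> y \<otimes>\<^bsub>E\<^esub> \<tau> y1) \<otimes>\<^bsub>E\<^esub> e \<otimes>\<^bsub>E\<^esub> \<sigma> x1 =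
        e \<otimes>\<^bsub>E\<^esub> (inv\<^bsub>E\<^esub> \<sigma> x \<otimes>\<^bsub>E\<^esub> inv\<^bsub>E\<^esub> \<tau> y) \<otimes>\<^bsub>E\<^esub> inv\<^bsub>E\<^esub> \<tau> y1 \<otimes>\<^bsub>E\<^esub> (inv\<^bsub>E\<^esub> \<sigma> x1 \<otimes>\<^bsub>E\<^esub> \<sigma> x1)"
      proof -
        have "(p \<otimes>\<^bsub>E\<^esub> s') \<otimes>\<^bsub>E\<^esub> (q \<otimes>\<^bsub>E\<^esub> r) \<otimes>\<^bsub>E\<^esub> e \<otimes>\<^bsub>E\<^esub> s = e \<otimes>\<^bsub>E\<^esub> (p \<otimes>\<^bsub>E\<^esub> q) \<otimes>\<^bsub>E\<^esub> r \<otimes>\<^bsub>E\<^esub> (s' \<otimes>\<^bsub>E\<^esub> s)"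
          if "p \<in> carrier E" "q \<in> carrier E" "r \<in> carrier E" "s \<in> carrier E" "s' \<in> carrier E" for p q r s s'
          using that abe by (simp add: E.m_ac)
        from this[of "inv\<^bsub>E\<^esub> \<sigma> x" "inv\<^bsub>E\<^esub> \<tau> y" "inv\<^bsub>E\<^esub> \<tau> y1" "\<sigma> x1" "inv\<^bsub>E\<^esub> \<sigma> x1"]
        show ?thesis using abe g x1 y1 by (simp add: E.inv_mult)
      qed
      ultimately show ?thesis using abe g x1 y1 by (simp add: \<sigma>_mult \<tau>_mult)
    qed
    have "f \<otimes>\<^bsub>twisted\<^esub> g = h \<otimes>\<^bsub>twisted\<^esub> f"
      unfolding f' g(4) h_def mult_twisted 1 2 3 by simp
    moreover have "h \<in> carrier twisted" "g \<in> carrier twisted"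
      using h \<open>g \<in> N\<close> subgroup.subset[OF N_sub] by blast+
    ultimately have "f \<otimes>\<^bsub>twisted\<^esub> g \<otimes>\<^bsub>twisted\<^esub> inv\<^bsub>twisted\<^esub> f = h"
      using f by (metis F.inv_solve_right F.m_closed)
    with h show "f \<otimes>\<^bsub>twisted\<^esub> g \<otimes>\<^bsub>twisted\<^esub> inv\<^bsub>twisted\<^esub> f \<in> N" by simp
  qed
  then interpret N: normal N twisted .
  define M where "M = twisted Mod N"
  define \<pi> where "\<pi> x = N #>\<^bsub>twisted\<^esub> x" for x
  interpret M: group M unfolding M_def by (rule N.factorgroup_is_group)
  interpret \<pi>: group_hom twisted M \<pi>
    by unfold_locales (unfold M_def \<pi>_def, rule N.r_coset_hom_Mod)
  define \<phi> where "\<phi> a = \<pi> (a, \<one>\<^bsub>B\<^esub>, \<one>\<^bsub>E\<^esub>)" for a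
  define \<psi> where "\<psi> b = \<pi> (\<one>\<^bsub>A\<^esub>, b, \<one>\<^bsub>E\<^esub>)" for b
  have \<phi>_hom: "\<phi> \<in> hom A M"
  proof (rule homI)
    show "\<phi> (a \<otimes>\<^bsub>A\<^esub> a') = \<phi> a \<otimes>\<^bsub>M\<^esub> \<phi> a'" if "a \<in> carrier A" "a' \<in> carrier A" for a a'
      using that \<pi>.hom_mult[of "(a, \<one>\<^bsub>B\<^esub>, \<one>\<^bsub>E\<^esub>)" "(a', \<one>\<^bsub>B\<^esub>, \<one>\<^bsub>E\<^esub>)"] by (simp add: \<phi>_def)
  qed (simp add: \<phi>_def)
  have \<psi>_hom: "\<psi> \<in> hom B M"
  proof (rule homI)
    show "\<psi> (b \<otimes>\<^bsub>B\<^esub> b') = \<psi> b \<otimes>\<^bsub>M\<^esub> \<psi> b'" if "b \<in> carrier B" "b' \<in> carrier B" for b b'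
      using that \<pi>.hom_mult[of "(\<one>\<^bsub>A\<^esub>, b, \<one>\<^bsub>E\<^esub>)" "(\<one>\<^bsub>A\<^esub>, b', \<one>\<^bsub>E\<^esub>)"] by (simp add: \<psi>_def)
  qed (simp add: \<psi>_def)
  interpret \<phi>: group_hom A M \<phi> by unfold_locales (rule \<phi>_hom)
  interpret \<psi>: group_hom B M \<psi> by unfold_locales (rule \<psi>_hom)
  have \<pi>_one: "x \<in> N" if "\<pi> x = \<one>\<^bsub>M\<^esub>" "x \<in> carrier twisted" for x
    using that F.coset_join1[OF _ _ N_sub] N.subset by (simp add: \<pi>_def M_def)
  have "a = \<one>\<^bsub>A\<^esub>" if a: "a \<in> carrier A" "\<phi> a = \<one>\<^bsub>M\<^esub>" for a
  proof -
    have "(a, \<one>\<^bsub>B\<^esub>, \<one>\<^bsub>E\<^esub>) \<in> N" using a by (intro \<pi>_one) (auto simp: \<phi>_def)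
    then obtain d x y where dxy: "d \<in> carrier D" "x \<in> S" "y \<in> T" "a = \<alpha> d \<otimes>\<^bsub>A\<^esub> x"
      "\<one>\<^bsub>B\<^esub> = inv\<^bsub>B\<^esub> \<beta> d \<otimes>\<^bsub>B\<^esub> y" "\<one>\<^bsub>E\<^esub> = inv\<^bsub>E\<^esub> \<sigma> x \<otimes>\<^bsub>E\<^esub> inv\<^bsub>E\<^esub> \<tau> y"
      unfolding N_def by blast
    have y: "y = \<beta> d" using dxy by (metis B.inv_solve_left B.one_closed B.r_one T.mem_carrier \<beta>.hom_closed)
    have "\<sigma> x = inv\<^bsub>E\<^esub> \<tau> y" using dxy
      by (metis E.inv_closed E.inv_inv E.inv_equality E.m_comm \<open>\<And>x. x \<in> S \<Longrightarrow> \<sigma> x \<in> carrier E\<close> \<open>\<And>x. x \<in> T \<Longrightarrow> \<tau> x \<in> carrier E\<close>)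
    then have "\<sigma> x = \<tau> (inv\<^bsub>B\<^esub> y)" using dxy by (simp add: \<tau>_inv)
    \<comment> \<open>Here y is the image of d, so its inverse is the image of the inverse of d;
      \<open>sep\<close> then identifies x as the inverse of \<open>\<alpha> d\<close>, and a
      collapses to one.\<close>
    from sep[OF _ _ this, of "inv\<^bsub>D\<^esub> d"] have "x = inv\<^bsub>A\<^esub> \<alpha> d" using dxy y by simp
    then show ?thesis using dxy by simp
  qed
  then have inj\<phi>: "inj_on \<phi> (carrier A)" by (intro \<phi>.inj_on_one_iff[THEN iffD2]) auto
  have "b = \<one>\<^bsub>B\<^esub>" if b: "b \<in> carrier B" "\<psi> b = \<one>\<^bsub>M\<^esub>" for b
  proof -
    have "(\<one>\<^bsub>A\<^esub>, b, \<one>\<^bsub>E\<^esub>) \<in> N" using b by (intro \<pi>_one) (auto simp: \<psi>_def)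
    then obtain d x y where dxy: "d \<in> carrier D" "x \<in> S" "y \<in> T" "\<one>\<^bsub>A\<^esub> = \<alpha> d \<otimes>\<^bsub>A\<^esub> x"
      "b = inv\<^bsub>B\<^esub> \<beta> d \<otimes>\<^bsub>B\<^esub> y" "\<one>\<^bsub>E\<^esub> = inv\<^bsub>E\<^esub> \<sigma> x \<otimes>\<^bsub>E\<^esub> inv\<^bsub>E\<^esub> \<tau> y"
      unfolding N_def by blast
    have x: "x = inv\<^bsub>A\<^esub> \<alpha> d"
      using dxy by (metis A.inv_equality A.inv_inv S.mem_carrier \<alpha>.hom_closed)
    have "\<sigma> x = inv\<^bsub>E\<^esub> \<tau> y" using dxy
      by (metis E.inv_closed E.inv_inv E.inv_equality E.m_comm \<open>\<And>x. x \<in> S \<Longrightarrow> \<sigma> x \<in> carrier E\<close> \<open>\<And>x. x \<in> T \<Longrightarrow> \<tau> x \<in> carrier E\<close>)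
    then have "\<sigma> x = \<tau> (inv\<^bsub>B\<^esub> y)" using dxy by (simp add: \<tau>_inv)
    from sep[OF _ _ this, of "inv\<^bsub>D\<^esub> d"] have "inv\<^bsub>B\<^esub> y = inv\<^bsub>B\<^esub> \<beta> d" using dxy x by simp
    then show ?thesis using dxy by (metis B.inv_inv B.l_inv T.mem_carrier \<beta>.hom_closed)
  qed
  then have inj\<psi>: "inj_on \<psi> (carrier B)" by (intro \<psi>.inj_on_one_iff[THEN iffD2]) auto
  have agree: "\<phi> (\<alpha> d) = \<psi> (\<beta> d)" if d: "d \<in> carrier D" for d
  proof -
    have "(\<alpha> d, inv\<^bsub>B\<^esub> \<beta> d, \<one>\<^bsub>E\<^esub>) \<in> N"
      using d by (intro NI[of d "\<one>\<^bsub>A\<^esub>" "\<one>\<^bsub>B\<^esub>"]) (simp_all add: \<sigma>_one \<tau>_one)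
    from F.rcoset_mult_left[OF N_sub this, of "(\<one>\<^bsub>A\<^esub>, \<beta> d, \<one>\<^bsub>E\<^esub>)"]
    show ?thesis using d by (simp add: \<phi>_def \<psi>_def \<pi>_def)
  qed
  have "in_variety m n M"
    using in_variety_surj_hom[OF in_variety_twisted M.group_axioms \<pi>.homh]
    by (auto simp: M_def carrier_FactGroup \<pi>_def)
  then have "weak_embedding m n A B D \<alpha> \<beta> M \<phi> \<psi>"
    unfolding weak_embedding_def using \<phi>_hom \<psi>_hom inj\<phi> inj\<psi> agree by blast
  then show thesis by (rule that)
qed

end

section \<open>Amalgams\<close>

text \<open>One half of condition (1); the other half is the instance with A and B exchanged. It is
  what lets commutators with D, computed in A, depend only on classes modulo V(B).\<close>

locale half_amalgam =
  A: variety_group A m n + B: variety_group B m n + \<alpha>: group_hom D A \<alpha> + \<beta>: group_hom D B \<beta>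
  for A :: "('a, 'r) monoid_scheme" and B :: "('b, 's) monoid_scheme"
    and D :: "('d, 't) monoid_scheme" and \<alpha> \<beta> m n +
  assumes central: "d \<in> carrier D \<Longrightarrow> \<beta> d \<in> verbal n B \<Longrightarrow> \<alpha> d \<in> center A"
begin

definition D_image :: "'b set set" where
  "D_image = (\<lambda>d. verbal n B #>\<^bsub>B\<^esub> \<beta> d) ` carrier D"

text \<open>The second argument is a class of B, but the commutator is formed in A: an element of D
  representing that class is carried over by \<open>\<alpha>\<close>. Independence of the chosen
  representatives is \<open>commutator_cong\<close>.\<close>

definition comm_map :: "'a set \<Rightarrow> 'b set \<Rightarrow> 'a" where
  "comm_map \<xi> \<eta> = commutator A (SOME a. a \<in> carrier A \<and> verbal n A #>\<^bsub>A\<^esub> a = \<xi>)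
     (\<alpha> (SOME d. d \<in> carrier D \<and> verbal n B #>\<^bsub>B\<^esub> \<beta> d = \<eta>))"

section \<open>Commutators with D on the verbal quotients\<close>

lemma subgroup_D_image: "subgroup D_image (B Mod verbal n B)"
proof -
  interpret N: normal "verbal n B" B by (rule B.normal_verbal)
  interpret Q: group "B Mod verbal n B" by (rule N.factorgroup_is_group)
  have "(\<lambda>d. verbal n B #>\<^bsub>B\<^esub> \<beta> d) \<in> hom D (B Mod verbal n B)"
    using hom_compose[OF \<beta>.homh N.r_coset_hom_Mod] by (simp add: comp_def)
  then interpret h: group_hom D "B Mod verbal n B" "\<lambda>d. verbal n B #>\<^bsub>B\<^esub> \<beta> d" by unfold_locales
  show ?thesis unfolding D_image_def by (rule h.img_is_subgroup)
qed

text \<open>Changing a modulo V(A) multiplies it by a central element. Changing d modulo V(B)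
  multiplies \<open>\<alpha> d\<close> by the image of an element of D that lies in V(B), which is
  central in A by \<open>central\<close>.\<close>

lemma commutator_cong:
  assumes a: "a \<in> carrier A" "a' \<in> carrier A" "verbal n A #>\<^bsub>A\<^esub> a = verbal n A #>\<^bsub>A\<^esub> a'"
    and d: "d \<in> carrier D" "d' \<in> carrier D" "verbal n B #>\<^bsub>B\<^esub> \<beta> d = verbal n B #>\<^bsub>B\<^esub> \<beta> d'"
  shows "commutator A a (\<alpha> d) = commutator A a' (\<alpha> d')"
proof -
  obtain z where z: "z \<in> verbal n A" "a = z \<otimes>\<^bsub>A\<^esub> a'"
    using A.rcoset_eqD[OF A.subgroup_verbal a] by blast
  obtain y where y: "y \<in> verbal n B" "\<beta> d = y \<otimes>\<^bsub>B\<^esub> \<beta> d'"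
    using B.rcoset_eqD[OF B.subgroup_verbal _ _ d(3)] d by auto
  have "\<beta> (d \<otimes>\<^bsub>D\<^esub> inv\<^bsub>D\<^esub> d') = y"
    using d y B.verbal_carrier[OF y(1)] by (simp add: B.m_assoc)
  then have e: "\<alpha> (d \<otimes>\<^bsub>D\<^esub> inv\<^bsub>D\<^esub> d') \<in> center A" using y d by (intro central) auto
  have "d = d \<otimes>\<^bsub>D\<^esub> inv\<^bsub>D\<^esub> d' \<otimes>\<^bsub>D\<^esub> d'" using d by (simp add: \<alpha>.G.m_assoc)
  then have "\<alpha> d = \<alpha> (d \<otimes>\<^bsub>D\<^esub> inv\<^bsub>D\<^esub> d') \<otimes>\<^bsub>A\<^esub> \<alpha> d'"
    using d \<alpha>.hom_mult[of "d \<otimes>\<^bsub>D\<^esub> inv\<^bsub>D\<^esub> d'" d'] by simp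
  then have "commutator A a (\<alpha> d) =
    commutator A a (\<alpha> (d \<otimes>\<^bsub>D\<^esub> inv\<^bsub>D\<^esub> d')) \<otimes>\<^bsub>A\<^esub> commutator A a (\<alpha> d')"
    using a d A.commutator_mult_right[of a "\<alpha> (d \<otimes>\<^bsub>D\<^esub> inv\<^bsub>D\<^esub> d')" "\<alpha> d'"] by simp
  also have "\<dots> = commutator A a (\<alpha> d')"
    using a d A.commutator_center_right[OF e a(1)] by (simp del: \<alpha>.hom_mult)
  also have "\<dots> = commutator A z (\<alpha> d') \<otimes>\<^bsub>A\<^esub> commutator A a' (\<alpha> d')"
    unfolding z(2) using a d A.verbal_carrier[OF z(1)] by (intro A.commutator_mult_left) auto
  also have "\<dots> = commutator A a' (\<alpha> d')"
    using a d z A.verbal_subset_center A.commutator_center_left[of z "\<alpha> d'"] by auto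
  finally show ?thesis .
qed

lemma comm_map_eq:
  assumes "a \<in> carrier A" "d \<in> carrier D"
  shows "comm_map (verbal n A #>\<^bsub>A\<^esub> a) (verbal n B #>\<^bsub>B\<^esub> \<beta> d) = commutator A a (\<alpha> d)"
proof -
  have "\<exists>x. x \<in> carrier A \<and> verbal n A #>\<^bsub>A\<^esub> x = verbal n A #>\<^bsub>A\<^esub> a"
    and "\<exists>e. e \<in> carrier D \<and> verbal n B #>\<^bsub>B\<^esub> \<beta> e = verbal n B #>\<^bsub>B\<^esub> \<beta> d" using assms by blast+
  from someI_ex[OF this(1)] someI_ex[OF this(2)] show ?thesis
    unfolding comm_map_def using assms by (intro commutator_cong) auto
qed

lemma
  assumes "\<xi> \<in> carrier (A Mod verbal n A)" "\<eta> \<in> D_image"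
  shows comm_map_closed: "comm_map \<xi> \<eta> \<in> A.torsion_verbal"
    and comm_map_mult_left: "\<xi>' \<in> carrier (A Mod verbal n A) \<Longrightarrow>
      comm_map (\<xi> \<otimes>\<^bsub>A Mod verbal n A\<^esub> \<xi>') \<eta> = comm_map \<xi> \<eta> \<otimes>\<^bsub>A\<^esub> comm_map \<xi>' \<eta>"
    and comm_map_mult_right: "\<eta>' \<in> D_image \<Longrightarrow>
      comm_map \<xi> (\<eta> \<otimes>\<^bsub>B Mod verbal n B\<^esub> \<eta>') = comm_map \<xi> \<eta> \<otimes>\<^bsub>A\<^esub> comm_map \<xi> \<eta>'"
proof -
  interpret NA: normal "verbal n A" A by (rule A.normal_verbal)
  interpret NB: normal "verbal n B" B by (rule B.normal_verbal)
  obtain a d where ad: "a \<in> carrier A" "d \<in> carrier D" "\<xi> = verbal n A #>\<^bsub>A\<^esub> a" "\<eta> = verbal n B #>\<^bsub>B\<^esub> \<beta> d"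
    using assms by (auto simp: carrier_FactGroup D_image_def)
  show "comm_map \<xi> \<eta> \<in> A.torsion_verbal"
    unfolding ad using ad(1,2) by (simp add: comm_map_eq A.commutator_in_verbal)
  show "comm_map (\<xi> \<otimes>\<^bsub>A Mod verbal n A\<^esub> \<xi>') \<eta> = comm_map \<xi> \<eta> \<otimes>\<^bsub>A\<^esub> comm_map \<xi>' \<eta>"
    if \<xi>': "\<xi>' \<in> carrier (A Mod verbal n A)"
  proof -
    obtain a' where a': "a' \<in> carrier A" "\<xi>' = verbal n A #>\<^bsub>A\<^esub> a'"
      using \<xi>' by (auto simp: carrier_FactGroup)
    then show ?thesis
      using ad(1,2) by (simp add: ad NA.rcos_sum comm_map_eq A.commutator_mult_left)
  qed
  show "comm_map \<xi> (\<eta> \<otimes>\<^bsub>B Mod verbal n B\<^esub> \<eta>') = comm_map \<xi> \<eta> \<otimes>\<^bsub>A\<^esub> comm_map \<xi> \<eta>'"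
    if \<eta>': "\<eta>' \<in> D_image"
  proof -
    obtain d' where d': "d' \<in> carrier D" "\<eta>' = verbal n B #>\<^bsub>B\<^esub> \<beta> d'"
      using \<eta>' by (auto simp: D_image_def)
    have "\<eta> \<otimes>\<^bsub>B Mod verbal n B\<^esub> \<eta>' = verbal n B #>\<^bsub>B\<^esub> \<beta> (d \<otimes>\<^bsub>D\<^esub> d')"
      using ad(1,2) d'(1) by (simp add: ad d' NB.rcos_sum)
    then show ?thesis
      using ad(1,2) d' comm_map_eq[of a "d \<otimes>\<^bsub>D\<^esub> d'"]
      by (simp add: ad(3,4) comm_map_eq A.commutator_mult_right)
  qed
qed

end

text \<open>The tuples \<open>(a, v, u, b)\<close> with \<open>u = a\<^sup>q a'\<close> and \<open>v = b\<^sup>q b'\<close> in \<open>D\<close>, as in condition (2).\<close>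

definition matched :: "nat \<Rightarrow> ('a, 'r) monoid_scheme \<Rightarrow> ('b, 's) monoid_scheme \<Rightarrow> ('d, 't) monoid_scheme
     \<Rightarrow> ('d \<Rightarrow> 'a) \<Rightarrow> ('d \<Rightarrow> 'b) \<Rightarrow> ('a \<times> 'd \<times> 'd \<times> 'b) set" where
  "matched n A B D \<alpha> \<beta> = {(a, v, u, b). a \<in> carrier A \<and> v \<in> carrier D \<and> u \<in> carrier D \<and> b \<in> carrier B \<and>
     (\<exists>q>0. q dvd n \<and> (\<exists>a'\<in>verbal n A. a [^]\<^bsub>A\<^esub> q \<otimes>\<^bsub>A\<^esub> a' = \<alpha> u) \<and>
       (\<exists>b'\<in>verbal n B. b [^]\<^bsub>B\<^esub> q \<otimes>\<^bsub>B\<^esub> b' = \<beta> v))}"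

section \<open>Ordered products as products of lists\<close>

definition list_prod :: "('a, 'r) monoid_scheme \<Rightarrow> 'a list \<Rightarrow> 'a" where
  "list_prod G xs = foldr (\<otimes>\<^bsub>G\<^esub>) xs \<one>\<^bsub>G\<^esub>"

lemma list_prod_simps [simp]:
  "list_prod G [] = \<one>\<^bsub>G\<^esub>" "list_prod G (x # xs) = x \<otimes>\<^bsub>G\<^esub> list_prod G xs"
  by (simp_all add: list_prod_def)

lemma (in monoid) list_prod_closed: "set xs \<subseteq> carrier G \<Longrightarrow> list_prod G xs \<in> carrier G"
  by (induction xs) auto

lemma (in monoid) list_prod_append:
  "set xs \<subseteq> carrier G \<Longrightarrow> set ys \<subseteq> carrier G \<Longrightarrow>
    list_prod G (xs @ ys) = list_prod G xs \<otimes> list_prod G ys"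
  by (induction xs) (auto simp: list_prod_closed m_assoc)

text \<open>The shift by one reconciles products indexed from 1 with list positions counted from
  0.\<close>

lemma ordered_prod_nth: "ordered_prod G (\<lambda>i. h (xs ! (i - 1))) (length xs) = list_prod G (map h xs)"
proof -
  have "map (\<lambda>i. h (xs ! (i - 1))) [1..<Suc (length xs)] = map h xs"
    by (rule nth_equalityI) (simp_all del: upt_Suc)
  then show ?thesis by (simp add: ordered_prod_def list_prod_def)
qed

lemma ordered_prod_eq_list_prod: "ordered_prod G f k = list_prod G (map f [1..<Suc k])"
  by (simp add: ordered_prod_def list_prod_def)

text \<open>Condition (2) is stated for lists, which concatenate under multiplication. The empty
  list is included since it stands for the neutral element of the relation subgroup
  \<open>R\<close>.\<close>

lemma weakly_embeddable_if:
  fixes A :: "('a, 'r) monoid_scheme" and B :: "('b, 's) monoid_scheme" and D :: "('d, 't) monoid_scheme"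
  assumes dvd: "n dvd m div gcd 2 m"
    and HA: "half_amalgam A B D \<alpha> \<beta> m n" and HB: "half_amalgam B A D \<beta> \<alpha> m n"
    and prod_iff: "\<And>L d. set L \<subseteq> matched n A B D \<alpha> \<beta> \<Longrightarrow> d \<in> carrier D \<Longrightarrow>
      list_prod A (map (\<lambda>(a, v, u, b). commutator A a (\<alpha> v)) L) = \<alpha> d \<longleftrightarrow>
      list_prod B (map (\<lambda>(a, v, u, b). commutator B (\<beta> u) b) L) = \<beta> d"
  shows "weakly_embeddable m n A B D \<alpha> \<beta>"
proof -
  define kA where "kA = (\<lambda>(a, v, u :: 'd, b :: 'b). commutator A a (\<alpha> v))"
  define kB where "kB = (\<lambda>(a :: 'a, v :: 'd, u, b). commutator B (\<beta> u) b)"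
  note prod_iff = prod_iff[folded kA_def kB_def]
  have kA: "kA (a, v, u, b) = commutator A a (\<alpha> v)" for a v u b by (simp add: kA_def)
  have kB: "kB (a, v, u, b) = commutator B (\<beta> u) b" for a v u b by (simp add: kB_def)
  interpret HA: half_amalgam A B D \<alpha> \<beta> m n by (rule HA)
  interpret HB: half_amalgam B A D \<beta> \<alpha> m n by (rule HB)
  interpret NA: normal "verbal n A" A by (rule HA.A.normal_verbal)
  interpret NB: normal "verbal n B" B by (rule HA.B.normal_verbal)
  note verbal_A = HA.A.subgroup_verbal and verbal_B = HA.B.subgroup_verbal
  \<comment> \<open>The torsion parts contain all commutators and have exponent n, which passes to
    \<open>C\<close> and then to \<open>E\<close>; the full verbal subgroups would not ensure
    this.\<close>
  define S where "S = A\<lparr>carrier := HA.A.torsion_verbal\<rparr>"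
  define T where "T = B\<lparr>carrier := HA.B.torsion_verbal\<rparr>"
  interpret S: comm_group S unfolding S_def by (rule HA.A.comm_group_torsion_verbal)
  interpret T: comm_group T unfolding T_def by (rule HA.B.comm_group_torsion_verbal)
  have S_simps: "carrier S = HA.A.torsion_verbal" "\<one>\<^bsub>S\<^esub> = \<one>\<^bsub>A\<^esub>" "x \<otimes>\<^bsub>S\<^esub> y = x \<otimes>\<^bsub>A\<^esub> y" for x y
    by (simp_all add: S_def)
  have T_simps: "carrier T = HA.B.torsion_verbal" "\<one>\<^bsub>T\<^esub> = \<one>\<^bsub>B\<^esub>" "x \<otimes>\<^bsub>T\<^esub> y = x \<otimes>\<^bsub>B\<^esub> y" for x y
    by (simp_all add: T_def)
  have S_inv: "inv\<^bsub>S\<^esub> x = inv\<^bsub>A\<^esub> x" if "x \<in> carrier S" for x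
    using that unfolding S_def
    by (intro HA.A.m_inv_consistent HA.A.subgroup_torsion_verbal) simp
  have T_inv: "inv\<^bsub>T\<^esub> x = inv\<^bsub>B\<^esub> x" if "x \<in> carrier T" for x
    using that unfolding T_def
    by (intro HA.B.m_inv_consistent HA.B.subgroup_torsion_verbal) simp
  have comm_S: "commutator A x y \<in> carrier S" if "x \<in> carrier A" "y \<in> carrier A" for x y
    using HA.A.commutator_in_torsion_verbal[OF that] by (simp add: S_simps)
  have comm_T: "commutator B x y \<in> carrier T" if "x \<in> carrier B" "y \<in> carrier B" for x y
    using HA.B.commutator_in_torsion_verbal[OF that] by (simp add: T_simps)
  have S_car: "x \<in> carrier A" if "x \<in> carrier S" for x
    using that HA.A.verbal_carrier by (simp add: S_simps)
  have T_car: "x \<in> carrier B" if "x \<in> carrier T" for x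
    using that HA.B.verbal_carrier by (simp add: T_simps)

  define K where "K = S \<times>\<times> T"
  interpret K: comm_group K unfolding K_def by (intro comm_group_DirProd S.comm_group_axioms T.comm_group_axioms)
  have K_simps: "carrier K = carrier S \<times> carrier T" "\<one>\<^bsub>K\<^esub> = (\<one>\<^bsub>A\<^esub>, \<one>\<^bsub>B\<^esub>)"
    "(x, y) \<otimes>\<^bsub>K\<^esub> (x', y') = (x \<otimes>\<^bsub>A\<^esub> x', y \<otimes>\<^bsub>B\<^esub> y')" for x y x' y'
    by (simp_all add: K_def S_simps T_simps)
  have K_inv: "inv\<^bsub>K\<^esub> (x, y) = (inv\<^bsub>A\<^esub> x, inv\<^bsub>B\<^esub> y)" if "x \<in> carrier S" "y \<in> carrier T" for x y
    unfolding K_def using that by (simp add: S_inv T_inv)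

  \<comment> \<open>Factoring these pairs out of S x T imposes [a, v] = [u, b] for all matched
    tuples, which are the relations \<open>compat\<close> asks for.\<close>
  define pairs where "pairs = (\<lambda>(a, v, u, b). (commutator A a (\<alpha> v), inv\<^bsub>B\<^esub> commutator B (\<beta> u) b)) ` matched n A B D \<alpha> \<beta>"
  define R where "R = generate K pairs"
  have pairs: "pairs \<subseteq> carrier K"
    using comm_S comm_T T_inv T.inv_closed
    by (fastforce simp: pairs_def matched_def K_simps)
  have R_sub: "subgroup R K" unfolding R_def by (rule K.generate_is_subgroup[OF pairs])
  \<comment> \<open>Replacing a and u by their inverses inverts both commutators. Thus elements of
    \<open>R\<close> are products of generators without inverses, the only products that condition
    (2) speaks about.\<close>
  have matched_inv: "(inv\<^bsub>A\<^esub> a, v, inv\<^bsub>D\<^esub> u, b) \<in> matched n A B D \<alpha> \<beta>"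
    if m: "(a, v, u, b) \<in> matched n A B D \<alpha> \<beta>" for a v u b
  proof -
    obtain q a' b' where q: "q > 0" "q dvd n" "a' \<in> verbal n A" "a [^]\<^bsub>A\<^esub> q \<otimes>\<^bsub>A\<^esub> a' = \<alpha> u"
      "b' \<in> verbal n B" "b [^]\<^bsub>B\<^esub> q \<otimes>\<^bsub>B\<^esub> b' = \<beta> v" and c: "a \<in> carrier A" "v \<in> carrier D" "u \<in> carrier D" "b \<in> carrier B"
      using m by (auto simp: matched_def)
    have ac: "a' \<in> carrier A" using q HA.A.verbal_carrier by simp
    have "inv\<^bsub>A\<^esub> (\<alpha> u) = inv\<^bsub>A\<^esub> (a' \<otimes>\<^bsub>A\<^esub> a [^]\<^bsub>A\<^esub> q)"
      using q c HA.A.verbal_commutes[of a' "a [^]\<^bsub>A\<^esub> q"] by simp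
    then have "(inv\<^bsub>A\<^esub> a) [^]\<^bsub>A\<^esub> q \<otimes>\<^bsub>A\<^esub> inv\<^bsub>A\<^esub> a' = \<alpha> (inv\<^bsub>D\<^esub> u)"
      using c ac by (simp add: HA.A.inv_mult_group HA.A.nat_pow_inv)
    moreover have "inv\<^bsub>A\<^esub> a' \<in> verbal n A" using subgroup.m_inv_closed[OF verbal_A] q by simp
    ultimately show ?thesis using q c by (auto simp: matched_def)
  qed
  have R_list: "\<exists>L. set L \<subseteq> matched n A B D \<alpha> \<beta> \<and>
      fst r = list_prod A (map kA L) \<and>
      inv\<^bsub>B\<^esub> (snd r) = list_prod B (map kB L)" if "r \<in> R" for r
    using that unfolding R_def
  proof (induction r rule: generate.induct)
    case one
    show ?case by (rule exI[of _ "[]"]) (simp add: K_simps)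
  next
    case (incl h)
    then obtain a v u b where h: "(a, v, u, b) \<in> matched n A B D \<alpha> \<beta>"
      "h = (commutator A a (\<alpha> v), inv\<^bsub>B\<^esub> commutator B (\<beta> u) b)" by (auto simp: pairs_def)
    then show ?case by (intro exI[of _ "[(a, v, u, b)]"]) (auto simp: matched_def kA kB)
  next
    case (inv h)
    then obtain a v u b where h: "(a, v, u, b) \<in> matched n A B D \<alpha> \<beta>"
      "h = (commutator A a (\<alpha> v), inv\<^bsub>B\<^esub> commutator B (\<beta> u) b)" by (auto simp: pairs_def)
    then have c: "a \<in> carrier A" "v \<in> carrier D" "u \<in> carrier D" "b \<in> carrier B" by (auto simp: matched_def)
    have "inv\<^bsub>B\<^esub> commutator B (\<beta> u) b \<in> carrier T"
      using c comm_T T_inv T.inv_closed by (metis HA.\<beta>.hom_closed)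
    then have "inv\<^bsub>K\<^esub> h = (commutator A (inv\<^bsub>A\<^esub> a) (\<alpha> v), commutator B (\<beta> u) b)"
      using c comm_S by (simp add: h(2) K_inv HA.A.commutator_inv_left)
    then show ?case using c matched_inv[OF h(1)]
      by (intro exI[of _ "[(inv\<^bsub>A\<^esub> a, v, inv\<^bsub>D\<^esub> u, b)]"]) (simp add: HA.B.commutator_inv_left kA kB)
  next
    case (eng h1 h2)
    then obtain L1 L2 where L: "set L1 \<subseteq> matched n A B D \<alpha> \<beta>" "set L2 \<subseteq> matched n A B D \<alpha> \<beta>"
      "fst h1 = list_prod A (map kA L1)"
      "inv\<^bsub>B\<^esub> (snd h1) = list_prod B (map kB L1)"
      "fst h2 = list_prod A (map kA L2)"
      "inv\<^bsub>B\<^esub> (snd h2) = list_prod B (map kB L2)" by blast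
    have "h1 \<in> carrier K" "h2 \<in> carrier K"
      using eng.hyps K.generate_in_carrier[OF pairs] by auto
    then obtain x1 y1 x2 y2 where h: "h1 = (x1, y1)" "h2 = (x2, y2)"
      "x1 \<in> carrier S" "y1 \<in> carrier T" "x2 \<in> carrier S" "y2 \<in> carrier T"
      by (cases h1, cases h2) (auto simp: K_simps)
    have A_sub: "set (map kA L) \<subseteq> carrier A"
      and B_sub: "set (map kB L) \<subseteq> carrier B"
      if "set L \<subseteq> matched n A B D \<alpha> \<beta>" for L
      using that by (auto simp: matched_def kA kB)
    \<comment> \<open>The second coordinate of a generator is an inverse, so inversion must preserve
      the order of the factors; it does because they lie in V(B) and commute.\<close>
    have "inv\<^bsub>B\<^esub> (y1 \<otimes>\<^bsub>B\<^esub> y2) = inv\<^bsub>B\<^esub> (y2 \<otimes>\<^bsub>B\<^esub> y1)"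
      using h HA.B.verbal_commutes[of y1 y2] T_car by (simp add: T_simps)
    then have "inv\<^bsub>B\<^esub> (y1 \<otimes>\<^bsub>B\<^esub> y2) = inv\<^bsub>B\<^esub> y1 \<otimes>\<^bsub>B\<^esub> inv\<^bsub>B\<^esub> y2"
      using h T_car by (simp add: HA.B.inv_mult_group)
    then show ?case
      using L h HA.A.list_prod_append[OF A_sub[OF L(1)] A_sub[OF L(2)]]
        HA.B.list_prod_append[OF B_sub[OF L(1)] B_sub[OF L(2)]]
      by (intro exI[of _ "L1 @ L2"]) (simp add: K_simps)
  qed

  define C where "C = K Mod R"
  define \<pi> where "\<pi> x = R #>\<^bsub>K\<^esub> x" for x
  interpret R: normal R K using K.subgroup_imp_normal[OF R_sub] .
  interpret C: comm_group C unfolding C_def by (rule K.abelian_FactGroup[OF R_sub])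
  interpret \<pi>: group_hom K C \<pi> by unfold_locales (unfold C_def \<pi>_def, rule R.r_coset_hom_Mod)
  have \<pi>_eq: "\<pi> (r \<otimes>\<^bsub>K\<^esub> x) = \<pi> x" if "r \<in> R" "x \<in> carrier K" for r x
    unfolding \<pi>_def using K.rcoset_mult_left[OF R_sub that] .
  define jA where "jA x = \<pi> (x, \<one>\<^bsub>B\<^esub>)" for x
  define jB where "jB y = \<pi> (\<one>\<^bsub>A\<^esub>, y)" for y
  have one_ST: "\<one>\<^bsub>A\<^esub> \<in> carrier S" "\<one>\<^bsub>B\<^esub> \<in> carrier T"
    using S.one_closed T.one_closed by (simp_all only: S_simps T_simps)
  have jA_closed: "jA x \<in> carrier C" if "x \<in> carrier S" for x
    using that one_ST by (simp add: jA_def K_simps)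
  have jB_closed: "jB x \<in> carrier C" if "x \<in> carrier T" for x
    using that one_ST by (simp add: jB_def K_simps)
  have jA_mult: "jA (x \<otimes>\<^bsub>A\<^esub> y) = jA x \<otimes>\<^bsub>C\<^esub> jA y" if "x \<in> carrier S" "y \<in> carrier S" for x y
    using that one_ST \<pi>.hom_mult[of "(x, \<one>\<^bsub>B\<^esub>)" "(y, \<one>\<^bsub>B\<^esub>)"] by (simp add: jA_def K_simps(1,3))
  have jB_mult: "jB (x \<otimes>\<^bsub>B\<^esub> y) = jB x \<otimes>\<^bsub>C\<^esub> jB y" if "x \<in> carrier T" "y \<in> carrier T" for x y
    using that one_ST \<pi>.hom_mult[of "(\<one>\<^bsub>A\<^esub>, x)" "(\<one>\<^bsub>A\<^esub>, y)"] by (simp add: jB_def K_simps(1,3))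
  define f where "f \<xi> \<eta> = jA (HA.comm_map \<xi> \<eta>)" for \<xi> \<eta>
  \<comment> \<open>The map \<open>HB.comm_map\<close> yields [b, d], whereas \<open>g\<close> has
    to give [d, b]; hence the inverse.\<close>
  define g where "g \<xi> \<eta> = jB (inv\<^bsub>B\<^esub> HB.comm_map \<eta> \<xi>)" for \<xi> \<eta>
  have f_eq: "f (verbal n A #>\<^bsub>A\<^esub> a) (verbal n B #>\<^bsub>B\<^esub> \<beta> d) = jA (commutator A a (\<alpha> d))"
    if "a \<in> carrier A" "d \<in> carrier D" for a d
    using that by (simp add: f_def HA.comm_map_eq)
  have g_eq: "g (verbal n A #>\<^bsub>A\<^esub> \<alpha> d) (verbal n B #>\<^bsub>B\<^esub> b) = jB (commutator B (\<beta> d) b)"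
    if "b \<in> carrier B" "d \<in> carrier D" for b d
    using that HA.B.commutator_swap[of b "\<beta> d"] by (simp add: g_def HB.comm_map_eq)
  have HA_closed: "HA.comm_map \<xi> \<eta> \<in> carrier S"
    if "\<xi> \<in> carrier (A Mod verbal n A)" "\<eta> \<in> HA.D_image" for \<xi> \<eta>
    using HA.comm_map_closed[OF that] by (simp add: S_simps)
  have HB_closed: "HB.comm_map \<eta> \<xi> \<in> carrier T"
    if "\<eta> \<in> carrier (B Mod verbal n B)" "\<xi> \<in> HB.D_image" for \<xi> \<eta>
    using HB.comm_map_closed[OF that] by (simp add: T_simps)
  have T_inv_closed: "inv\<^bsub>B\<^esub> y \<in> carrier T" if "y \<in> carrier T" for y
    using T.inv_closed[OF that] T_inv[OF that] by simp
  have jB_inv_mult: "jB (inv\<^bsub>B\<^esub> (y \<otimes>\<^bsub>B\<^esub> y')) = jB (inv\<^bsub>B\<^esub> y) \<otimes>\<^bsub>C\<^esub> jB (inv\<^bsub>B\<^esub> y')"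
    if "y \<in> carrier T" "y' \<in> carrier T" for y y'
  proof -
    have "y \<otimes>\<^bsub>B\<^esub> y' = y' \<otimes>\<^bsub>B\<^esub> y" using T.m_comm[OF that] by (simp add: T_simps)
    then have "inv\<^bsub>B\<^esub> (y \<otimes>\<^bsub>B\<^esub> y') = inv\<^bsub>B\<^esub> y \<otimes>\<^bsub>B\<^esub> inv\<^bsub>B\<^esub> y'"
      using that T_car by (simp add: HA.B.inv_mult_group)
    then show ?thesis using that by (simp add: jB_mult T_inv_closed)
  qed

  interpret pb: partial_bilinear "A Mod verbal n A" "B Mod verbal n B" C HB.D_image HA.D_image f g n
  proof (intro partial_bilinear.intro partial_bilinear_axioms.intro HA.A.comm_group_quotient
      HA.B.comm_group_quotient C.comm_group_axioms HA.subgroup_D_image HB.subgroup_D_image)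
    fix q :: nat and \<xi> \<eta>
    assume q: "q > 0" "q dvd n" and "\<xi> \<in> carrier (A Mod verbal n A)" "\<eta> \<in> carrier (B Mod verbal n B)"
      and \<xi>q: "\<xi> [^]\<^bsub>A Mod verbal n A\<^esub> q \<in> HB.D_image" and \<eta>q: "\<eta> [^]\<^bsub>B Mod verbal n B\<^esub> q \<in> HA.D_image"
    then obtain a b where ab: "a \<in> carrier A" "b \<in> carrier B" "\<xi> = verbal n A #>\<^bsub>A\<^esub> a" "\<eta> = verbal n B #>\<^bsub>B\<^esub> b"
      by (auto simp: carrier_FactGroup)
    \<comment> \<open>That the q-th powers of the classes lie in the images of D means that a^q and
      b^q are elements of D up to verbal factors. Those factors are the a' and b' of condition
      (2).\<close>
    obtain u where u: "u \<in> carrier D" "verbal n A #>\<^bsub>A\<^esub> \<alpha> u = verbal n A #>\<^bsub>A\<^esub> a [^]\<^bsub>A\<^esub> q"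
      using \<xi>q ab by (auto simp: HB.D_image_def NA.FactGroup_pow)
    obtain v where v: "v \<in> carrier D" "verbal n B #>\<^bsub>B\<^esub> \<beta> v = verbal n B #>\<^bsub>B\<^esub> b [^]\<^bsub>B\<^esub> q"
      using \<eta>q ab by (auto simp: HA.D_image_def NB.FactGroup_pow)
    obtain a' where a': "a' \<in> verbal n A" "\<alpha> u = a' \<otimes>\<^bsub>A\<^esub> a [^]\<^bsub>A\<^esub> q"
      using HA.A.rcoset_eqD[OF verbal_A _ _ u(2)] u ab by auto
    obtain b' where b': "b' \<in> verbal n B" "\<beta> v = b' \<otimes>\<^bsub>B\<^esub> b [^]\<^bsub>B\<^esub> q"
      using HA.B.rcoset_eqD[OF verbal_B _ _ v(2)] v ab by auto
    have "a [^]\<^bsub>A\<^esub> q \<otimes>\<^bsub>A\<^esub> a' = \<alpha> u" "b [^]\<^bsub>B\<^esub> q \<otimes>\<^bsub>B\<^esub> b' = \<beta> v"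
      using a' b' ab HA.A.verbal_commutes[of a' "a [^]\<^bsub>A\<^esub> q"] HA.B.verbal_commutes[of b' "b [^]\<^bsub>B\<^esub> q"] by simp_all
    then have "(a, v, u, b) \<in> matched n A B D \<alpha> \<beta>"
      using q u v ab a' b' by (auto simp: matched_def)
    then have "(commutator A a (\<alpha> v), inv\<^bsub>B\<^esub> commutator B (\<beta> u) b) \<in> pairs"
      unfolding pairs_def by force
    then have r: "(commutator A a (\<alpha> v), inv\<^bsub>B\<^esub> commutator B (\<beta> u) b) \<in> R"
      unfolding R_def by (rule generate.incl)
    have "jA (commutator A a (\<alpha> v)) = jB (commutator B (\<beta> u) b)"
      using \<pi>_eq[OF r, of "(\<one>\<^bsub>A\<^esub>, commutator B (\<beta> u) b)"] ab u v one_ST comm_T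
      by (simp add: jA_def jB_def K_simps(1,3))
    moreover have "\<xi> [^]\<^bsub>A Mod verbal n A\<^esub> q = verbal n A #>\<^bsub>A\<^esub> \<alpha> u" "\<eta> [^]\<^bsub>B Mod verbal n B\<^esub> q = verbal n B #>\<^bsub>B\<^esub> \<beta> v"
      using ab u v by (simp_all add: NA.FactGroup_pow NB.FactGroup_pow)
    ultimately show "f \<xi> (\<eta> [^]\<^bsub>B Mod verbal n B\<^esub> q) = g (\<xi> [^]\<^bsub>A Mod verbal n A\<^esub> q) \<eta>"
      using ab u(1) v(1) by (simp add: f_eq g_eq)
  qed (auto simp: f_def g_def jA_closed jB_closed HA_closed HB_closed HA.comm_map_mult_left
      HA.comm_map_mult_right HB.comm_map_mult_left HB.comm_map_mult_right jA_mult jB_inv_mult T_inv_closed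
      HA.A.quotient_pow_n HA.B.quotient_pow_n simp del: mult_FactGroup one_FactGroup)

  have exp_C: "x [^]\<^bsub>C\<^esub> n = \<one>\<^bsub>C\<^esub>" if x: "x \<in> carrier C" for x
  proof -
    obtain s t where st: "s \<in> carrier S" "t \<in> carrier T" "x = \<pi> (s, t)"
      using x by (auto simp: C_def carrier_FactGroup \<pi>_def K_simps)
    have "s [^]\<^bsub>S\<^esub> n = \<one>\<^bsub>S\<^esub>" "t [^]\<^bsub>T\<^esub> n = \<one>\<^bsub>T\<^esub>"
      using st HA.A.nat_pow_consistent[of s n] HA.B.nat_pow_consistent[of t n] by (simp_all add: S_def T_def)
    then have "(s, t) [^]\<^bsub>K\<^esub> n = \<one>\<^bsub>K\<^esub>" by (simp add: K_def nat_pow_DirProd)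
    then show ?thesis using st \<pi>.hom_nat_pow[of "(s, t)" n] by (simp add: K_simps(1))
  qed
  obtain E :: "(('b set \<Rightarrow> 'a set) \<times> ('a \<times> 'b) set) set monoid" and \<iota> b
    where E: "comm_group E" "\<forall>e\<in>carrier E. e [^]\<^bsub>E\<^esub> n = \<one>\<^bsub>E\<^esub>"
      and \<iota>: "\<iota> \<in> hom C E" "inj_on \<iota> (carrier C)"
      and b: "\<forall>x\<in>carrier (A Mod verbal n A). \<forall>y\<in>carrier (B Mod verbal n B). b x y \<in> carrier E"
      "\<forall>x\<in>carrier (A Mod verbal n A). \<forall>x'\<in>carrier (A Mod verbal n A). \<forall>y\<in>carrier (B Mod verbal n B).
        b (x \<otimes>\<^bsub>A Mod verbal n A\<^esub> x') y = b x y \<otimes>\<^bsub>E\<^esub> b x' y"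
      "\<forall>x\<in>carrier (A Mod verbal n A). \<forall>y\<in>carrier (B Mod verbal n B). \<forall>y'\<in>carrier (B Mod verbal n B).
        b x (y \<otimes>\<^bsub>B Mod verbal n B\<^esub> y') = b x y \<otimes>\<^bsub>E\<^esub> b x y'"
      and b_f: "\<forall>x\<in>carrier (A Mod verbal n A). \<forall>v\<in>HA.D_image. b x v = \<iota> (f x v)"
      and b_g: "\<forall>u\<in>HB.D_image. \<forall>y\<in>carrier (B Mod verbal n B). b u y = \<iota> (g u y)"
    by (rule pb.bilinear_extension[OF exp_C])
  note E = E(1) E(2)[rule_format] and b = b[rule_format]
  interpret E: comm_group E by (rule E(1))
  interpret \<iota>: group_hom C E \<iota> by unfold_locales (rule \<iota>(1))
  define c where "c x y = b (verbal n A #>\<^bsub>A\<^esub> x) (verbal n B #>\<^bsub>B\<^esub> y)" for x y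
  have qA: "verbal n A #>\<^bsub>A\<^esub> x \<in> carrier (A Mod verbal n A)" if "x \<in> carrier A" for x
    using that by (auto simp: carrier_FactGroup)
  have qB: "verbal n B #>\<^bsub>B\<^esub> x \<in> carrier (B Mod verbal n B)" if "x \<in> carrier B" for x
    using that by (auto simp: carrier_FactGroup)
  interpret tp: twisted_product A B E m n c
  proof
    fix x x' y assume x: "x \<in> carrier A" "x' \<in> carrier A" and y: "y \<in> carrier B"
    show "c (x \<otimes>\<^bsub>A\<^esub> x') y = c x y \<otimes>\<^bsub>E\<^esub> c x' y"
      using b(2)[OF qA[OF x(1)] qA[OF x(2)] qB[OF y]] x by (simp add: c_def NA.rcos_sum)
  next
    fix x y y' assume x: "x \<in> carrier A" and y: "y \<in> carrier B" "y' \<in> carrier B"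
    show "c x (y \<otimes>\<^bsub>B\<^esub> y') = c x y \<otimes>\<^bsub>E\<^esub> c x y'"
      using b(3)[OF qA[OF x] qB[OF y(1)] qB[OF y(2)]] y by (simp add: c_def NB.rcos_sum)
  qed (use dvd E(2) b(1) qA qB in \<open>auto simp: c_def\<close>)
  define \<sigma> where "\<sigma> x = \<iota> (jA x)" for x
  define \<tau> where "\<tau> y = \<iota> (jB y)" for y
  \<comment> \<open>Equality in \<open>E\<close> descends to \<open>C\<close> because
    \<open>\<iota>\<close> is injective, so (x, inv y) lies in \<open>R\<close>. Then x and y are
    the two products of one matched list, and condition (2) compares them with d.\<close>
  have sep: "x = \<alpha> d \<longleftrightarrow> y = \<beta> d"
    if x: "x \<in> carrier S" and y: "y \<in> carrier T" and eq: "\<sigma> x = \<tau> y" and d: "d \<in> carrier D" for x y d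
  proof -
    have "jA x = jB y" using inj_onD[OF \<iota>(2)] eq x y jA_closed jB_closed by (simp add: \<sigma>_def \<tau>_def)
    have "\<pi> (x, inv\<^bsub>B\<^esub> y) = jA x \<otimes>\<^bsub>C\<^esub> jB (inv\<^bsub>B\<^esub> y)"
      using \<pi>.hom_mult[of "(x, \<one>\<^bsub>B\<^esub>)" "(\<one>\<^bsub>A\<^esub>, inv\<^bsub>B\<^esub> y)"] x y one_ST T_inv_closed S_car T_car
      by (simp add: jA_def jB_def K_simps(1,3))
    also have "\<dots> = jB y \<otimes>\<^bsub>C\<^esub> jB (inv\<^bsub>B\<^esub> y)" using \<open>jA x = jB y\<close> by simp
    also have "\<dots> = jB \<one>\<^bsub>B\<^esub>" using y T_inv_closed T_car by (simp flip: jB_mult)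
    also have "\<dots> = \<one>\<^bsub>C\<^esub>" using \<pi>.hom_one by (simp add: jB_def K_simps(2))
    finally have "(x, inv\<^bsub>B\<^esub> y) \<in> R"
      using K.coset_join1[OF _ _ R_sub] R.subset x T_inv_closed[OF y] by (simp add: \<pi>_def C_def K_simps(1))
    from R_list[OF this] obtain L where L: "set L \<subseteq> matched n A B D \<alpha> \<beta>"
      "x = list_prod A (map kA L)"
      "y = list_prod B (map kB L)"
      using T_car[OF y] by auto
    show ?thesis using prod_iff[OF L(1) d] by (simp flip: L(2,3))
  qed
  have D: "group D" by unfold_locales
  obtain M :: "('a \<times> 'b \<times> (('b set \<Rightarrow> 'a set) \<times> ('a \<times> 'b) set) set) set monoid" and \<phi> \<psi>
    where "weak_embedding m n A B D \<alpha> \<beta> M \<phi> \<psi>"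
  proof (rule tp.weak_embedding_quotient[OF D HA.\<alpha>.homh HA.\<beta>.homh HA.A.subgroup_torsion_verbal _ _
        HA.B.subgroup_torsion_verbal, folded S_simps(1) T_simps(1)])
    show "carrier S \<subseteq> verbal n A" "carrier T \<subseteq> verbal n B" by (auto simp: S_simps T_simps)
    show "\<sigma> \<in> hom (A\<lparr>carrier := carrier S\<rparr>) E"
      by (rule homI) (auto simp: \<sigma>_def jA_closed jA_mult)
    show "\<tau> \<in> hom (B\<lparr>carrier := carrier T\<rparr>) E"
      by (rule homI) (auto simp: \<tau>_def jB_closed jB_mult)
    show "commutator A a (\<alpha> d) \<in> carrier S" if "a \<in> carrier A" "d \<in> carrier D" for a d
      using that by (intro comm_S) auto
    show "commutator B (\<beta> d) b \<in> carrier T" if "b \<in> carrier B" "d \<in> carrier D" for b d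
      using that by (intro comm_T) auto
    show "c a (\<beta> d) = \<sigma> (commutator A a (\<alpha> d))" if "a \<in> carrier A" "d \<in> carrier D" for a d
      using that qA by (simp add: c_def \<sigma>_def b_f f_eq HA.D_image_def)
    show "c (\<alpha> d) b = \<tau> (commutator B (\<beta> d) b)" if "b \<in> carrier B" "d \<in> carrier D" for b d
      using that qB by (simp add: c_def \<tau>_def b_g g_eq HB.D_image_def)
    show "x = \<alpha> d \<longleftrightarrow> y = \<beta> d"
      if "x \<in> carrier S" "y \<in> carrier T" "\<sigma> x = \<tau> y" "d \<in> carrier D" for x y d
      using sep that .
  qed
  \<comment> \<open>The constructed group lives over sets of triples; this transfers the embedding
    to words over A + B.\<close>
  then show ?thesis by (rule weakly_embeddableI[OF HA.A.group_axioms HA.B.group_axioms])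
qed

section \<open>Necessity of the two conditions\<close>

lemma hom_list_prod:
  assumes "group_hom G H h" "set xs \<subseteq> carrier G"
  shows "h (list_prod G xs) = list_prod H (map h xs)"
proof -
  interpret group_hom G H h by fact
  show ?thesis using assms(2) by (induction xs) (auto simp: G.list_prod_closed)
qed

lemma (in group_hom) hom_commutator:
  "x \<in> carrier G \<Longrightarrow> y \<in> carrier G \<Longrightarrow> h (commutator G x y) = commutator H (h x) (h y)"
  by (simp add: commutator_def)

text \<open>The preimage of the center of M is a subgroup containing all n-th powers and
  commutators. Thus verbal elements of A become central even against the image of B.\<close>

lemma hom_verbal_center:
  assumes "group_hom G M h" "in_variety m n M" "x \<in> verbal n G"
  shows "h x \<in> center M"
proof -
  interpret M: variety_group M m n
    using assms(2) by (simp add: variety_group_def variety_group_axioms_def in_variety_def)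
  interpret h: group_hom G M h by fact
  have "subgroup {x \<in> carrier G. h x \<in> center M} G"
  proof (rule h.G.subgroupI)
    have "\<one>\<^bsub>G\<^esub> \<in> {x \<in> carrier G. h x \<in> center M}"
      using subgroup.one_closed[OF M.subgroup_center] by simp
    then show "{x \<in> carrier G. h x \<in> center M} \<noteq> {}" by blast
  qed (auto simp: subgroup.m_inv_closed[OF M.subgroup_center] subgroup.m_closed[OF M.subgroup_center])
  then have "verbal n G \<subseteq> {x \<in> carrier G. h x \<in> center M}"
    by (rule h.G.verbal_subset) (auto simp: h.hom_nat_pow M.pow_n_in_center h.hom_commutator M.commutator_in_center)
  then show ?thesis using assms(3) by blast
qed

text \<open>In M the common image of d is central as it comes from V(A); injectivity on B pulls this
  back.\<close>

lemma weak_embedding_imp_central: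
  assumes emb: "weak_embedding m n A B D \<alpha> \<beta> M \<phi> \<psi>" and A: "group A" and B: "group B"
    and \<beta>: "\<beta> \<in> hom D B" and d: "d \<in> carrier D" "\<alpha> d \<in> verbal n A"
  shows "\<beta> d \<in> center B"
proof -
  have M: "in_variety m n M" and \<phi>: "\<phi> \<in> hom A M" and \<psi>: "\<psi> \<in> hom B M" "inj_on \<psi> (carrier B)"
    and agree: "\<phi> (\<alpha> d) = \<psi> (\<beta> d)"
    using emb d by (auto simp: weak_embedding_def)
  have gM: "group M" using M by (simp add: in_variety_def)
  interpret \<psi>: group_hom B M \<psi> using B gM \<psi>(1) by (simp add: group_hom_def group_hom_axioms_def)
  have "group_hom A M \<phi>" using A gM \<phi> by (simp add: group_hom_def group_hom_axioms_def)
  from hom_verbal_center[OF this M d(2)] have central: "\<psi> (\<beta> d) \<in> center M" by (simp add: agree)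
  have \<beta>d: "\<beta> d \<in> carrier B" using \<beta> d(1) by (auto simp: hom_def)
  have "\<beta> d \<otimes>\<^bsub>B\<^esub> b = b \<otimes>\<^bsub>B\<^esub> \<beta> d" if b: "b \<in> carrier B" for b
    by (rule inj_onD[OF \<psi>(2)]) (use central b \<beta>d in \<open>auto simp: center_def\<close>)
  then show ?thesis using \<beta>d by (simp add: center_def)
qed

text \<open>Verbal factors become central in M, so both commutators attached to a matched tuple have
  the image [a, b]^q there. The two products therefore have the same image, and injectivity compares
  it with d on either side.\<close>

lemma weak_embedding_imp_prod_iff:
  fixes A :: "('a, 'r) monoid_scheme" and B :: "('b, 's) monoid_scheme" and D :: "('d, 't) monoid_scheme"
  assumes emb: "weak_embedding m n A B D \<alpha> \<beta> M \<phi> \<psi>" and \<alpha>: "group_hom D A \<alpha>" and \<beta>: "group_hom D B \<beta>"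
    and L: "set L \<subseteq> matched n A B D \<alpha> \<beta>" and d: "d \<in> carrier D"
  shows "list_prod A (map (\<lambda>(a, v, u, b). commutator A a (\<alpha> v)) L) = \<alpha> d \<longleftrightarrow>
    list_prod B (map (\<lambda>(a, v, u, b). commutator B (\<beta> u) b) L) = \<beta> d"
proof -
  interpret \<alpha>: group_hom D A \<alpha> by (rule \<alpha>)
  interpret \<beta>: group_hom D B \<beta> by (rule \<beta>)
  have M: "in_variety m n M" and \<phi>: "\<phi> \<in> hom A M" "inj_on \<phi> (carrier A)"
    and \<psi>: "\<psi> \<in> hom B M" "inj_on \<psi> (carrier B)"
    and agree: "\<And>d. d \<in> carrier D \<Longrightarrow> \<phi> (\<alpha> d) = \<psi> (\<beta> d)"
    using emb by (auto simp: weak_embedding_def)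
  have gM: "group M" using M by (simp add: in_variety_def)
  interpret M: variety_group M m n using gM M by (simp add: variety_group_def variety_group_axioms_def)
  interpret \<phi>: group_hom A M \<phi> using gM \<phi>(1) by unfold_locales
  interpret \<psi>: group_hom B M \<psi> using gM \<psi>(1) by unfold_locales
  define kA where "kA = (\<lambda>(a, v, u :: 'd, b :: 'b). commutator A a (\<alpha> v))"
  define kB where "kB = (\<lambda>(a :: 'a, v :: 'd, u, b). commutator B (\<beta> u) b)"
  have key: "kA x \<in> carrier A \<and> kB x \<in> carrier B \<and> \<phi> (kA x) = \<psi> (kB x)" if x: "x \<in> matched n A B D \<alpha> \<beta>" for x
  proof -
    obtain a v u b q a' b' where x: "x = (a, v, u, b)" "a \<in> carrier A" "v \<in> carrier D" "u \<in> carrier D" "b \<in> carrier B"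
      and a': "a' \<in> verbal n A" "a [^]\<^bsub>A\<^esub> (q :: nat) \<otimes>\<^bsub>A\<^esub> a' = \<alpha> u"
      and b': "b' \<in> verbal n B" "b [^]\<^bsub>B\<^esub> q \<otimes>\<^bsub>B\<^esub> b' = \<beta> v"
      using x by (auto simp: matched_def)
    \<comment> \<open>Taking the whole carrier in \<open>verbal_subset\<close> gives that a' is an
      element of A.\<close>
    have ca': "a' \<in> carrier A" "\<phi> a' \<in> center M"
      using a' hom_verbal_center[OF \<phi>.group_hom_axioms M] \<alpha>.H.verbal_subset[OF \<alpha>.H.subgroup_self] by auto
    have cb': "b' \<in> carrier B" "\<psi> b' \<in> center M"
      using b' hom_verbal_center[OF \<psi>.group_hom_axioms M] \<beta>.H.verbal_subset[OF \<beta>.H.subgroup_self] by auto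
    have "\<phi> (commutator A a (\<alpha> v)) = commutator M (\<phi> a) (\<psi> (\<beta> v))"
      using x by (simp add: \<phi>.hom_commutator agree)
    also have "\<dots> = commutator M (\<phi> a) (\<psi> b) [^]\<^bsub>M\<^esub> q"
      using x cb' by (simp add: \<psi>.hom_nat_pow M.commutator_mult_right M.commutator_pow_right
          M.commutator_center_right flip: b'(2))
    also have "\<dots> = commutator M (\<phi> (\<alpha> u)) (\<psi> b)"
      using x ca' by (simp add: \<phi>.hom_nat_pow M.commutator_mult_left M.commutator_pow_left
          M.commutator_center_left flip: a'(2))
    also have "\<dots> = \<psi> (commutator B (\<beta> u) b)"
      using x by (simp add: \<psi>.hom_commutator agree)
    finally show ?thesis using x by (simp add: kA_def kB_def)
  qed
  have A_sub: "set (map kA L) \<subseteq> carrier A" and B_sub: "set (map kB L) \<subseteq> carrier B"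
    using key L by auto
  have "map \<phi> (map kA L) = map \<psi> (map kB L)" using key L by auto
  then have eq: "\<phi> (list_prod A (map kA L)) = \<psi> (list_prod B (map kB L))"
    using hom_list_prod[OF \<phi>.group_hom_axioms A_sub] hom_list_prod[OF \<psi>.group_hom_axioms B_sub]
    by (simp only:)
  have "list_prod A (map kA L) = \<alpha> d \<longleftrightarrow> \<phi> (list_prod A (map kA L)) = \<phi> (\<alpha> d)"
    using \<phi>(2) d \<alpha>.H.list_prod_closed[OF A_sub] by (auto dest: inj_onD)
  also have "\<dots> \<longleftrightarrow> \<psi> (list_prod B (map kB L)) = \<psi> (\<beta> d)" using eq agree[OF d] by simp
  also have "\<dots> \<longleftrightarrow> list_prod B (map kB L) = \<beta> d"
    using \<psi>(2) d \<beta>.H.list_prod_closed[OF B_sub] by (auto dest: inj_onD)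
  finally show ?thesis unfolding kA_def kB_def .
qed

text \<open>The elements \<open>u i\<close> and \<open>v i\<close> of D name a_i^q a_i' and b_i^q
  b_i', so that each of them can be read in the other group as well.\<close>

theorem theorem2p4:
  fixes m n :: nat
    and A :: "('a, 'r) monoid_scheme"
    and B :: "('b, 's) monoid_scheme"
    and D :: "('d, 't) monoid_scheme"
    and \<alpha> :: "'d \<Rightarrow> 'a" and \<beta> :: "'d \<Rightarrow> 'b"
  assumes "n dvd m div gcd 2 m"
    and "amalgam m n A B D \<alpha> \<beta>"
  shows "weakly_embeddable m n A B D \<alpha> \<beta> \<longleftrightarrow>
    ((\<forall>d \<in> carrier D. \<alpha> d \<in> power_subgroup A n <#>\<^bsub>A\<^esub> commutator_subgroup A \<longrightarrow> \<beta> d \<in> center B) \<and>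
     (\<forall>d \<in> carrier D. \<beta> d \<in> power_subgroup B n <#>\<^bsub>B\<^esub> commutator_subgroup B \<longrightarrow> \<alpha> d \<in> center A)) \<and>
    (\<forall>(k :: nat) (q :: nat \<Rightarrow> nat) (a :: nat \<Rightarrow> 'a) (a' :: nat \<Rightarrow> 'a) (b :: nat \<Rightarrow> 'b) (b' :: nat \<Rightarrow> 'b)
        (u :: nat \<Rightarrow> 'd) (v :: nat \<Rightarrow> 'd).
       k > 0 \<longrightarrow>
       (\<forall>i \<in> {1..k}.
          q i > 0 \<and> q i dvd n \<and>
          a i \<in> carrier A \<and> a' i \<in> power_subgroup A n <#>\<^bsub>A\<^esub> commutator_subgroup A \<and>
          u i \<in> carrier D \<and> a i [^]\<^bsub>A\<^esub> q i \<otimes>\<^bsub>A\<^esub> a' i = \<alpha> (u i) \<and>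
          b i \<in> carrier B \<and> b' i \<in> power_subgroup B n <#>\<^bsub>B\<^esub> commutator_subgroup B \<and>
          v i \<in> carrier D \<and> b i [^]\<^bsub>B\<^esub> q i \<otimes>\<^bsub>B\<^esub> b' i = \<beta> (v i)) \<longrightarrow>
       (\<forall>d \<in> carrier D.
          ordered_prod A (\<lambda>i. commutator A (a i) (\<alpha> (v i))) k = \<alpha> d \<longleftrightarrow>
          ordered_prod B (\<lambda>i. commutator B (\<beta> (u i)) (b i)) k = \<beta> d))"
  (is "?emb \<longleftrightarrow> (?cA \<and> ?cB) \<and> ?prods")
proof -
  have varA: "in_variety m n A" and varB: "in_variety m n B" and varD: "in_variety m n D"
    and \<alpha>: "\<alpha> \<in> hom D A" "inj_on \<alpha> (carrier D)" and \<beta>: "\<beta> \<in> hom D B" "inj_on \<beta> (carrier D)"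
    using assms(2) by (auto simp: amalgam_def)
  have gA: "group A" and gB: "group B" and gD: "group D"
    using varA varB varD by (auto simp: in_variety_def)
  have vA: "variety_group A m n" and vB: "variety_group B m n"
    using gA gB varA varB by (auto simp: variety_group_def variety_group_axioms_def)
  have h\<alpha>: "group_hom D A \<alpha>" and h\<beta>: "group_hom D B \<beta>"
    using gA gB gD \<alpha>(1) \<beta>(1) by (auto simp: group_hom_def group_hom_axioms_def)
  show ?thesis
  proof
    assume ?emb
    then obtain M :: "('a + 'b) list monoid" and \<phi> \<psi> where emb: "weak_embedding m n A B D \<alpha> \<beta> M \<phi> \<psi>"
      by (auto simp: weakly_embeddable_def)
    then have emb': "weak_embedding m n B A D \<beta> \<alpha> M \<psi> \<phi>" by (auto simp: weak_embedding_def)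
    have ?cA using weak_embedding_imp_central[OF emb gA gB \<beta>(1)] by (simp add: verbal_def)
    moreover have ?cB using weak_embedding_imp_central[OF emb' gB gA \<alpha>(1)] by (simp add: verbal_def)
    moreover have ?prods
    proof (intro allI impI ballI)
      fix k :: nat and q :: "nat \<Rightarrow> nat" and a a' b b' u v d
      assume *: "\<forall>i\<in>{1..k}. q i > 0 \<and> q i dvd n \<and>
          a i \<in> carrier A \<and> a' i \<in> power_subgroup A n <#>\<^bsub>A\<^esub> commutator_subgroup A \<and>
          u i \<in> carrier D \<and> a i [^]\<^bsub>A\<^esub> q i \<otimes>\<^bsub>A\<^esub> a' i = \<alpha> (u i) \<and>
          b i \<in> carrier B \<and> b' i \<in> power_subgroup B n <#>\<^bsub>B\<^esub> commutator_subgroup B \<and>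
          v i \<in> carrier D \<and> b i [^]\<^bsub>B\<^esub> q i \<otimes>\<^bsub>B\<^esub> b' i = \<beta> (v i)"
        and d: "d \<in> carrier D"
      \<comment> \<open>The tuples are listed in the order 1, ..., k of the ordered
        products.\<close>
      define L where "L = map (\<lambda>i. (a i, v i, u i, b i)) [1..<Suc k]"
      have "(a i, v i, u i, b i) \<in> matched n A B D \<alpha> \<beta>" if "i \<in> {1..k}" for i
        using *[rule_format, OF that] unfolding matched_def verbal_def by blast
      then have "set L \<subseteq> matched n A B D \<alpha> \<beta>" by (auto simp: L_def simp del: upt_Suc)
      from weak_embedding_imp_prod_iff[OF emb h\<alpha> h\<beta> this d]
      show "ordered_prod A (\<lambda>i. commutator A (a i) (\<alpha> (v i))) k = \<alpha> d \<longleftrightarrow>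
          ordered_prod B (\<lambda>i. commutator B (\<beta> (u i)) (b i)) k = \<beta> d"
        by (simp add: L_def comp_def ordered_prod_eq_list_prod del: upt_Suc)
    qed
    ultimately show "(?cA \<and> ?cB) \<and> ?prods" by blast
  next
    assume conds: "(?cA \<and> ?cB) \<and> ?prods"
    then have cA: ?cA and cB: ?cB and prods: ?prods by blast+
    have HA: "half_amalgam A B D \<alpha> \<beta> m n"
      using vA vB h\<alpha> h\<beta> cB by (auto simp: half_amalgam_def half_amalgam_axioms_def verbal_def)
    have HB: "half_amalgam B A D \<beta> \<alpha> m n"
      using vA vB h\<alpha> h\<beta> cA by (auto simp: half_amalgam_def half_amalgam_axioms_def verbal_def)
    show ?emb
    proof (rule weakly_embeddable_if[OF assms(1) HA HB])
      fix L d assume L: "set L \<subseteq> matched n A B D \<alpha> \<beta>" and d: "d \<in> carrier D"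
      show "list_prod A (map (\<lambda>(a, v, u, b). commutator A a (\<alpha> v)) L) = \<alpha> d \<longleftrightarrow>
        list_prod B (map (\<lambda>(a, v, u, b). commutator B (\<beta> u) b) L) = \<beta> d"
      \<comment> \<open>Condition (2) has k > 0, so the empty product is settled directly: it equals
        the image of d exactly when d is trivial, on both sides.\<close>
      proof (cases "L = []")
        case True
        interpret \<alpha>: group_hom D A \<alpha> by (rule h\<alpha>)
        interpret \<beta>: group_hom D B \<beta> by (rule h\<beta>)
        have "\<one>\<^bsub>A\<^esub> = \<alpha> d \<longleftrightarrow> d = \<one>\<^bsub>D\<^esub>" "\<one>\<^bsub>B\<^esub> = \<beta> d \<longleftrightarrow> d = \<one>\<^bsub>D\<^esub>"
          using d \<alpha>(2) \<beta>(2) by (auto dest: inj_onD[of _ _ d "\<one>\<^bsub>D\<^esub>"])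
        with True show ?thesis by simp
      next
        case False
        define a where "a i = fst (L ! (i - 1))" for i
        define v where "v i = fst (snd (L ! (i - 1)))" for i
        define u where "u i = fst (snd (snd (L ! (i - 1))))" for i
        define b where "b i = snd (snd (snd (L ! (i - 1))))" for i
        have "\<forall>i\<in>{1..length L}. \<exists>q a' b'. q > 0 \<and> q dvd n \<and> a' \<in> verbal n A \<and>
          a i [^]\<^bsub>A\<^esub> q \<otimes>\<^bsub>A\<^esub> a' = \<alpha> (u i) \<and> b' \<in> verbal n B \<and> b i [^]\<^bsub>B\<^esub> q \<otimes>\<^bsub>B\<^esub> b' = \<beta> (v i) \<and>
          a i \<in> carrier A \<and> u i \<in> carrier D \<and> b i \<in> carrier B \<and> v i \<in> carrier D"
        proof
          fix i assume "i \<in> {1..length L}"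
          then have "L ! (i - 1) \<in> matched n A B D \<alpha> \<beta>" using L by (intro subsetD[OF L] nth_mem) auto
          then have "(a i, v i, u i, b i) \<in> matched n A B D \<alpha> \<beta>" by (simp add: a_def v_def u_def b_def)
          then show "\<exists>q a' b'. q > 0 \<and> q dvd n \<and> a' \<in> verbal n A \<and>
            a i [^]\<^bsub>A\<^esub> q \<otimes>\<^bsub>A\<^esub> a' = \<alpha> (u i) \<and> b' \<in> verbal n B \<and> b i [^]\<^bsub>B\<^esub> q \<otimes>\<^bsub>B\<^esub> b' = \<beta> (v i) \<and>
            a i \<in> carrier A \<and> u i \<in> carrier D \<and> b i \<in> carrier B \<and> v i \<in> carrier D"
            by (auto simp: matched_def)
        qed
        \<comment> \<open>The witnesses hidden in \<open>matched\<close> are chosen for each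
          position, giving the families over which condition (2) quantifies; outside 1, ..., length
          L their values are arbitrary.\<close>
        then obtain q a' b' where qab: "\<forall>i\<in>{1..length L}. q i > 0 \<and> q i dvd n \<and> a' i \<in> verbal n A \<and>
          a i [^]\<^bsub>A\<^esub> q i \<otimes>\<^bsub>A\<^esub> a' i = \<alpha> (u i) \<and> b' i \<in> verbal n B \<and> b i [^]\<^bsub>B\<^esub> q i \<otimes>\<^bsub>B\<^esub> b' i = \<beta> (v i) \<and>
          a i \<in> carrier A \<and> u i \<in> carrier D \<and> b i \<in> carrier B \<and> v i \<in> carrier D"
          by metis
        have "ordered_prod A (\<lambda>i. commutator A (a i) (\<alpha> (v i))) (length L) = \<alpha> d \<longleftrightarrow>
          ordered_prod B (\<lambda>i. commutator B (\<beta> (u i)) (b i)) (length L) = \<beta> d"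
          using False qab d
          by (intro prods[rule_format, of "length L" q a a' u b b' v d]) (simp_all add: verbal_def)
        then show ?thesis
          using ordered_prod_nth[of A "\<lambda>(a, v, u, b). commutator A a (\<alpha> v)" L]
            ordered_prod_nth[of B "\<lambda>(a, v, u, b). commutator B (\<beta> u) b" L]
          by (simp add: case_prod_beta a_def v_def u_def b_def)
      qed
    qed
  qed
qed

end
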